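(* Let $n\ge1$, $\hbar>0$ and $p,p'\in\mathbb{C}^n$. Then $\mathcal{A}_{p,\hbar}=\mathcal{A}_{p',\hbar}$ as Fréchet $^*$-algebras (with product $\star^\hbar_{\mathrm{Wick}}$ and complex conjugation as involution); that is, they coincide as subspaces of $C^\omega(\mathbb{C}^n)$, and their topologies and algebraic structures coincide.
   Context: Conventions: $\mathbb{N}=\{0,1,2,\dots\}$; $z=(z^1,\dots,z^n)$ are the standard holomorphic coordinates on $\mathbb{C}^n$; multiindex notation is the usual componentwise one; $\sum_{N=0}^\infty$ means summation over $N\in\mathbb{N}^n$ and $\sum_{I=0}^R$ summation over $I\in\mathbb{N}^n$ with $I\le R$. For $p\in\mathbb{C}^n$, $f\in C^\infty(\mathbb{C}^n)$, $m\in\mathbb{N}$, $\ell\in\{0,\dots,2^m-1\}$, $R,S\in\mathbb{N}^n$ define recursively, with values in $[0,+\infty]$, $$h^{p,\hbar}_{0,0,R,S}(f)=\sum_{N=0}^\infty\frac{(2\hbar)^{|R|+|S|+|N|}}{N!}\left|\frac{\partial^{|R|+|S|+|N|}f}{\partial z^R\partial\overline{z}^{N+S}}(p)\right|^2,$$ and for $m\ge1$ $$h^{p,\hbar}_{m,\ell,R,S}(f)=\sum_{N=0}^\infty\frac1{N!}\Big(\sum_{I=0}^R\sum_{J=0}^{N+S}\tbinom{R}{I}\tbinom{N+S}{J}h^{p,\hbar}_{m-1,\ell/2,I,J}(f)\Big)^2\quad(\ell\text{ even}),$$ $$h^{p,\hbar}_{m,\ell,R,S}(f)=\sum_{N=0}^\infty\frac1{N!}\Big(\sum_{I=0}^R\sum_{J=0}^{N+S}\tbinom{R}{I}\tbinom{N+S}{J}h^{p,\hbar}_{m-1,(\ell-1)/2,J,I}(f)\Big)^2\quad(\ell\text{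 odd}).$$ Put $\|f\|^{p,\hbar}_{m,\ell,R,S}=\big(h^{p,\hbar}_{m,\ell,R,S}(f)\big)^{1/2^{m+1}}$ and $\widetilde{\mathcal{A}}_{p,\hbar}=\{f\in C^\infty(\mathbb{C}^n)\mid \|f\|^{p,\hbar}_{m,\ell,R,S}<\infty\text{ for all }m,\ell,R,S\}$, a vector space on which these are seminorms. Define $\mathcal{A}_{p,\hbar}=\widetilde{\mathcal{A}}_{p,\hbar}/\{f\in C^\infty(\mathbb{C}^n)\mid \mathsf{j}^\infty_pf=0\}$ (quotient by the functions with vanishing $\infty$-jet at $p$), with the topology induced by all the seminorms; it is a Fréchet space. Every class has a unique real-analytic representative, so $\mathcal{A}_{p,\hbar}$ is identified with a subspace of $C^\omega(\mathbb{C}^n)$. The product $f\star^\hbar_{\mathrm{Wick}}g=\sum_{N=0}^\infty\frac{(2\hbar)^{|N|}}{N!}\frac{\partial^{|N|}f}{\partial z^N}\frac{\partial^{|N|}g}{\partial\overline{z}^N}$ converges absolutely in $\mathcal{A}_{p,\hbar}$ and makes it a Fréchet $^*$-algebra with complex conjugation as involution. *)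

theory Defs
  imports "HOL-Analysis.Analysis"
begin

section \<open>Multiindices\<close>

text \<open>Multiindices are elements of \<^typ>\<open>nat ^ 'n\<close>, with the componentwise addition and order of
  the library; \<^term>\<open>{..R}\<close> is the finite set of all multiindices below \<^term>\<open>R\<close>.\<close>

type_synonym 'n cfun = "complex ^ 'n \<Rightarrow> complex"

definition mi_abs :: "nat ^ 'n \<Rightarrow> nat" where
  "mi_abs N = (\<Sum>k\<in>UNIV. N $ k)"

definition mi_fact :: "nat ^ 'n \<Rightarrow> nat" where
  "mi_fact N = (\<Prod>k\<in>UNIV. fact (N $ k))"

definition mi_binom :: "nat ^ 'n \<Rightarrow> nat ^ 'n \<Rightarrow> nat" where
  "mi_binom R I = (\<Prod>k\<in>UNIV. (R $ k) choose (I $ k))"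


section \<open>Smooth functions, jets, real-analytic functions\<close>

definition dir_deriv :: "complex ^ 'n \<Rightarrow> 'n cfun \<Rightarrow> 'n cfun" where
  "dir_deriv v f = (\<lambda>x. frechet_derivative f (at x) v)"

fun dir_derivs :: "(complex ^ 'n) list \<Rightarrow> 'n cfun \<Rightarrow> 'n cfun" where
  "dir_derivs [] f = f"
| "dir_derivs (v # vs) f = dir_deriv v (dir_derivs vs f)"

text \<open>\<^const>\<open>frechet_derivative\<close> and \<^const>\<open>differentiable\<close> refer to \<open>\<real>\<close>-linear derivatives. A function
  is \<open>C\<^sup>\<infinity>\<close> iff all its iterated directional derivatives exist and are (totally) differentiable.\<close>

definition smooth :: "'n::finite cfun \<Rightarrow> bool" where
  "smooth f \<longleftrightarrow> (\<forall>vs x. dir_derivs vs f differentiable (at x))"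

definition jet_vanishes :: "complex ^ 'n \<Rightarrow> 'n cfun \<Rightarrow> bool" where
  "jet_vanishes p f \<longleftrightarrow> (\<forall>vs. dir_derivs vs f p = 0)"

text \<open>Local expansion into power series in the real coordinates \<open>Re z\<^sup>k\<close>, \<open>Im z\<^sup>k\<close>.\<close>

definition real_analytic :: "'n::finite cfun \<Rightarrow> bool" where
  "real_analytic f \<longleftrightarrow>
     (\<forall>a. \<exists>r>0. \<exists>c :: nat ^ 'n \<Rightarrow> nat ^ 'n \<Rightarrow> complex. \<forall>z\<in>ball a r.
        ((\<lambda>(J, K). c J K * of_real ((\<Prod>k\<in>UNIV. Re (z $ k - a $ k) ^ (J $ k)) *
                                     (\<Prod>k\<in>UNIV. Im (z $ k - a $ k) ^ (K $ k))))
          has_sum f z) UNIV)"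


section \<open>Wirtinger derivatives\<close>

definition wirt :: "'n::finite \<Rightarrow> 'n cfun \<Rightarrow> 'n cfun" where
  "wirt k f = (\<lambda>x. (dir_deriv (axis k 1) f x - \<i> * dir_deriv (axis k \<i>) f x) / 2)"

definition wirt_bar :: "'n::finite \<Rightarrow> 'n cfun \<Rightarrow> 'n cfun" where
  "wirt_bar k f = (\<lambda>x. (dir_deriv (axis k 1) f x + \<i> * dir_deriv (axis k \<i>) f x) / 2)"

text \<open>An arbitrary enumeration of the coordinates, used to order the partial derivatives; by
  Schwarz's theorem the order does not matter for smooth functions.\<close>

definition coords :: "'n::finite list" where
  "coords = (SOME ks. distinct ks \<and> set ks = UNIV)"

definition D_z :: "nat ^ 'n \<Rightarrow> 'n cfun \<Rightarrow> 'n cfun" where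
  "D_z R f = foldr (\<lambda>k. wirt k ^^ (R $ k)) coords f"

definition D_zbar :: "nat ^ 'n \<Rightarrow> 'n cfun \<Rightarrow> 'n cfun" where
  "D_zbar S f = foldr (\<lambda>k. wirt_bar k ^^ (S $ k)) coords f"


section \<open>The seminorms\<close>

text \<open>All infinite sums are sums of elements of \<open>[0,\<infinity>]\<close>, hence always exist. Only indices
  \<open>\<ell> < 2\<^sup>m\<close> are meaningful; for these the value of \<open>\<ell>\<close> in the base case is \<open>0\<close>.\<close>

primrec wick_h ::
  "complex ^ 'n \<Rightarrow> real \<Rightarrow> nat \<Rightarrow> nat \<Rightarrow> nat ^ 'n \<Rightarrow> nat ^ 'n \<Rightarrow> 'n cfun \<Rightarrow> ennreal" where
  "wick_h p hbar 0 l R S f =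
     (\<Sum>\<^sub>\<infinity>N. ennreal ((2 * hbar) ^ (mi_abs R + mi_abs S + mi_abs N) / real (mi_fact N)
               * (cmod (D_z R (D_zbar (N + S) f) p))\<^sup>2))"
| "wick_h p hbar (Suc m) l R S f =
     (\<Sum>\<^sub>\<infinity>N. 1 / of_nat (mi_fact N) *
        (\<Sum>I\<in>{..R}. \<Sum>J\<in>{..N + S}. of_nat (mi_binom R I) * of_nat (mi_binom (N + S) J) *
           (if even l then wick_h p hbar m (l div 2) I J f
            else wick_h p hbar m ((l - 1) div 2) J I f))\<^sup>2)"

definition wick_seminorm ::
  "complex ^ 'n \<Rightarrow> real \<Rightarrow> nat \<Rightarrow> nat \<Rightarrow> nat ^ 'n \<Rightarrow> nat ^ 'n \<Rightarrow> 'n cfun \<Rightarrow> ennreal" where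
  "wick_seminorm p hbar m l R S f =
     (if wick_h p hbar m l R S f = \<infinity> then \<infinity>
      else ennreal (root (2 ^ (m + 1)) (enn2real (wick_h p hbar m l R S f))))"

definition A_tilde :: "complex ^ 'n \<Rightarrow> real \<Rightarrow> 'n cfun set" where
  "A_tilde p hbar =
     {f. smooth f \<and> (\<forall>m l R S. l < 2 ^ m \<longrightarrow> wick_seminorm p hbar m l R S f < \<infinity>)}"

definition A_ball :: "complex ^ 'n \<Rightarrow> real \<Rightarrow> nat \<Rightarrow> nat \<Rightarrow> nat ^ 'n \<Rightarrow> nat ^ 'n \<Rightarrow>
    'n cfun \<Rightarrow> real \<Rightarrow> 'n cfun set" where
  "A_ball p hbar m l R S f \<epsilon> =
     {g \<in> A_tilde p hbar. wick_seminorm p hbar m l R S (\<lambda>z. g z - f z) < ennreal \<epsilon>}"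


section \<open>The quotient algebra\<close>

definition jet_rel :: "complex ^ 'n \<Rightarrow> ('n cfun \<times> 'n cfun) set" where
  "jet_rel p = {(f, g). smooth f \<and> smooth g \<and> jet_vanishes p (\<lambda>z. g z - f z)}"

definition jet_class :: "complex ^ 'n \<Rightarrow> 'n cfun \<Rightarrow> 'n cfun set" where
  "jet_class p f = jet_rel p `` {f}"

record 'a top_star_algebra =
  tsa_carrier :: "'a set"
  tsa_topology :: "'a topology"
  tsa_add :: "'a \<Rightarrow> 'a \<Rightarrow> 'a"
  tsa_scale :: "complex \<Rightarrow> 'a \<Rightarrow> 'a"
  tsa_mult :: "'a \<Rightarrow> 'a \<Rightarrow> 'a"
  tsa_star :: "'a \<Rightarrow> 'a"

text \<open>The seminorms at \<^term>\<open>p\<close> depend only on the jet at \<^term>\<open>p\<close>, so their balls in the quotient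
  are the images of the balls upstairs.\<close>

definition quot_topology :: "complex ^ 'n \<Rightarrow> real \<Rightarrow> 'n cfun set topology" where
  "quot_topology p hbar = topology_generated_by
     {jet_class p ` A_ball p hbar m l R S f \<epsilon> | m l R S f \<epsilon>.
        l < 2 ^ m \<and> f \<in> A_tilde p hbar \<and> \<epsilon> > 0}"

definition wick_term :: "real \<Rightarrow> 'n cfun \<Rightarrow> 'n cfun \<Rightarrow> nat ^ 'n \<Rightarrow> 'n cfun" where
  "wick_term hbar f g N =
     (\<lambda>z. of_real ((2 * hbar) ^ mi_abs N / real (mi_fact N)) * D_z N f z * D_zbar N g z)"

text \<open>Operations on classes are given by representatives. The star product of two classes is the
  sum of the unordered series of the classes of the Wick terms in the topology of the
  quotient.\<close>

definition wick_quotient :: "complex ^ 'n \<Rightarrow> real \<Rightarrow> 'n cfun set top_star_algebra" where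
  "wick_quotient p hbar =
     \<lparr> tsa_carrier = A_tilde p hbar // jet_rel p,
       tsa_topology = quot_topology p hbar,
       tsa_add = (\<lambda>X Y. \<Union>f\<in>X. \<Union>g\<in>Y. jet_class p (\<lambda>z. f z + g z)),
       tsa_scale = (\<lambda>c X. \<Union>f\<in>X. jet_class p (\<lambda>z. c * f z)),
       tsa_mult = (\<lambda>X Y. THE L. limitin (quot_topology p hbar)
          (\<lambda>F. \<Union>f\<in>X. \<Union>g\<in>Y. jet_class p (\<lambda>z. \<Sum>N\<in>F. wick_term hbar f g N z))
          L (finite_subsets_at_top UNIV)),
       tsa_star = (\<lambda>X. \<Union>f\<in>X. jet_class p (\<lambda>z. cnj (f z))) \<rparr>"


section \<open>Identification with a subspace of the real-analytic functions\<close>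

definition analytic_rep :: "'n::finite cfun set \<Rightarrow> 'n cfun" where
  "analytic_rep X = (THE f. f \<in> X \<and> real_analytic f)"

text \<open>The structure of the quotient, transported along \<^const>\<open>analytic_rep\<close>, whose inverse is
  \<^term>\<open>jet_class p\<close>. The operations are undefined outside the carrier, so that equality
  of records means equality of carrier, topology and operations on the carrier.\<close>

definition wick_algebra :: "complex ^ 'n \<Rightarrow> real \<Rightarrow> 'n cfun top_star_algebra" where
  "wick_algebra p hbar =
     (let Q = wick_quotient p hbar; A = analytic_rep ` tsa_carrier Q in
     \<lparr> tsa_carrier = A,
       tsa_topology = pullback_topology A (jet_class p) (tsa_topology Q),
       tsa_add = (\<lambda>f\<in>A. \<lambda>g\<in>A. analytic_rep (tsa_add Q (jet_class p f) (jet_class p g))),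
       tsa_scale = (\<lambda>c. \<lambda>f\<in>A. analytic_rep (tsa_scale Q c (jet_class p f))),
       tsa_mult = (\<lambda>f\<in>A. \<lambda>g\<in>A. analytic_rep (tsa_mult Q (jet_class p f) (jet_class p g))),
       tsa_star = (\<lambda>f\<in>A. analytic_rep (tsa_star Q (jet_class p f))) \<rparr>)"

end

theory Submission
  imports Defs
begin

text \<open>Scaling the mixed derivatives of \<open>f\<close> at \<open>p\<close> by powers of \<open>sqrt (2 * hbar)\<close> turns the seminorms
  into functionals of an array \<open>X R S\<close>. By the Cauchy-Schwarz inequality all of them together are
  equivalent to the family of the sums of \<open>X R S ^ 2 ^ k / (R! * S!)\<close>, in which a geometric factor
  \<open>c ^ (|R| + |S|)\<close> costs nothing but an increase of \<open>k\<close>. Hence the Taylor series of \<open>f\<close> at \<open>p\<close> in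
  \<open>z\<close> and its conjugate converges everywhere, and expanding it at \<open>p'\<close> only costs such a factor: every
  seminorm at \<open>p'\<close> is bounded by a root of a seminorm at \<open>p\<close>. The bijection between the two quotients
  given by the analytic representatives is therefore a homeomorphism; since the partial sums
  of the star product are themselves real-analytic, it also matches the limits that define the
  products, without any knowledge about their convergence.\<close>

section \<open>Sums in \<open>[0,\<infinity>]\<close> over multiindices\<close>

text \<open>A geometric factor is harmless because the weights \<open>1 / (R! * S!)\<close> are
  those of an exponential series: one Cauchy-Schwarz inequality splits off the factor, whose square
  is still summable against the weights, and doubles the exponent of the entries. Jensen's
  inequality for the powers \<open>2 ^ k\<close> treats the binomial sums and the Taylor shift in
  the same way, so the exponents stay powers of two, as in the recursion. The parity of
  \<open>l\<close> matters for the converse bound. An even step sums only the second index to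
  infinity; a power sum over both indices needs one odd step on top of even ones, hence the
  seminorms with \<open>l = 1\<close> and \<open>R = S = 0\<close>. The estimates are stated for
  values in \<open>[0,\<infinity>]\<close>, so that finiteness comes out of them instead of being
  presupposed. Openness of balls is shown for \<open>wick_h\<close> without its root: in place of
  the triangle inequality stands convexity together with homogeneity. The product is a
  \<open>THE\<close> limit in the quotient, so the limits for two base points are compared inside
  one Hausdorff topology on the common set of analytic representatives.\<close>

lemma ennreal_summable_on [simp]: "f summable_on A" for f :: "'a \<Rightarrow> ennreal"
  by (rule nonneg_summable_on_complete) simp

lemma infsum_ennreal_SUP: "infsum f A = (SUP F\<in>{F. finite F \<and> F \<subseteq> A}. sum f F)" for f :: "'a \<Rightarrow> ennreal"
  by (rule nonneg_infsum_complete) simp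

lemma infsum_cmult_ennreal: "(\<Sum>\<^sub>\<infinity>x\<in>A. c * f x) = c * (\<Sum>\<^sub>\<infinity>x\<in>A. f x)" for c :: ennreal
  unfolding infsum_ennreal_SUP
  by (simp add: SUP_mult_left_ennreal sum_distrib_left)

lemma infsum_multc_ennreal: "(\<Sum>\<^sub>\<infinity>x\<in>A. f x * c) = (\<Sum>\<^sub>\<infinity>x\<in>A. f x) * c" for c :: ennreal
  using infsum_cmult_ennreal[of c f A] by (simp add: mult.commute)

lemma infsum_mono_ennreal:
  "(\<And>x. x \<in> A \<Longrightarrow> f x \<le> g x) \<Longrightarrow> (\<Sum>\<^sub>\<infinity>x\<in>A. f x) \<le> (\<Sum>\<^sub>\<infinity>x\<in>A. g x)" for f :: "'a \<Rightarrow> ennreal"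
  by (rule infsum_mono) auto

lemma infsum_mono_set_ennreal:
  "A \<subseteq> B \<Longrightarrow> (\<Sum>\<^sub>\<infinity>x\<in>A. f x) \<le> (\<Sum>\<^sub>\<infinity>x\<in>B. f x)" for f :: "'a \<Rightarrow> ennreal"
  by (rule infsum_mono_neutral) auto

lemma infsum_member_le_ennreal: "x \<in> A \<Longrightarrow> f x \<le> (\<Sum>\<^sub>\<infinity>x\<in>A. f x)" for f :: "'a \<Rightarrow> ennreal"
  using infsum_mono_set_ennreal[of "{x}" A f] by simp

text \<open>Tonelli's theorem. For finitely many rows it is finite additivity; in general every
  finite set of pairs lies over the finite set of its first components, so suprema over finite sets
  suffice.\<close>

lemma infsum_Sigma_ennreal:
  "(\<Sum>\<^sub>\<infinity>x\<in>A. \<Sum>\<^sub>\<infinity>y\<in>B x. f x y) = (\<Sum>\<^sub>\<infinity>(x, y)\<in>Sigma A B. f x y)" for f :: "'a \<Rightarrow> 'b \<Rightarrow> ennreal"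
proof (rule antisym)
  have fin: "(\<Sum>x\<in>F. \<Sum>\<^sub>\<infinity>y\<in>B x. f x y) = (\<Sum>\<^sub>\<infinity>(x, y)\<in>Sigma F B. f x y)" if "finite F" for F
    using that
  proof (induction F)
    case (insert x F)
    have "(\<Sum>\<^sub>\<infinity>(x, y)\<in>Sigma (insert x F) B. f x y)
        = (\<Sum>\<^sub>\<infinity>(x, y)\<in>Pair x ` B x \<union> Sigma F B. f x y)"
      by (rule arg_cong[where f = "infsum _"]) auto
    also have "\<dots> = (\<Sum>\<^sub>\<infinity>(x, y)\<in>Pair x ` B x. f x y) + (\<Sum>\<^sub>\<infinity>(x, y)\<in>Sigma F B. f x y)"
      using insert.hyps by (intro infsum_Un_disjoint) auto
    also have "(\<Sum>\<^sub>\<infinity>(x, y)\<in>Pair x ` B x. f x y) = (\<Sum>\<^sub>\<infinity>y\<in>B x. f x y)"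
      by (subst infsum_reindex) (auto simp: inj_on_def o_def)
    finally show ?case using insert by simp
  qed simp
  show "(\<Sum>\<^sub>\<infinity>x\<in>A. \<Sum>\<^sub>\<infinity>y\<in>B x. f x y) \<le> (\<Sum>\<^sub>\<infinity>(x, y)\<in>Sigma A B. f x y)"
    unfolding infsum_ennreal_SUP[of "\<lambda>x. infsum (f x) (B x)"]
    by (intro SUP_least) (auto simp: fin intro!: infsum_mono_set_ennreal)
  show "(\<Sum>\<^sub>\<infinity>(x, y)\<in>Sigma A B. f x y) \<le> (\<Sum>\<^sub>\<infinity>x\<in>A. \<Sum>\<^sub>\<infinity>y\<in>B x. f x y)"
    unfolding infsum_ennreal_SUP[of "\<lambda>(x, y). f x y"]
  proof (intro SUP_least)
    fix G assume "G \<in> {G. finite G \<and> G \<subseteq> Sigma A B}"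
    then have G: "finite G" "G \<subseteq> Sigma A B" by auto
    have "(\<Sum>(x, y)\<in>G. f x y) = (\<Sum>\<^sub>\<infinity>(x, y)\<in>G. f x y)"
      using G by simp
    also have "\<dots> \<le> (\<Sum>\<^sub>\<infinity>(x, y)\<in>Sigma (fst ` G) B. f x y)"
      using G by (intro infsum_mono_set_ennreal) force
    also have "\<dots> = (\<Sum>\<^sub>\<infinity>x\<in>fst ` G. \<Sum>\<^sub>\<infinity>y\<in>B x. f x y)"
      using G by (simp add: fin)
    also have "\<dots> \<le> (\<Sum>\<^sub>\<infinity>x\<in>A. \<Sum>\<^sub>\<infinity>y\<in>B x. f x y)"
      using G by (intro infsum_mono_set_ennreal) auto
    finally show "(\<Sum>(x, y)\<in>G. f x y) \<le> (\<Sum>\<^sub>\<infinity>x\<in>A. \<Sum>\<^sub>\<infinity>y\<in>B x. f x y)" .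
  qed
qed

lemma infsum_swap_ennreal:
  "(\<Sum>\<^sub>\<infinity>x\<in>A. \<Sum>\<^sub>\<infinity>y\<in>B. f x y) = (\<Sum>\<^sub>\<infinity>y\<in>B. \<Sum>\<^sub>\<infinity>x\<in>A. f x y)" for f :: "'a \<Rightarrow> 'b \<Rightarrow> ennreal"
  unfolding infsum_Sigma_ennreal
  by (rule infsum_reindex_bij_witness[where i = prod.swap and j = prod.swap]) auto

lemma ennreal_two_mult_le: "2 * (x * y) \<le> x\<^sup>2 + y\<^sup>2" for x y :: ennreal
proof (cases "x = top \<or> y = top")
  case False
  then obtain a b where "x = ennreal a" "a \<ge> 0" "y = ennreal b" "b \<ge> 0"
    by (metis ennreal_cases)
  moreover have "2 * (a * b) \<le> a\<^sup>2 + b\<^sup>2"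
    using sum_squares_bound[of a b] by simp
  ultimately show ?thesis
    by (simp add: ennreal_power flip: ennreal_mult ennreal_plus ennreal_numeral)
qed (auto simp: power2_eq_square)

lemma infsum_mult_infsum_ennreal:
  "(\<Sum>\<^sub>\<infinity>i\<in>A. f i) * (\<Sum>\<^sub>\<infinity>j\<in>A. g j) = (\<Sum>\<^sub>\<infinity>i\<in>A. \<Sum>\<^sub>\<infinity>j\<in>A. f i * g j)" for f :: "'a \<Rightarrow> ennreal"
  by (simp add: infsum_cmult_ennreal infsum_multc_ennreal)

text \<open>Lagrange's double sum: twice the square is a double sum over \<open>i\<close> and
  \<open>j\<close> of products \<open>(a i * b j) * (a j * b i)\<close>, to which the
  arithmetic-geometric mean inequality applies termwise. No quotient or root appears, so infinite
  values need no separate treatment here.\<close>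

lemma Cauchy_Schwarz_infsum_ennreal:
  fixes w a b :: "'a \<Rightarrow> ennreal"
  shows "(\<Sum>\<^sub>\<infinity>i\<in>A. w i * a i * b i)\<^sup>2 \<le> (\<Sum>\<^sub>\<infinity>i\<in>A. w i * (a i)\<^sup>2) * (\<Sum>\<^sub>\<infinity>i\<in>A. w i * (b i)\<^sup>2)"
proof -
  have "2 * (\<Sum>\<^sub>\<infinity>i\<in>A. w i * a i * b i)\<^sup>2
      = (\<Sum>\<^sub>\<infinity>i\<in>A. \<Sum>\<^sub>\<infinity>j\<in>A. w i * w j * (2 * ((a i * b j) * (a j * b i))))"
    unfolding power2_eq_square infsum_mult_infsum_ennreal
    by (simp flip: infsum_cmult_ennreal add: mult_ac)
  also have "\<dots> \<le> (\<Sum>\<^sub>\<infinity>i\<in>A. \<Sum>\<^sub>\<infinity>j\<in>A. w i * w j * ((a i * b j)\<^sup>2 + (a j * b i)\<^sup>2))"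
    by (intro infsum_mono_ennreal mult_left_mono ennreal_two_mult_le) auto
  also have "\<dots> = (\<Sum>\<^sub>\<infinity>i\<in>A. \<Sum>\<^sub>\<infinity>j\<in>A. (w i * (a i)\<^sup>2) * (w j * (b j)\<^sup>2))
      + (\<Sum>\<^sub>\<infinity>i\<in>A. \<Sum>\<^sub>\<infinity>j\<in>A. (w i * (b i)\<^sup>2) * (w j * (a j)\<^sup>2))"
    by (subst infsum_add[symmetric], simp, simp, subst infsum_add[symmetric], simp, simp,
        simp add: power_mult_distrib distrib_left mult_ac)
  also have "\<dots> = 2 * ((\<Sum>\<^sub>\<infinity>i\<in>A. w i * (a i)\<^sup>2) * (\<Sum>\<^sub>\<infinity>i\<in>A. w i * (b i)\<^sup>2))"
    unfolding infsum_mult_infsum_ennreal[symmetric] by (simp add: mult_2 mult.commute)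
  finally show ?thesis
    by (simp add: ennreal_mult_le_mult_iff)
qed

text \<open>Jensen's inequality for the convex function \<open>x ^ 2 ^ k\<close> with weights that
  are not normalised, whence the power \<open>2 ^ k - 1\<close> of the total mass. Each doubling of
  the exponent is a Cauchy-Schwarz inequality against the constant 1.\<close>

lemma infsum_power_mean:
  fixes w x :: "'a \<Rightarrow> ennreal"
  shows "(\<Sum>\<^sub>\<infinity>i\<in>A. w i * x i) ^ (2 ^ k)
    \<le> (\<Sum>\<^sub>\<infinity>i\<in>A. w i) ^ (2 ^ k - 1) * (\<Sum>\<^sub>\<infinity>i\<in>A. w i * x i ^ (2 ^ k))"
proof (induction k)
  case (Suc k)
  let ?W = "\<Sum>\<^sub>\<infinity>i\<in>A. w i"
  have e: "2 * (2 ^ k - 1) + 1 = (2 ^ Suc k - 1 :: nat)"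
    using one_le_power[of "2::nat" k] by (simp only: power_Suc) linarith
  have "(\<Sum>\<^sub>\<infinity>i\<in>A. w i * x i) ^ (2 ^ Suc k) = ((\<Sum>\<^sub>\<infinity>i\<in>A. w i * x i) ^ (2 ^ k))\<^sup>2"
    by (simp add: power_mult[symmetric] mult.commute)
  also have "\<dots> \<le> (?W ^ (2 ^ k - 1) * (\<Sum>\<^sub>\<infinity>i\<in>A. w i * x i ^ (2 ^ k)))\<^sup>2"
    by (rule power_mono[OF Suc]) auto
  also have "\<dots> = ?W ^ (2 * (2 ^ k - 1)) * (\<Sum>\<^sub>\<infinity>i\<in>A. w i * 1 * x i ^ (2 ^ k))\<^sup>2"
    by (simp add: power_mult_distrib power_mult[symmetric] mult.commute)
  also have "\<dots> \<le> ?W ^ (2 * (2 ^ k - 1)) *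
      ((\<Sum>\<^sub>\<infinity>i\<in>A. w i * 1\<^sup>2) * (\<Sum>\<^sub>\<infinity>i\<in>A. w i * (x i ^ (2 ^ k))\<^sup>2))"
    by (intro mult_left_mono Cauchy_Schwarz_infsum_ennreal) auto
  also have "\<dots> = ?W ^ (2 * (2 ^ k - 1) + 1) * (\<Sum>\<^sub>\<infinity>i\<in>A. w i * x i ^ (2 ^ Suc k))"
    by (simp add: mult_ac power_mult[symmetric])
  finally show ?case unfolding e .
qed simp

section \<open>Weights of the multivariate exponential series\<close>

definition mwt :: "real \<Rightarrow> nat ^ 'n \<Rightarrow> real" where
  "mwt c R = c ^ mi_abs R / real (mi_fact R)"

lemma mi_fact_pos [simp]: "mi_fact R > 0"
  by (simp add: mi_fact_def)

lemma mi_abs_add [simp]: "mi_abs (R + S) = mi_abs R + mi_abs S"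
  by (simp add: mi_abs_def sum.distrib)

lemma mi_abs_zero [simp]: "mi_abs 0 = 0"
  and mi_fact_zero [simp]: "mi_fact 0 = 1"
  by (simp_all add: mi_abs_def mi_fact_def)

lemma mwt_nonneg [simp]: "c \<ge> 0 \<Longrightarrow> mwt c R \<ge> 0"
  by (simp add: mwt_def)

lemma mwt_zero [simp]: "mwt c 0 = 1"
  by (simp add: mwt_def)

lemma mwt_prod: "mwt c R = (\<Prod>k\<in>UNIV. c ^ (R $ k) / fact (R $ k))"
  by (simp add: mwt_def mi_abs_def mi_fact_def power_sum prod_dividef)

lemma mwt_mult: "mwt (c * d) R = c ^ mi_abs R * mwt d R"
  by (simp add: mwt_def power_mult_distrib)

lemma mwt_mono: "0 \<le> c \<Longrightarrow> c \<le> d \<Longrightarrow> mwt c R \<le> mwt d R"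
  by (simp add: mwt_def divide_right_mono power_mono)

text \<open>Written with weights, the binomial coefficient is a ratio, so a weighted binomial sum
  over \<open>R = I + A\<close> decouples into independent sums over \<open>I\<close> and
  \<open>A\<close>.\<close>

lemma mi_binom_mwt: "real (mi_binom (I + A) I) * mwt 1 (I + A) = mwt 1 I * mwt 1 A"
proof -
  have "real ((i + a) choose i) / fact (i + a) = 1 / (fact i * fact a)" for i a :: nat
    by (simp add: binomial_fact)
  then show ?thesis
    by (simp add: mwt_prod mi_binom_def flip: prod.distrib)
qed

lemma sum_atMost_vec_prod:
  fixes f :: "'n::finite \<Rightarrow> nat \<Rightarrow> 'a :: comm_semiring_1"
  shows "(\<Sum>R\<in>{..M}. \<Prod>k\<in>UNIV. f k (R $ k)) = (\<Prod>k\<in>UNIV. \<Sum>i\<le>M $ k. f k i)"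
proof -
  have "(\<Prod>k\<in>UNIV. \<Sum>i\<le>M $ k. f k i) = (\<Sum>g\<in>PiE UNIV (\<lambda>k. {..M $ k}). \<Prod>k\<in>UNIV. f k (g k))"
    by (rule prod_sum_PiE) auto
  also have "\<dots> = (\<Sum>R\<in>{..M}. \<Prod>k\<in>UNIV. f k (R $ k))"
    by (rule sum.reindex_bij_witness[where i = vec_nth and j = vec_lambda])
       (auto simp: less_eq_vec_def PiE_def)
  finally show ?thesis ..
qed

lemma finite_atMost_vec [simp]: "finite {..M :: nat ^ 'n}"
proof (rule finite_subset)
  show "{..M} \<subseteq> vec_lambda ` PiE UNIV (\<lambda>k. {..M $ k})"
  proof
    fix R assume "R \<in> {..M}"
    then have "R = vec_lambda (vec_nth R)" "vec_nth R \<in> PiE UNIV (\<lambda>k. {..M $ k})"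
      by (auto simp: less_eq_vec_def)
    then show "R \<in> vec_lambda ` PiE UNIV (\<lambda>k. {..M $ k})" by blast
  qed
qed (intro finite_imageI finite_PiE; simp)

text \<open>The binomial theorem divided by \<open>M!\<close>: convolving weights adds their bases.
  It factors over the coordinates because the box \<open>{..M}\<close> is a product of
  intervals.\<close>

lemma mwt_binomial: "(\<Sum>R\<in>{..M}. mwt a R * mwt b (M - R)) = mwt (a + b) M"
proof -
  have "(\<Sum>R\<in>{..M}. mwt a R * mwt b (M - R))
      = (\<Sum>R\<in>{..M}. \<Prod>k\<in>UNIV. (a ^ (R $ k) / fact (R $ k)) *
           (b ^ (M $ k - R $ k) / fact (M $ k - R $ k)))"
    by (simp only: mwt_prod prod.distrib vector_minus_component)
  also have "\<dots> = (\<Prod>k\<in>UNIV. \<Sum>i\<le>M $ k. (a ^ i / fact i) * (b ^ (M $ k - i) / fact (M $ k - i)))"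
    by (rule sum_atMost_vec_prod)
  also have "\<dots> = mwt (a + b) M"
    unfolding mwt_prod
    by (intro prod.cong refl)
       (use exp_series_add_commuting[of a b] in \<open>simp add: divide_inverse mult_ac\<close>)
  finally show ?thesis .
qed

lemma sum_mi_binom: "(\<Sum>I\<in>{..R}. real (mi_binom R I)) = 2 ^ mi_abs R"
proof -
  have "real (mi_binom R I) * mwt 1 R = mwt 1 I * mwt 1 (R - I)" if "I \<le> R" for I
  proof -
    have "R = I + (R - I)" using that by (simp add: vec_eq_iff less_eq_vec_def)
    then show ?thesis using mi_binom_mwt[of I "R - I"] by simp
  qed
  then have "(\<Sum>I\<in>{..R}. real (mi_binom R I)) * mwt 1 R = mwt (1 + 1) R"
    unfolding sum_distrib_right mwt_binomial[symmetric] by (intro sum.cong) auto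
  then show ?thesis using mi_fact_pos[of R] by (simp add: mwt_def)
qed

lemma sum_mwt_le:
  fixes F :: "(nat ^ 'n) set"
  assumes "finite F" "c \<ge> 0"
  shows "(\<Sum>R\<in>F. mwt c R) \<le> exp c ^ CARD('n)"
proof -
  \<comment> \<open>The corner of a box around \<open>F\<close>; inserting 0 keeps the maximum
    meaningful for empty \<open>F\<close>.\<close>
  define M :: "nat ^ 'n" where "M = (\<chi> k. Max (insert 0 ((\<lambda>R. R $ k) ` F)))"
  have "F \<subseteq> {..M}"
    using assms by (auto simp: M_def less_eq_vec_def intro!: Max_ge)
  then have "(\<Sum>R\<in>F. mwt c R) \<le> (\<Sum>R\<in>{..M}. mwt c R)"
    using assms by (intro sum_mono2) auto
  also have "\<dots> = (\<Prod>k\<in>UNIV. \<Sum>i\<le>M $ k. c ^ i / fact i)"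
    unfolding mwt_prod by (rule sum_atMost_vec_prod)
  also have "\<dots> \<le> (\<Prod>k\<in>(UNIV::'n set). exp c)"
  proof (intro prod_mono conjI sum_nonneg)
    fix k
    have "(\<Sum>i\<le>M $ k. c ^ i / fact i) \<le> (\<Sum>i. c ^ i / fact i)"
      using summable_exp[of c] assms
      by (intro sum_le_suminf) (auto simp: divide_inverse mult.commute)
    then show "(\<Sum>i\<le>M $ k. c ^ i / fact i) \<le> exp c"
      by (simp add: exp_def divide_inverse mult.commute)
  qed (use assms in auto)
  finally show ?thesis by simp
qed

text \<open>This holds for every base \<open>c\<close>: a geometric factor \<open>c ^ |R|\<close>
  never endangers summability against \<open>1 / R!\<close>.\<close>

lemma infsum_mwt_finite:
  assumes "c \<ge> 0"
  shows "(\<Sum>\<^sub>\<infinity>R :: nat ^ 'n. ennreal (mwt c R)) < top"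
proof -
  have "(\<Sum>\<^sub>\<infinity>R :: nat ^ 'n. ennreal (mwt c R)) \<le> ennreal (exp c ^ CARD('n))"
    unfolding infsum_ennreal_SUP
    using assms by (intro SUP_least) (auto simp: sum_ennreal intro!: ennreal_leI sum_mwt_le)
  then show ?thesis using ennreal_less_top le_less_trans by blast
qed

text \<open>Tonelli over the pairs \<open>I \<le> R\<close>, parametrised by \<open>I\<close> and
  the difference \<open>A = R - I\<close>.\<close>

lemma infsum_atMost_shift:
  fixes F :: "nat ^ 'n \<Rightarrow> nat ^ 'n \<Rightarrow> ennreal"
  shows "(\<Sum>\<^sub>\<infinity>R. \<Sum>I\<in>{..R}. F R I) = (\<Sum>\<^sub>\<infinity>I. \<Sum>\<^sub>\<infinity>A. F (I + A) I)"
proof -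
  have "(\<Sum>\<^sub>\<infinity>R. \<Sum>I\<in>{..R}. F R I) = (\<Sum>\<^sub>\<infinity>R. \<Sum>\<^sub>\<infinity>I\<in>{..R}. F R I)"
    by simp
  also have "\<dots> = (\<Sum>\<^sub>\<infinity>I. \<Sum>\<^sub>\<infinity>A. F (I + A) I)"
    unfolding infsum_Sigma_ennreal
    by (rule infsum_reindex_bij_witness[where i = "\<lambda>(I, A). (I + A, I)" and j = "\<lambda>(R, I). (I, R - I)"])
       (auto simp: vec_eq_iff less_eq_vec_def intro!: arg_cong2[where f = F])
  finally show ?thesis .
qed

section \<open>Power sums of sequences under shifts and binomial sums\<close>

definition psum :: "nat \<Rightarrow> real \<Rightarrow> (nat ^ 'n \<Rightarrow> ennreal) \<Rightarrow> ennreal" where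
  "psum k c y = (\<Sum>\<^sub>\<infinity>R. ennreal (mwt c R) * y R ^ (2 ^ k))"

text \<open>A majorant of Taylor's formula: if \<open>y\<close> bounds the derivatives at a point,
  then \<open>shift_op w y\<close> bounds those at a point whose coordinates differ by at most
  \<open>w\<close>. For \<open>w = 1\<close> it is also the outer sum over \<open>N\<close> in the
  recursion of the seminorms.\<close>

definition shift_op :: "real \<Rightarrow> (nat ^ 'n \<Rightarrow> ennreal) \<Rightarrow> nat ^ 'n \<Rightarrow> ennreal" where
  "shift_op w y R = (\<Sum>\<^sub>\<infinity>K. ennreal (mwt w K) * y (R + K))"

definition binom_op :: "(nat ^ 'n \<Rightarrow> ennreal) \<Rightarrow> nat ^ 'n \<Rightarrow> ennreal" where
  "binom_op y R = (\<Sum>I\<in>{..R}. of_nat (mi_binom R I) * y I)"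

text \<open>Jensen with the weights of base \<open>w\<close> moves the power inside the shift. The
  entries of the resulting double sum depend on \<open>R + K\<close> only, and convolving the
  weights turns the bases \<open>c\<close> and \<open>w\<close> into \<open>c + w\<close>.\<close>

lemma psum_shift_op:
  assumes "c \<ge> 0" "w \<ge> 0"
  obtains C where "C < top" "\<And>y :: nat ^ 'n \<Rightarrow> ennreal. psum k c (shift_op w y) \<le> C * psum k (c + w) y"
proof
  let ?E = "(\<Sum>\<^sub>\<infinity>R :: nat ^ 'n. ennreal (mwt w R))"
  show "?E ^ (2 ^ k - 1) < top"
    using infsum_mwt_finite[OF assms(2), where ?'n = 'n] by (simp add: power_less_top_ennreal)
  fix y :: "nat ^ 'n \<Rightarrow> ennreal"
  let ?Y = "\<lambda>R. y R ^ (2 ^ k)"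
  have "psum k c (shift_op w y)
      \<le> (\<Sum>\<^sub>\<infinity>R. ennreal (mwt c R) * (?E ^ (2 ^ k - 1) * (\<Sum>\<^sub>\<infinity>K. ennreal (mwt w K) * ?Y (R + K))))"
    unfolding psum_def shift_op_def
    by (intro infsum_mono_ennreal mult_left_mono infsum_power_mean) auto
  also have "\<dots> = ?E ^ (2 ^ k - 1) *
      (\<Sum>\<^sub>\<infinity>R. \<Sum>\<^sub>\<infinity>K. ennreal (mwt c R) * (ennreal (mwt w K) * ?Y (R + K)))"
    by (simp only: infsum_cmult_ennreal mult.left_commute[where a = "?E ^ (2 ^ k - 1)"])
  also have "(\<Sum>\<^sub>\<infinity>R. \<Sum>\<^sub>\<infinity>K. ennreal (mwt c R) * (ennreal (mwt w K) * ?Y (R + K)))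
      = (\<Sum>\<^sub>\<infinity>M. \<Sum>R\<in>{..M}. ennreal (mwt c R) * (ennreal (mwt w (M - R)) * ?Y M))"
    unfolding infsum_atMost_shift by simp
  also have "\<dots> = psum k (c + w) y"
    unfolding psum_def mwt_binomial[symmetric]
    using assms by (simp add: sum_ennreal[symmetric] ennreal_mult sum_distrib_right mult.assoc)
  finally show "psum k c (shift_op w y) \<le> ?E ^ (2 ^ k - 1) * psum k (c + w) y" .
qed

text \<open>The binomial coefficients of \<open>R\<close> have total mass \<open>2 ^ |R|\<close>, so
  Jensen costs the power \<open>2 ^ k - 1\<close> of it, which is geometric in \<open>|R|\<close>
  and goes into the base \<open>d\<close>. Afterwards coefficient and weight split into a weight of
  \<open>I\<close> and a weight of \<open>R - I\<close>, and the latter sums to a constant.\<close>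

lemma psum_binom_op:
  assumes "c \<ge> 0"
  obtains C d where "C < top" "d \<ge> 0" "\<And>y :: nat ^ 'n \<Rightarrow> ennreal. psum k c (binom_op y) \<le> C * psum k d y"
proof
  define d where "d = c * 2 ^ (2 ^ k - 1)"
  let ?E = "(\<Sum>\<^sub>\<infinity>R :: nat ^ 'n. ennreal (mwt d R))"
  show d: "d \<ge> 0" using assms by (simp add: d_def)
  show "?E < top" by (rule infsum_mwt_finite[OF d])
  fix y :: "nat ^ 'n \<Rightarrow> ennreal"
  let ?Y = "\<lambda>R. y R ^ (2 ^ k)"
  have *: "ennreal (mwt c R) * binom_op y R ^ (2 ^ k)
      \<le> (\<Sum>I\<in>{..R}. ennreal (mwt d R * real (mi_binom R I)) * ?Y I)" for R
  proof -
    have "binom_op y R ^ (2 ^ k) \<le> (\<Sum>I\<in>{..R}. of_nat (mi_binom R I)) ^ (2 ^ k - 1) *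
        (\<Sum>I\<in>{..R}. of_nat (mi_binom R I) * ?Y I)"
      using infsum_power_mean[where A = "{..R}"] by (simp add: binom_op_def)
    also have "(\<Sum>I\<in>{..R}. of_nat (mi_binom R I)) = ennreal (2 ^ mi_abs R)"
      by (simp add: sum_mi_binom[symmetric] ennreal_of_nat_eq_real_of_nat flip: sum_ennreal)
    finally have "ennreal (mwt c R) * binom_op y R ^ (2 ^ k) \<le> ennreal (mwt c R) *
       (ennreal (2 ^ mi_abs R) ^ (2 ^ k - 1) * (\<Sum>I\<in>{..R}. of_nat (mi_binom R I) * ?Y I))"
      by (rule mult_left_mono) simp
    also have "\<dots> = ennreal (mwt c R * (2 ^ mi_abs R) ^ (2 ^ k - 1)) *
        (\<Sum>I\<in>{..R}. of_nat (mi_binom R I) * ?Y I)"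
      using assms by (simp add: ennreal_mult ennreal_power mult.assoc)
    also have "mwt c R * (2 ^ mi_abs R) ^ (2 ^ k - 1) = mwt d R"
      by (simp add: mwt_def d_def power_mult_distrib power_mult[symmetric] mult.commute)
    finally show ?thesis
      using d by (simp add: sum_distrib_left ennreal_mult ennreal_of_nat_eq_real_of_nat mult.assoc)
  qed
  have "psum k c (binom_op y) \<le> (\<Sum>\<^sub>\<infinity>R. \<Sum>I\<in>{..R}. ennreal (mwt d R * real (mi_binom R I)) * ?Y I)"
    unfolding psum_def by (intro infsum_mono_ennreal *)
  also have "\<dots> = (\<Sum>\<^sub>\<infinity>I. \<Sum>\<^sub>\<infinity>A. ennreal (mwt d (I + A) * real (mi_binom (I + A) I)) * ?Y I)"
    by (rule infsum_atMost_shift)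
  also have "\<dots> = (\<Sum>\<^sub>\<infinity>I. \<Sum>\<^sub>\<infinity>A :: nat ^ 'n. (ennreal (mwt d I) * ?Y I) * ennreal (mwt d A))"
  proof -
    have "mwt d (I + A) * real (mi_binom (I + A) I) = mwt d I * mwt d A" for I A :: "nat ^ 'n"
      using mi_binom_mwt[of I A] mwt_mult[of d 1 "I + A"] mwt_mult[of d 1 I] mwt_mult[of d 1 A]
      by (simp add: power_add mult_ac)
    then have *: "ennreal (mwt d (I + A) * real (mi_binom (I + A) I)) * ?Y I
        = (ennreal (mwt d I) * ?Y I) * ennreal (mwt d A)" for I A
      using d by (simp add: ennreal_mult mult_ac)
    show ?thesis unfolding * ..
  qed
  also have "\<dots> = ?E * psum k d y"
    unfolding psum_def infsum_cmult_ennreal infsum_multc_ennreal by (rule mult.commute)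
  finally show "psum k c (binom_op y) \<le> ?E * psum k d y" .
qed


lemma ennreal_bound_trans:
  assumes "C < top" "D < top" "x \<le> C * y" "y \<le> D * z"
  shows "C * D < (top :: ennreal)" "x \<le> (C * D) * z"
proof -
  show "C * D < top" using assms by (simp add: ennreal_mult_less_top)
  have "x \<le> C * (D * z)" using assms(3) mult_left_mono[OF assms(4)] by (meson order_trans zero_le)
  then show "x \<le> (C * D) * z" by (simp add: mult.assoc)
qed

section \<open>Seminorms on arrays\<close>

definition psum2 :: "nat \<Rightarrow> real \<Rightarrow> (nat ^ 'n \<Rightarrow> nat ^ 'n \<Rightarrow> ennreal) \<Rightarrow> ennreal" where
  "psum2 k c X = (\<Sum>\<^sub>\<infinity>R. ennreal (mwt c R) * psum k c (X R))"

lemma psum_mono: "0 \<le> c \<Longrightarrow> c \<le> d \<Longrightarrow> (\<And>R. y R \<le> z R) \<Longrightarrow> psum k c y \<le> psum k d z"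
  unfolding psum_def
  by (intro infsum_mono_ennreal mult_mono ennreal_leI mwt_mono power_mono) auto

lemma psum2_mono: "0 \<le> c \<Longrightarrow> c \<le> d \<Longrightarrow> (\<And>R S. X R S \<le> Y R S) \<Longrightarrow> psum2 k c X \<le> psum2 k d Y"
  unfolding psum2_def
  by (intro infsum_mono_ennreal mult_mono ennreal_leI mwt_mono psum_mono) auto

text \<open>Both indices carry the same weight, so an operation on columns can be estimated as one
  on rows. It also makes the transposition in the odd steps invisible.\<close>

lemma psum2_transpose: "psum2 k c (\<lambda>R S. X S R) = psum2 k c X"
proof -
  have *: "psum2 k c Y = (\<Sum>\<^sub>\<infinity>R. \<Sum>\<^sub>\<infinity>S. ennreal (mwt c R) * ennreal (mwt c S) * Y R S ^ (2 ^ k))"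
    for Y :: "nat ^ 'n \<Rightarrow> nat ^ 'n \<Rightarrow> ennreal"
    by (simp add: psum2_def psum_def mult.assoc flip: infsum_cmult_ennreal)
  show ?thesis
    unfolding * by (subst infsum_swap_ennreal) (simp add: mult.commute)
qed

lemma psum2_square: "psum2 k c (\<lambda>R S. (X R S)\<^sup>2) = psum2 (Suc k) c X"
  by (simp add: psum2_def psum_def power_mult[symmetric])

lemma psum2_rows:
  assumes "0 \<le> c" "c \<le> d" "\<And>y. psum k c (T y) \<le> C * psum k' d y"
  shows "psum2 k c (\<lambda>R. T (X R)) \<le> C * psum2 k' d X"
proof -
  have "psum2 k c (\<lambda>R. T (X R)) \<le> (\<Sum>\<^sub>\<infinity>R. ennreal (mwt d R) * (C * psum k' d (X R)))"
    unfolding psum2_def using assms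
    by (intro infsum_mono_ennreal mult_mono ennreal_leI mwt_mono) auto
  also have "\<dots> = C * psum2 k' d X"
    by (simp only: psum2_def infsum_cmult_ennreal mult.left_commute[where a = C])
  finally show ?thesis .
qed

lemma psum2_shift_rows:
  assumes "c \<ge> 0" "w \<ge> 0"
  obtains C where "C < top" "\<And>X :: nat ^ 'n \<Rightarrow> nat ^ 'n \<Rightarrow> ennreal.
    psum2 k c (\<lambda>R. shift_op w (X R)) \<le> C * psum2 k (c + w) X"
  using psum_shift_op[OF assms, of k] psum2_rows[of c "c + w" k "shift_op w"] assms
  by (metis add.commute le_add_same_cancel2)

lemma psum2_binom_rows:
  assumes "c \<ge> 0"
  obtains C d where "C < top" "d \<ge> 0" "\<And>X :: nat ^ 'n \<Rightarrow> nat ^ 'n \<Rightarrow> ennreal.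
    psum2 k c (\<lambda>R. binom_op (X R)) \<le> C * psum2 k d X"
proof -
  obtain C d where C: "C < top" "d \<ge> 0"
    "\<And>y :: nat ^ 'n \<Rightarrow> ennreal. psum k c (binom_op y) \<le> C * psum k d y"
    using psum_binom_op[OF assms] by metis
  have "psum k c (binom_op y) \<le> C * psum k (max c d) y" for y :: "nat ^ 'n \<Rightarrow> ennreal"
    using C psum_mono[of d "max c d" y y k] by (meson max.cobounded2 mult_left_mono order_refl order_trans zero_le)
  then have "psum2 k c (\<lambda>R. binom_op (X R)) \<le> C * psum2 k (max c d) X"
    for X :: "nat ^ 'n \<Rightarrow> nat ^ 'n \<Rightarrow> ennreal"
    using assms by (intro psum2_rows) auto
  then show ?thesis using that[of C "max c d"] C assms by auto
qed

text \<open>Taylor shift in \<open>z\<close> and in its conjugate, treated as independent variables: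
  the majorant of the derivatives at a second base point.\<close>

definition dshift :: "real \<Rightarrow> (nat ^ 'n \<Rightarrow> nat ^ 'n \<Rightarrow> ennreal) \<Rightarrow> nat ^ 'n \<Rightarrow> nat ^ 'n \<Rightarrow> ennreal" where
  "dshift w X R S = shift_op w (\<lambda>M. shift_op w (X M) S) R"

text \<open>One shift acts on the rows, the other becomes a shift on rows after a transposition;
  each adds \<open>w\<close> to the base.\<close>

lemma psum2_dshift:
  assumes "c \<ge> 0" "w \<ge> 0"
  obtains C d where "C < top" "d \<ge> 0" "\<And>X :: nat ^ 'n \<Rightarrow> nat ^ 'n \<Rightarrow> ennreal.
    psum2 k c (dshift w X) \<le> C * psum2 k d X"
proof -
  obtain C where C: "C < top" "\<And>X :: nat ^ 'n \<Rightarrow> nat ^ 'n \<Rightarrow> ennreal.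
      psum2 k c (\<lambda>R. shift_op w (X R)) \<le> C * psum2 k (c + w) X"
    using psum2_shift_rows[OF assms] by metis
  obtain D where D: "D < top" "\<And>X :: nat ^ 'n \<Rightarrow> nat ^ 'n \<Rightarrow> ennreal.
      psum2 k (c + w) (\<lambda>R. shift_op w (X R)) \<le> D * psum2 k (c + w + w) X"
    using psum2_shift_rows[of "c + w" w] assms by (metis add_nonneg_nonneg)
  show ?thesis
  proof (rule that)
    fix X :: "nat ^ 'n \<Rightarrow> nat ^ 'n \<Rightarrow> ennreal"
    have "psum2 k c (dshift w X) = psum2 k c (\<lambda>S. shift_op w (\<lambda>M. shift_op w (X M) S))"
      unfolding dshift_def by (subst psum2_transpose[symmetric]) simp
    also have "\<dots> \<le> C * psum2 k (c + w) (\<lambda>S M. shift_op w (X M) S)"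
      by (rule C(2))
    finally have 1: "psum2 k c (dshift w X) \<le> C * psum2 k (c + w) (\<lambda>M. shift_op w (X M))"
      by (subst (asm) psum2_transpose)
    show "psum2 k c (dshift w X) \<le> (C * D) * psum2 k (c + w + w) X"
      by (rule ennreal_bound_trans(2)[OF C(1) D(1) 1 D(2)])
    show "C * D < top" by (rule ennreal_bound_trans(1)[OF C(1) D(1) 1 D(2)])
  qed (use assms in auto)
qed

text \<open>This absorbs the base. The factor \<open>c ^ (|R| + |S|)\<close> is split off the
  weights, and Cauchy-Schwarz with weights of base 1 separates its square, which sums to
  \<open>?E * ?E\<close>, from the squared powers of the entries.\<close>

lemma psum2_square_le:
  assumes "c \<ge> 0"
  obtains C where "C < top" "\<And>X :: nat ^ 'n \<Rightarrow> nat ^ 'n \<Rightarrow> ennreal. (psum2 k c X)\<^sup>2 \<le> C * psum2 (Suc k) 1 X"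
proof
  let ?E = "(\<Sum>\<^sub>\<infinity>R :: nat ^ 'n. ennreal (mwt (c\<^sup>2) R))"
  show "?E * ?E < top"
    using infsum_mwt_finite[of "c\<^sup>2", where ?'n = 'n] by (simp add: ennreal_mult_less_top)
  fix X :: "nat ^ 'n \<Rightarrow> nat ^ 'n \<Rightarrow> ennreal"
  define w where "w = (\<lambda>(R :: nat ^ 'n, S :: nat ^ 'n). ennreal (mwt 1 R * mwt 1 S))"
  define a where "a = (\<lambda>(R :: nat ^ 'n, S :: nat ^ 'n). ennreal (c ^ (mi_abs R + mi_abs S)))"
  define b where "b = (\<lambda>(R, S). X R S ^ (2 ^ k))"
  have *: "mwt (c * c) R = c ^ mi_abs R * c ^ mi_abs R * mwt 1 R" "mwt c R = c ^ mi_abs R * mwt 1 R"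
    for R :: "nat ^ 'n"
    using mwt_mult[of "c * c" 1 R] mwt_mult[of c 1 R] by (simp_all add: power_mult_distrib)
  have "psum2 k c X = (\<Sum>\<^sub>\<infinity>i\<in>UNIV. w i * a i * b i)"
    unfolding psum2_def psum_def infsum_cmult_ennreal[symmetric] infsum_Sigma_ennreal UNIV_Times_UNIV
    using assms by (intro infsum_cong) (auto simp: w_def a_def b_def * power_add ennreal_mult mult_ac)
  moreover have "(\<Sum>\<^sub>\<infinity>i\<in>UNIV. w i * (a i)\<^sup>2) = ?E * ?E"
    unfolding infsum_mult_infsum_ennreal infsum_Sigma_ennreal UNIV_Times_UNIV
    using assms by (intro infsum_cong)
      (auto simp: w_def a_def * power_add ennreal_mult power2_eq_square mult_ac)
  moreover have "(\<Sum>\<^sub>\<infinity>i\<in>UNIV. w i * (b i)\<^sup>2) = psum2 (Suc k) 1 X"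
    unfolding psum2_def psum_def infsum_cmult_ennreal[symmetric] infsum_Sigma_ennreal UNIV_Times_UNIV
    by (intro infsum_cong) (auto simp: w_def b_def ennreal_mult power_mult[symmetric] mult_ac)
  ultimately show "(psum2 k c X)\<^sup>2 \<le> ?E * ?E * psum2 (Suc k) 1 X"
    using Cauchy_Schwarz_infsum_ennreal[of w a b UNIV] by simp
qed

lemma psum2_member:
  obtains C where "C < top" "\<And>X :: nat ^ 'n \<Rightarrow> nat ^ 'n \<Rightarrow> ennreal. X R S \<le> C * psum2 0 1 X"
proof
  define C where "C = ennreal (real (mi_fact R) * real (mi_fact S))"
  show "C < top" by (simp add: C_def)
  fix X :: "nat ^ 'n \<Rightarrow> nat ^ 'n \<Rightarrow> ennreal"
  have "ennreal (mwt 1 S) * X R S \<le> psum 0 1 (X R)"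
    unfolding psum_def using infsum_member_le_ennreal[of S UNIV "\<lambda>S. ennreal (mwt 1 S) * X R S"] by simp
  then have "ennreal (mwt 1 R) * (ennreal (mwt 1 S) * X R S) \<le> ennreal (mwt 1 R) * psum 0 1 (X R)"
    by (rule mult_left_mono) simp
  also have "\<dots> \<le> psum2 0 1 X"
    unfolding psum2_def by (rule infsum_member_le_ennreal) simp
  finally have "C * (ennreal (mwt 1 R) * (ennreal (mwt 1 S) * X R S)) \<le> C * psum2 0 1 X"
    by (rule mult_left_mono) simp
  also have "C * (ennreal (mwt 1 R) * (ennreal (mwt 1 S) * X R S))
      = ennreal (real (mi_fact R) * real (mi_fact S) * mwt 1 R * mwt 1 S) * X R S"
    by (simp add: C_def ennreal_mult mult.assoc)
  also have "real (mi_fact R) * real (mi_fact S) * mwt 1 R * mwt 1 S = 1"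
    using mi_fact_pos[of R] mi_fact_pos[of S] by (simp add: mwt_def)
  finally show "X R S \<le> C * psum2 0 1 X" by simp
qed

section \<open>The recursion of the seminorms as an operation on arrays\<close>

definition wick_step :: "(nat ^ 'n \<Rightarrow> nat ^ 'n \<Rightarrow> ennreal) \<Rightarrow> nat ^ 'n \<Rightarrow> nat ^ 'n \<Rightarrow> ennreal" where
  "wick_step Y R S = shift_op 1 (\<lambda>M. (binom_op (\<lambda>I. binom_op (Y I) M) R)\<^sup>2) S"

text \<open>The recursion of \<open>wick_h\<close> with the derivatives replaced by an arbitrary
  array. An odd \<open>l\<close> transposes the previous level, so the outer sum of the step runs
  over what was its first index.\<close>

primrec wick_array :: "nat \<Rightarrow> nat \<Rightarrow> (nat ^ 'n \<Rightarrow> nat ^ 'n \<Rightarrow> ennreal) \<Rightarrow> nat ^ 'n \<Rightarrow> nat ^ 'n \<Rightarrow> ennreal" where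
  "wick_array 0 l X = (\<lambda>R. shift_op 1 (\<lambda>M. (X R M)\<^sup>2))"
| "wick_array (Suc m) l X = wick_step (if even l then wick_array m (l div 2) X
     else (\<lambda>R S. wick_array m ((l - 1) div 2) X S R))"

text \<open>The shift adds 1 to the base, the square raises \<open>k\<close> by one, and the
  binomial sums in the two indices each replace the base by another one.\<close>

lemma psum2_wick_step:
  assumes "c \<ge> 0"
  obtains C d where "C < top" "d \<ge> 0" "\<And>Y :: nat ^ 'n \<Rightarrow> nat ^ 'n \<Rightarrow> ennreal.
    psum2 k c (wick_step Y) \<le> C * psum2 (Suc k) d Y"
proof -
  obtain C1 where C1: "C1 < top" "\<And>X :: nat ^ 'n \<Rightarrow> nat ^ 'n \<Rightarrow> ennreal.
      psum2 k c (\<lambda>R. shift_op 1 (X R)) \<le> C1 * psum2 k (c + 1) X"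
    using psum2_shift_rows[OF assms, of 1] by (metis zero_le_one)
  obtain C2 d2 where C2: "C2 < top" "d2 \<ge> 0" "\<And>X :: nat ^ 'n \<Rightarrow> nat ^ 'n \<Rightarrow> ennreal.
      psum2 (Suc k) (c + 1) (\<lambda>R. binom_op (X R)) \<le> C2 * psum2 (Suc k) d2 X"
    using psum2_binom_rows[of "c + 1"] assms by (metis add_nonneg_nonneg zero_le_one)
  obtain C3 d3 where C3: "C3 < top" "d3 \<ge> 0" "\<And>X :: nat ^ 'n \<Rightarrow> nat ^ 'n \<Rightarrow> ennreal.
      psum2 (Suc k) d2 (\<lambda>R. binom_op (X R)) \<le> C3 * psum2 (Suc k) d3 X"
    using psum2_binom_rows[OF C2(2)] by metis
  show ?thesis
  proof (rule that)
    fix Y :: "nat ^ 'n \<Rightarrow> nat ^ 'n \<Rightarrow> ennreal"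
    define Z where "Z = (\<lambda>R M. binom_op (\<lambda>I. binom_op (Y I) M) R)"
    have "wick_step Y = (\<lambda>R. shift_op 1 (\<lambda>M. (Z R M)\<^sup>2))"
      by (simp add: wick_step_def Z_def fun_eq_iff)
    then have 1: "psum2 k c (wick_step Y) \<le> C1 * psum2 (Suc k) (c + 1) Z"
      using C1(2)[of "\<lambda>R M. (Z R M)\<^sup>2"] by (simp add: psum2_square)
    have "psum2 (Suc k) (c + 1) Z = psum2 (Suc k) (c + 1) (\<lambda>M. binom_op (\<lambda>I. binom_op (Y I) M))"
      unfolding Z_def by (subst psum2_transpose[symmetric]) simp
    also have "\<dots> \<le> C2 * psum2 (Suc k) d2 (\<lambda>M I. binom_op (Y I) M)"
      by (rule C2)
    finally have 2: "psum2 (Suc k) (c + 1) Z \<le> C2 * psum2 (Suc k) d2 (\<lambda>I. binom_op (Y I))"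
      by (subst (asm) psum2_transpose)
    note 12 = ennreal_bound_trans[OF C1(1) C2(1) 1 2]
    note 123 = ennreal_bound_trans[OF 12(1) C3(1) 12(2) C3(3)]
    show "psum2 k c (wick_step Y) \<le> (C1 * C2 * C3) * psum2 (Suc k) d3 Y" by (rule 123)
    show "C1 * C2 * C3 < top" by (rule 123)
  qed (rule C3(2))
qed

text \<open>Each level of the recursion contains one squaring, and so does the base level, so
  \<open>k\<close> rises by \<open>m + 1\<close>. Constant and base are uniform in the
  array.\<close>

lemma psum2_wick_array:
  assumes "c \<ge> 0"
  shows "\<exists>C d. C < top \<and> d \<ge> 0 \<and> (\<forall>X :: nat ^ 'n \<Rightarrow> nat ^ 'n \<Rightarrow> ennreal.
    psum2 k c (wick_array m l X) \<le> C * psum2 (k + m + 1) d X)"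
  using assms
proof (induction m arbitrary: l k c)
  case 0
  obtain C where C: "C < top" "\<And>X :: nat ^ 'n \<Rightarrow> nat ^ 'n \<Rightarrow> ennreal.
      psum2 k c (\<lambda>R. shift_op 1 (X R)) \<le> C * psum2 k (c + 1) X"
    using psum2_shift_rows[OF 0, of 1] by (metis zero_le_one)
  have "psum2 k c (wick_array 0 l X) \<le> C * psum2 (k + 0 + 1) (c + 1) X"
    for X :: "nat ^ 'n \<Rightarrow> nat ^ 'n \<Rightarrow> ennreal"
    using C(2)[of "\<lambda>R M. (X R M)\<^sup>2"] by (simp add: psum2_square)
  moreover have "c + 1 \<ge> 0" using 0 by simp
  ultimately show ?case using C(1) by blast
next
  case (Suc m)
  define l' where "l' = (if even l then l div 2 else (l - 1) div 2)"
  obtain C d where C: "C < top" "d \<ge> 0" "\<And>Y :: nat ^ 'n \<Rightarrow> nat ^ 'n \<Rightarrow> ennreal.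
      psum2 k c (wick_step Y) \<le> C * psum2 (Suc k) d Y"
    using psum2_wick_step[OF Suc.prems] by metis
  obtain D e where D: "D < top" "e \<ge> 0" "\<And>X :: nat ^ 'n \<Rightarrow> nat ^ 'n \<Rightarrow> ennreal.
      psum2 (Suc k) d (wick_array m l' X) \<le> D * psum2 (Suc k + m + 1) e X"
    using Suc.IH[OF C(2)] by metis
  have "psum2 k c (wick_array (Suc m) l X) \<le> (C * D) * psum2 (k + Suc m + 1) e X"
    for X :: "nat ^ 'n \<Rightarrow> nat ^ 'n \<Rightarrow> ennreal"
  proof -
    \<comment> \<open>For odd \<open>l\<close> the previous level enters transposed, which
      \<open>psum2\<close> does not see.\<close>
    have "psum2 k c (wick_array (Suc m) l X) \<le> C * psum2 (Suc k) d (wick_array m l' X)"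
      using C(3) psum2_transpose[of "Suc k" d "wick_array m l' X"] by (simp add: l'_def split: if_splits) metis+
    from ennreal_bound_trans(2)[OF C(1) D(1) this D(3)] show ?thesis by simp
  qed
  moreover have "C * D < top" using C D by (simp add: ennreal_mult_less_top)
  ultimately show ?case using D(2) by blast
qed

lemma le_shift_op: "y R \<le> shift_op w y R"
  using infsum_member_le_ennreal[of 0 UNIV "\<lambda>K. ennreal (mwt w K) * y (R + K)"]
  by (simp add: shift_op_def)

lemma le_binom_op: "y R \<le> binom_op y R"
  using sum_mono2[of "{..R}" "{R}" "\<lambda>I. of_nat (mi_binom R I) * y I"]
  by (simp add: binom_op_def mi_binom_def)

lemma le_binom_op2: "Y R S \<le> binom_op (\<lambda>I. binom_op (Y I) S) R"
  using le_binom_op[of "Y R" S] le_binom_op[of "\<lambda>I. binom_op (Y I) S" R] by (rule order_trans)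

lemma shift_op_mono: "(\<And>M. y M \<le> z M) \<Longrightarrow> shift_op w y R \<le> shift_op w z R"
  unfolding shift_op_def by (intro infsum_mono_ennreal mult_left_mono) auto

lemma shift_square_le_wick_step: "shift_op 1 (\<lambda>M. (Y R M)\<^sup>2) S \<le> wick_step Y R S"
  unfolding wick_step_def by (intro shift_op_mono power_mono le_binom_op2) auto

text \<open>At every level only the summand \<open>N = 0\<close> with \<open>I = R\<close> and
  \<open>J = S\<close> is kept; \<open>l = 0\<close> takes the even branch throughout.\<close>

lemma power_le_wick_array: "X R S ^ (2 ^ Suc m) \<le> wick_array m 0 X R S"
proof (induction m arbitrary: R S)
  case 0
  show ?case using le_shift_op[of "\<lambda>M. (X R M)\<^sup>2"] by simp
next
  case (Suc m)
  have "X R S ^ (2 ^ Suc (Suc m)) = (X R S ^ (2 ^ Suc m))\<^sup>2"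
    by (simp add: power_mult[symmetric] mult.commute)
  also have "\<dots> \<le> (wick_array m 0 X R S)\<^sup>2"
    by (rule power_mono[OF Suc]) simp
  also have "\<dots> \<le> shift_op 1 (\<lambda>M. (wick_array m 0 X R M)\<^sup>2) S"
    by (rule le_shift_op)
  also have "\<dots> \<le> wick_array (Suc m) 0 X R S"
    using shift_square_le_wick_step[of "wick_array m 0 X"] by simp
  finally show ?case .
qed

text \<open>Now the whole outer sum of the top level is kept. With second index 0 it runs over a
  full row, and its square turns the exponent \<open>2 ^ Suc m\<close> of the lower levels into
  \<open>2 ^ (m + 2)\<close>.\<close>

lemma psum_le_wick_array: "psum (m + 2) 1 (X R) \<le> wick_array (Suc m) 0 X R 0"
proof -
  have "psum (m + 2) 1 (X R) = shift_op 1 (\<lambda>M. (X R M ^ (2 ^ Suc m))\<^sup>2) 0"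
    by (simp add: psum_def shift_op_def power_mult[symmetric] mult.commute)
  also have "\<dots> \<le> shift_op 1 (\<lambda>M. (wick_array m 0 X R M)\<^sup>2) 0"
    by (intro shift_op_mono power_mono power_le_wick_array) simp
  also have "\<dots> \<le> wick_array (Suc m) 0 X R 0"
    using shift_square_le_wick_step[of "wick_array m 0 X"] by simp
  finally show ?thesis .
qed

text \<open>The index \<open>l = 1\<close> is odd at the top level and becomes 0 below. The
  transposition lets the outer sum run over the rows, and since the step squares its entries, the
  row sums appear squared; Jensen with total mass \<open>?E\<close> compares this with the square of
  their sum.\<close>

lemma psum2_square_le_wick_array:
  obtains C where "C < top" "\<And>X :: nat ^ 'n \<Rightarrow> nat ^ 'n \<Rightarrow> ennreal.
    (psum2 (m + 2) 1 X)\<^sup>2 \<le> C * wick_array (m + 2) 1 X 0 0"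
proof
  let ?E = "(\<Sum>\<^sub>\<infinity>R :: nat ^ 'n. ennreal (mwt 1 R))"
  show "?E < top" by (rule infsum_mwt_finite) simp
  fix X :: "nat ^ 'n \<Rightarrow> nat ^ 'n \<Rightarrow> ennreal"
  have "(psum2 (m + 2) 1 X)\<^sup>2 \<le> ?E * (\<Sum>\<^sub>\<infinity>K. ennreal (mwt 1 K) * (psum (m + 2) 1 (X K))\<^sup>2)"
    unfolding psum2_def
    using infsum_power_mean[of "\<lambda>K. ennreal (mwt 1 K)" "\<lambda>K. psum (m + 2) 1 (X K)" UNIV 1] by simp
  also have "\<dots> \<le> ?E * (\<Sum>\<^sub>\<infinity>K. ennreal (mwt 1 K) * (wick_array (Suc m) 0 X K 0)\<^sup>2)"
    by (intro mult_left_mono infsum_mono_ennreal power_mono psum_le_wick_array) auto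
  also have "\<dots> = ?E * shift_op 1 (\<lambda>M. (wick_array (Suc m) 0 X M 0)\<^sup>2) 0"
    by (simp add: shift_op_def)
  also have "\<dots> \<le> ?E * wick_array (m + 2) 1 X 0 0"
    using shift_square_le_wick_step[of "\<lambda>R S. wick_array (Suc m) 0 X S R" 0 0]
    by (intro mult_left_mono) auto
  finally show "(psum2 (m + 2) 1 X)\<^sup>2 \<le> ?E * wick_array (m + 2) 1 X 0 0" .
qed

lemma ennreal_square_bound:
  assumes "C < top" "D < top" "x \<le> C * y" "y\<^sup>2 \<le> D * z"
  shows "C\<^sup>2 * D < (top :: ennreal)" "x\<^sup>2 \<le> (C\<^sup>2 * D) * z"
proof -
  have "x\<^sup>2 \<le> (C * y)\<^sup>2" using assms(3) by (rule power_mono) simp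
  also have "\<dots> = C\<^sup>2 * y\<^sup>2" by (rule power_mult_distrib)
  finally have 1: "x\<^sup>2 \<le> C\<^sup>2 * y\<^sup>2" .
  have "C\<^sup>2 < top" using assms(1) by (simp add: power_less_top_ennreal)
  from ennreal_bound_trans[OF this assms(2) 1 assms(4)]
  show "C\<^sup>2 * D < top" "x\<^sup>2 \<le> (C\<^sup>2 * D) * z" .
qed

text \<open>A single seminorm at the old point controls a given one at the new point. The entry is
  bounded by a power sum of order \<open>m + 1\<close> with some base; one squaring brings the base
  back to 1 and the order to \<open>m + 2\<close>, another is spent in reaching
  \<open>wick_array (m + 2) 1\<close>. Hence the fourth power.\<close>

lemma wick_array_dshift_le:
  assumes "w \<ge> 0"
  obtains C where "C < top" "\<And>X X' :: nat ^ 'n \<Rightarrow> nat ^ 'n \<Rightarrow> ennreal.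
    (\<And>R S. X' R S \<le> dshift w X R S) \<Longrightarrow> (wick_array m l X' R S) ^ 4 \<le> C * wick_array (m + 2) 1 X 0 0"
proof -
  obtain C1 where C1: "C1 < top" "\<And>X :: nat ^ 'n \<Rightarrow> nat ^ 'n \<Rightarrow> ennreal. X R S \<le> C1 * psum2 0 1 X"
    using psum2_member by metis
  obtain C2 d2 where C2: "C2 < top" "d2 \<ge> 0" "\<And>X :: nat ^ 'n \<Rightarrow> nat ^ 'n \<Rightarrow> ennreal.
      psum2 0 1 (wick_array m l X) \<le> C2 * psum2 (0 + m + 1) d2 X"
    using psum2_wick_array[of 1] by (metis zero_le_one)
  obtain C3 d3 where C3: "C3 < top" "d3 \<ge> 0" "\<And>X :: nat ^ 'n \<Rightarrow> nat ^ 'n \<Rightarrow> ennreal.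
      psum2 (m + 1) d2 (dshift w X) \<le> C3 * psum2 (m + 1) d3 X"
    using psum2_dshift[OF C2(2) assms] by metis
  obtain C4 where C4: "C4 < top" "\<And>X :: nat ^ 'n \<Rightarrow> nat ^ 'n \<Rightarrow> ennreal.
      (psum2 (m + 1) d3 X)\<^sup>2 \<le> C4 * psum2 (Suc (m + 1)) 1 X"
    using psum2_square_le[OF C3(2)] by metis
  obtain C5 where C5: "C5 < top" "\<And>X :: nat ^ 'n \<Rightarrow> nat ^ 'n \<Rightarrow> ennreal.
      (psum2 (m + 2) 1 X)\<^sup>2 \<le> C5 * wick_array (m + 2) 1 X 0 0"
    using psum2_square_le_wick_array by metis
  have B: "((C1 * C2 * C3)\<^sup>2 * C4)\<^sup>2 * C5 < top \<and>
      (wick_array m l X' R S) ^ 4 \<le> ((C1 * C2 * C3)\<^sup>2 * C4)\<^sup>2 * C5 * wick_array (m + 2) 1 X 0 0"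
    if X: "\<And>R S. X' R S \<le> dshift w X R S" for X X' :: "nat ^ 'n \<Rightarrow> nat ^ 'n \<Rightarrow> ennreal"
  proof -
    have "C2 * psum2 (0 + m + 1) d2 X' \<le> C2 * psum2 (m + 1) d2 (dshift w X)"
      using psum2_mono[OF C2(2) order_refl X] by (intro mult_left_mono) auto
    with C2(3)[of X'] have 2: "psum2 0 1 (wick_array m l X') \<le> C2 * psum2 (m + 1) d2 (dshift w X)"
      by (rule order_trans)
    note a = ennreal_bound_trans[OF C1(1) C2(1) C1(2) 2]
    note b = ennreal_bound_trans[OF a(1) C3(1) a(2) C3(3)]
    note c = ennreal_square_bound[OF b(1) C4(1) b(2) C4(2)]
    have c2: "(wick_array m l X' R S)\<^sup>2 \<le> (C1 * C2 * C3)\<^sup>2 * C4 * psum2 (m + 2) 1 X"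
      using c(2) by simp
    note d = ennreal_square_bound[OF c(1) C5(1) c2 C5(2)]
    show ?thesis using d by (simp add: power_mult[symmetric])
  qed
  show ?thesis
  proof (rule that)
    \<comment> \<open>The constant does not depend on the arrays, so its finiteness may be read off
      at zero.\<close>
    show "((C1 * C2 * C3)\<^sup>2 * C4)\<^sup>2 * C5 < top"
      using B[of "\<lambda>_ _. 0" "\<lambda>_ _. 0"] by simp
  qed (use B in blast)
qed

lemma ennreal_square_less_topI: "C < top \<Longrightarrow> y < top \<Longrightarrow> x\<^sup>2 \<le> C * y \<Longrightarrow> x < (top :: ennreal)"
  by (metis ennreal_mult_less_top le_less_trans power_less_top_ennreal zero_neq_numeral)

text \<open>Two squarings lead down from order 2 to order 0, and the last one admits an arbitrary
  base. So one seminorm is enough to make the Taylor series converge on the whole space.\<close>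

lemma psum2_finite_if_wick_array:
  fixes X :: "nat ^ 'n \<Rightarrow> nat ^ 'n \<Rightarrow> ennreal"
  assumes "wick_array 2 1 X 0 0 < top" "c \<ge> 0"
  shows "psum2 0 c X < top"
proof -
  obtain C where "C < top" "(psum2 2 1 X)\<^sup>2 \<le> C * wick_array 2 1 X 0 0"
    using psum2_square_le_wick_array[of 0] by (metis add_0)
  then have 2: "psum2 2 1 X < top"
    using assms(1) ennreal_square_less_topI by blast
  obtain C where "C < top" "(psum2 1 1 X)\<^sup>2 \<le> C * psum2 (Suc 1) 1 X"
    using psum2_square_le[of 1] by (metis zero_le_one)
  then have 1: "psum2 1 1 X < top"
    using 2 ennreal_square_less_topI by (metis Suc_1)
  obtain C where "C < top" "(psum2 0 c X)\<^sup>2 \<le> C * psum2 (Suc 0) 1 X"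
    using psum2_square_le[OF assms(2)] by metis
  then show ?thesis
    using 1 ennreal_square_less_topI by (metis One_nat_def)
qed

section \<open>Smooth functions and vanishing jets\<close>

lemma second_difference_bound:
  fixes f :: "'a::real_normed_vector \<Rightarrow> real"
  assumes f: "\<And>y. (f has_derivative f' y) (at y)"
    and A: "((\<lambda>y. f' y v) has_derivative A) (at x)" and "\<epsilon> > 0"
  obtains \<delta> where "\<delta> > 0" "\<And>t. 0 < t \<Longrightarrow> t < \<delta> \<Longrightarrow>
    \<bar>f (x + t *\<^sub>R v + t *\<^sub>R w) - f (x + t *\<^sub>R v) - f (x + t *\<^sub>R w) + f x - t\<^sup>2 * A w\<bar> \<le> \<epsilon> * t\<^sup>2"
proof -
  \<comment> \<open>In units of \<open>t\<close>, this bounds the displacements from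
    \<open>x\<close> of the two points compared below as well as the sum
    \<open>2 * norm v + norm w\<close> of their bounds; the 1 makes it positive.\<close>
  define K where "K = 2 * norm v + norm w + 1"
  have K: "K > 0" by (simp add: K_def add_nonneg_pos)
  interpret A: bounded_linear A using A by (rule has_derivative_bounded_linear)
  obtain d where d: "d > 0" "\<And>y. norm (y - x) < d \<Longrightarrow>
      norm (f' y v - f' x v - A (y - x)) \<le> (\<epsilon> / K) * norm (y - x)"
    using A K \<open>\<epsilon> > 0\<close> unfolding has_derivative_at_alt by (metis divide_pos_pos)
  show ?thesis
  proof (rule that)
    show "d / K > 0" using d K by simp
    fix t assume t: "0 < t" "t < d / K"
    \<comment> \<open>The mean value theorem is applied to the difference in direction
      \<open>w\<close> as a function of the step along \<open>v\<close>; the first derivative of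
      \<open>f\<close> is then compared with its linearisation at \<open>x\<close>, once with and
      once without the displacement by \<open>w\<close>.\<close>
    define g where "g s = f (x + s *\<^sub>R v + t *\<^sub>R w) - f (x + s *\<^sub>R v)" for s
    define g' where "g' s = f' (x + s *\<^sub>R v + t *\<^sub>R w) v - f' (x + s *\<^sub>R v) v" for s
    have lin: "f' y (c *\<^sub>R v) = c * f' y v" for y c
      using has_derivative_bounded_linear[OF f] by (metis linear_simps(5) real_scaleR_def)
    have "(g has_real_derivative g' s) (at s)" for s
    proof -
      have "(g has_derivative (\<lambda>h. f' (x + s *\<^sub>R v + t *\<^sub>R w) (h *\<^sub>R v) - f' (x + s *\<^sub>R v) (h *\<^sub>R v))) (at s)"
        unfolding g_def
        by (rule has_derivative_diff;
            rule has_derivative_compose[OF _ f]; auto intro!: derivative_eq_intros)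
      also have "(\<lambda>h. f' (x + s *\<^sub>R v + t *\<^sub>R w) (h *\<^sub>R v) - f' (x + s *\<^sub>R v) (h *\<^sub>R v)) = (*) (g' s)"
        by (auto simp: lin g'_def algebra_simps)
      finally show ?thesis
        by (simp add: has_field_derivative_def)
    qed
    then obtain s where s: "0 < s" "s < t" "g t - g 0 = (t - 0) * g' s"
      using MVT2[of 0 t g g'] t by auto
    have b: "norm (f' (x + y) v - f' x v - A y) \<le> (\<epsilon> / K) * (t * m)"
      if "norm y \<le> t * m" "m \<le> K" for y m
    proof -
      have "t * m \<le> t * K" using that t by simp
      moreover have "t * K < d" using t K by (simp add: field_simps)
      ultimately have "norm (f' (x + y) v - f' x v - A y) \<le> (\<epsilon> / K) * norm y"
        using d(2)[of "x + y"] that by simp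
      also have "\<dots> \<le> (\<epsilon> / K) * (t * m)"
        using that \<open>\<epsilon> > 0\<close> K by (intro mult_left_mono) auto
      finally show ?thesis .
    qed
    have mK: "norm v + norm w \<le> K" "norm v \<le> K" by (auto simp: K_def)
    have n1: "norm (s *\<^sub>R v) \<le> t * norm v"
      using s by (simp add: mult_right_mono)
    then have n2: "norm (s *\<^sub>R v + t *\<^sub>R w) \<le> t * (norm v + norm w)"
      using norm_triangle_ineq[of "s *\<^sub>R v" "t *\<^sub>R w"] t by (simp add: algebra_simps)
    have "\<bar>g' s - t * A w\<bar> \<le> (\<epsilon> / K) * (t * (norm v + norm w)) + (\<epsilon> / K) * (t * norm v)"
      using b[OF n2 mK(1)] b[OF n1 mK(2)] by (simp add: g'_def add.assoc A.add A.scaleR)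
    also have "\<dots> = (\<epsilon> / K) * t * (2 * norm v + norm w)"
      by (simp add: algebra_simps)
    also have "\<dots> \<le> (\<epsilon> / K) * t * K"
      using \<open>\<epsilon> > 0\<close> K t by (intro mult_left_mono) (auto simp: K_def)
    finally have "\<bar>g' s - t * A w\<bar> \<le> \<epsilon> * t" using K by simp
    then have "t * \<bar>g' s - t * A w\<bar> \<le> t * (\<epsilon> * t)"
      using t by (intro mult_left_mono) auto
    also have "t * \<bar>g' s - t * A w\<bar> = \<bar>t * g' s - t\<^sup>2 * A w\<bar>"
      using t by (simp add: abs_mult power2_eq_square mult.assoc flip: right_diff_distrib)
    also have "t * g' s = f (x + t *\<^sub>R v + t *\<^sub>R w) - f (x + t *\<^sub>R v) - f (x + t *\<^sub>R w) + f x"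
      using s(3) by (simp add: g_def)
    finally show "\<bar>f (x + t *\<^sub>R v + t *\<^sub>R w) - f (x + t *\<^sub>R v) - f (x + t *\<^sub>R w) + f x - t\<^sup>2 * A w\<bar> \<le> \<epsilon> * t\<^sup>2"
      by (simp add: power2_eq_square mult_ac)
  qed
qed

text \<open>The second difference is symmetric in \<open>v\<close> and \<open>w\<close>, so its two
  quadratic approximations must agree.\<close>

lemma symmetric_second_derivative_real:
  fixes f :: "'a::real_normed_vector \<Rightarrow> real"
  assumes f: "\<And>y. (f has_derivative f' y) (at y)"
    and A: "((\<lambda>y. f' y v) has_derivative A) (at x)"
    and B: "((\<lambda>y. f' y w) has_derivative B) (at x)"
  shows "A w = B v"
proof (rule ccontr)
  assume "A w \<noteq> B v"
  \<comment> \<open>Two errors of a third of the gap cannot add up to the gap.\<close>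
  define e where "e = \<bar>A w - B v\<bar> / 3"
  have e: "e > 0" using \<open>A w \<noteq> B v\<close> by (simp add: e_def)
  obtain d1 where d1: "d1 > 0" "\<And>t. 0 < t \<Longrightarrow> t < d1 \<Longrightarrow>
    \<bar>f (x + t *\<^sub>R v + t *\<^sub>R w) - f (x + t *\<^sub>R v) - f (x + t *\<^sub>R w) + f x - t\<^sup>2 * A w\<bar> \<le> e * t\<^sup>2"
    using second_difference_bound[OF f A e] by metis
  obtain d2 where d2: "d2 > 0" "\<And>t. 0 < t \<Longrightarrow> t < d2 \<Longrightarrow>
    \<bar>f (x + t *\<^sub>R w + t *\<^sub>R v) - f (x + t *\<^sub>R w) - f (x + t *\<^sub>R v) + f x - t\<^sup>2 * B v\<bar> \<le> e * t\<^sup>2"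
    using second_difference_bound[OF f B e] by metis
  define t where "t = min d1 d2 / 2"
  have t: "0 < t" "t < d1" "t < d2" using d1 d2 by (auto simp: t_def)
  have "\<bar>t\<^sup>2 * A w - t\<^sup>2 * B v\<bar> \<le> 2 * (e * t\<^sup>2)"
    using d1(2)[of t] d2(2)[of t] t by (simp add: add.commute add.left_commute)
  also have "\<bar>t\<^sup>2 * A w - t\<^sup>2 * B v\<bar> = t\<^sup>2 * (3 * e)"
    by (simp add: e_def abs_mult flip: right_diff_distrib)
  finally show False using e t by (simp add: algebra_simps)
qed

section \<open>Calculus of iterated directional derivatives\<close>

lemma has_derivative_dir_deriv:
  "f differentiable (at x) \<Longrightarrow> (f has_derivative (\<lambda>v. dir_deriv v f x)) (at x)"
  unfolding dir_deriv_def using frechet_derivative_works by blast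

lemma dir_deriv_eqI: "(f has_derivative f') (at x) \<Longrightarrow> dir_deriv v f x = f' v"
  unfolding dir_deriv_def by (metis frechet_derivative_at)

lemma dir_derivs_append: "dir_derivs (vs @ ws) f = dir_derivs vs (dir_derivs ws f)"
  by (induction vs) auto

lemma smooth_differentiable: "smooth f \<Longrightarrow> f differentiable (at x)"
  unfolding smooth_def by (metis dir_derivs.simps(1))

lemma smooth_dir_deriv: "smooth f \<Longrightarrow> smooth (dir_deriv v f)"
  unfolding smooth_def by (metis dir_derivs_append dir_derivs.simps)

lemma smooth_dir_derivs: "smooth f \<Longrightarrow> smooth (dir_derivs vs f)"
  by (induction vs) (auto intro: smooth_dir_deriv)

text \<open>Iterated derivatives of a product or of a series have no convenient closed form; an
  invariant set containing the function replaces them. This serves products, constants and entire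
  series.\<close>

lemma smooth_coinduct:
  assumes "f \<in> F" "\<And>u x. u \<in> F \<Longrightarrow> u differentiable (at x)" "\<And>u v. u \<in> F \<Longrightarrow> dir_deriv v u \<in> F"
  shows "smooth f"
proof -
  have "dir_derivs vs f \<in> F" for vs by (induction vs) (use assms in auto)
  then show ?thesis using assms(2) by (auto simp: smooth_def)
qed

lemma dir_deriv_add:
  "f differentiable (at x) \<Longrightarrow> g differentiable (at x) \<Longrightarrow>
    dir_deriv v (\<lambda>z. f z + g z) x = dir_deriv v f x + dir_deriv v g x"
  by (intro dir_deriv_eqI[where f' = "\<lambda>v. _ v + _ v"] has_derivative_add has_derivative_dir_deriv)

lemma dir_deriv_cmult:
  "f differentiable (at x) \<Longrightarrow> dir_deriv v (\<lambda>z. c * f z) x = c * dir_deriv v f x"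
  by (intro dir_deriv_eqI[where f' = "\<lambda>v. c * _ v"] has_derivative_mult_right has_derivative_dir_deriv)

lemma dir_deriv_mult:
  "f differentiable (at x) \<Longrightarrow> g differentiable (at x) \<Longrightarrow>
    dir_deriv v (\<lambda>z. f z * g z) x = f x * dir_deriv v g x + dir_deriv v f x * g x"
  by (intro dir_deriv_eqI[where f' = "\<lambda>v. f x * _ v + _ v * g x"] has_derivative_mult has_derivative_dir_deriv)

lemma dir_deriv_cnj:
  "f differentiable (at x) \<Longrightarrow> dir_deriv v (\<lambda>z. cnj (f z)) x = cnj (dir_deriv v f x)"
  by (intro dir_deriv_eqI[where f' = "\<lambda>v. cnj (_ v)"] has_derivative_cnj has_derivative_dir_deriv)

lemma dir_deriv_add_direction:
  "f differentiable (at x) \<Longrightarrow> dir_deriv (v + w) f x = dir_deriv v f x + dir_deriv w f x"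
  using has_derivative_bounded_linear[OF has_derivative_dir_deriv] by (rule linear_simps)

lemma dir_deriv_scaleR_direction:
  "f differentiable (at x) \<Longrightarrow> dir_deriv (c *\<^sub>R v) f x = c *\<^sub>R dir_deriv v f x"
  using has_derivative_bounded_linear[OF has_derivative_dir_deriv] by (rule linear_simps)

lemma dir_derivs_add:
  "smooth f \<Longrightarrow> smooth g \<Longrightarrow>
    dir_derivs vs (\<lambda>z. f z + g z) = (\<lambda>z. dir_derivs vs f z + dir_derivs vs g z)"
  by (induction vs) (auto intro!: ext simp: dir_deriv_add smooth_differentiable smooth_dir_derivs)

lemma dir_derivs_cmult:
  "smooth f \<Longrightarrow> dir_derivs vs (\<lambda>z. c * f z) = (\<lambda>z. c * dir_derivs vs f z)"
  by (induction vs) (auto intro!: ext simp: dir_deriv_cmult smooth_differentiable smooth_dir_derivs)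

lemma dir_derivs_cnj:
  "smooth f \<Longrightarrow> dir_derivs vs (\<lambda>z. cnj (f z)) = (\<lambda>z. cnj (dir_derivs vs f z))"
  by (induction vs) (auto intro!: ext simp: dir_deriv_cnj smooth_differentiable smooth_dir_derivs)

lemma smooth_add: "smooth f \<Longrightarrow> smooth g \<Longrightarrow> smooth (\<lambda>z. f z + g z)"
  unfolding smooth_def[of "\<lambda>z. f z + g z"]
  by (simp add: dir_derivs_add differentiable_add smooth_differentiable smooth_dir_derivs)

lemma smooth_cmult: "smooth f \<Longrightarrow> smooth (\<lambda>z. c * f z)"
  unfolding smooth_def[of "\<lambda>z. c * f z"]
  by (simp add: dir_derivs_cmult differentiable_mult smooth_differentiable smooth_dir_derivs)

lemma differentiable_cnj: "f differentiable (at x) \<Longrightarrow> (\<lambda>z. cnj (f z)) differentiable (at x)"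
  unfolding differentiable_def using has_derivative_cnj by blast

lemma smooth_cnj: "smooth f \<Longrightarrow> smooth (\<lambda>z. cnj (f z))"
  unfolding smooth_def[of "\<lambda>z. cnj (f z)"]
  by (simp add: dir_derivs_cnj differentiable_cnj smooth_differentiable smooth_dir_derivs)

text \<open>By the Leibniz rule this set is closed under \<^const>\<open>dir_deriv\<close> if \<open>F\<close> is: products of smooth
  functions are smooth, and the functions with vanishing jet at a point form an ideal.\<close>

inductive_set product_span :: "'n cfun set \<Rightarrow> 'n::finite cfun set" for F where
  mult: "u \<in> F \<Longrightarrow> smooth u \<Longrightarrow> smooth g \<Longrightarrow> (\<lambda>z. u z * g z) \<in> product_span F"
| add: "u \<in> product_span F \<Longrightarrow> g \<in> product_span F \<Longrightarrow> (\<lambda>z. u z + g z) \<in> product_span F"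

lemma product_span_differentiable: "u \<in> product_span F \<Longrightarrow> u differentiable (at x)"
  by (induction rule: product_span.induct)
     (auto simp: smooth_differentiable intro!: differentiable_mult differentiable_add)

lemma product_span_dir_deriv:
  assumes "u \<in> product_span F" "\<And>u v. u \<in> F \<Longrightarrow> dir_deriv v u \<in> F"
  shows "dir_deriv v u \<in> product_span F"
  using assms(1)
proof induction
  case (mult u g)
  have "dir_deriv v (\<lambda>z. u z * g z) = (\<lambda>x. u x * dir_deriv v g x + dir_deriv v u x * g x)"
    using mult by (simp add: dir_deriv_mult smooth_differentiable fun_eq_iff)
  then show ?case
    using mult assms(2) by (auto intro!: product_span.intros smooth_dir_deriv)
next
  case (add u g)
  have "dir_deriv v (\<lambda>z. u z + g z) = (\<lambda>x. dir_deriv v u x + dir_deriv v g x)"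
    using add by (simp add: dir_deriv_add product_span_differentiable fun_eq_iff)
  then show ?case using add by (auto intro!: product_span.intros)
qed

lemma smooth_mult:
  assumes "smooth f" "smooth g" shows "smooth (\<lambda>z. f z * g z)"
proof (rule smooth_coinduct)
  show "(\<lambda>z. f z * g z) \<in> product_span UNIV" using assms by (intro product_span.mult) auto
qed (auto intro: product_span_differentiable product_span_dir_deriv)

lemma smooth_const: "smooth (\<lambda>z. c)"
proof (rule smooth_coinduct)
  show "(\<lambda>z. c) \<in> range (\<lambda>c z. c)" by blast
next
  fix u :: "'a cfun" and v assume "u \<in> range (\<lambda>c z. c)"
  then have "dir_deriv v u = (\<lambda>z. 0)"
    by (auto simp: fun_eq_iff intro!: dir_deriv_eqI)
  then show "dir_deriv v u \<in> range (\<lambda>c z. c)" by blast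
qed auto

lemma smooth_diff: "smooth f \<Longrightarrow> smooth g \<Longrightarrow> smooth (\<lambda>z. f z - g z)"
  using smooth_add[of f "\<lambda>z. -1 * g z"] smooth_cmult[of g "-1"] by simp

lemma smooth_sum: "(\<And>i. i \<in> I \<Longrightarrow> smooth (f i)) \<Longrightarrow> smooth (\<lambda>z. \<Sum>i\<in>I. f i z)"
  by (induction I rule: infinite_finite_induct) (auto intro: smooth_const smooth_add)

section \<open>Functions with vanishing jet\<close>

definition flat :: "complex ^ 'n \<Rightarrow> 'n::finite cfun \<Rightarrow> bool" where
  "flat p f \<longleftrightarrow> smooth f \<and> jet_vanishes p f"

lemma flat_dir_deriv: "flat p f \<Longrightarrow> flat p (dir_deriv v f)"
  unfolding flat_def jet_vanishes_def by (metis dir_derivs.simps dir_derivs_append smooth_dir_deriv)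

lemma flat_at: "flat p f \<Longrightarrow> f p = 0"
  unfolding flat_def jet_vanishes_def by (metis dir_derivs.simps(1))

lemma flat_coinduct:
  assumes "f \<in> F" "\<And>u. u \<in> F \<Longrightarrow> smooth u" "\<And>u. u \<in> F \<Longrightarrow> u p = 0" "\<And>u v. u \<in> F \<Longrightarrow> dir_deriv v u \<in> F"
  shows "flat p f"
proof -
  have "dir_derivs vs f \<in> F" for vs by (induction vs) (use assms in auto)
  then show ?thesis using assms by (auto simp: flat_def jet_vanishes_def)
qed

lemma flat_add: "flat p f \<Longrightarrow> flat p g \<Longrightarrow> flat p (\<lambda>z. f z + g z)"
  by (simp add: flat_def jet_vanishes_def smooth_add dir_derivs_add)

lemma flat_cmult: "flat p f \<Longrightarrow> flat p (\<lambda>z. c * f z)"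
  by (simp add: flat_def jet_vanishes_def smooth_cmult dir_derivs_cmult)

lemma flat_cnj: "flat p f \<Longrightarrow> flat p (\<lambda>z. cnj (f z))"
  by (simp add: flat_def jet_vanishes_def smooth_cnj dir_derivs_cnj)

lemma flat_mult:
  assumes "flat p f" "smooth g" shows "flat p (\<lambda>z. f z * g z)"
proof (rule flat_coinduct)
  let ?F = "product_span {f. flat p f}"
  show "(\<lambda>z. f z * g z) \<in> ?F" using assms by (intro product_span.mult) (auto simp: flat_def)
  show "smooth u" if "u \<in> ?F" for u
    using that by induction (auto intro: smooth_mult smooth_add)
  show "u p = 0" if "u \<in> ?F" for u
    using that by induction (auto simp: flat_at)
  show "dir_deriv v u \<in> ?F" if "u \<in> ?F" for u v
    using that by (rule product_span_dir_deriv) (simp add: flat_dir_deriv)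
qed

lemma flat_zero: "flat p (\<lambda>z. 0)"
proof (rule flat_coinduct)
  show "(\<lambda>z. 0) \<in> {\<lambda>z. 0 :: complex}" by simp
  show "dir_deriv v u \<in> {\<lambda>z. 0}" if "u \<in> {\<lambda>z. 0}" for u and v :: "complex ^ 'a"
    using that by (auto simp: fun_eq_iff intro!: dir_deriv_eqI)
qed (auto simp: smooth_const)

lemma flat_sum: "(\<And>i. i \<in> I \<Longrightarrow> flat p (f i)) \<Longrightarrow> flat p (\<lambda>z. \<Sum>i\<in>I. f i z)"
  by (induction I rule: infinite_finite_induct) (auto intro: flat_zero flat_add)

section \<open>Commuting derivatives and Wirtinger derivatives\<close>

lemma dir_deriv_commute:
  assumes "smooth f"
  shows "dir_deriv v (dir_deriv w f) = dir_deriv w (dir_deriv v f)"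
proof
  fix x
  have d: "(f has_derivative (\<lambda>v. dir_deriv v f y)) (at y)" for y
    using assms by (intro has_derivative_dir_deriv smooth_differentiable)
  have d2: "(dir_deriv v f has_derivative (\<lambda>w. dir_deriv w (dir_deriv v f) x)) (at x)" for v
    using assms by (intro has_derivative_dir_deriv smooth_differentiable smooth_dir_deriv)
  show "dir_deriv v (dir_deriv w f) x = dir_deriv w (dir_deriv v f) x"
  proof (rule complex_eqI)
    show "Re (dir_deriv v (dir_deriv w f) x) = Re (dir_deriv w (dir_deriv v f) x)"
      by (rule symmetric_second_derivative_real[where f = "\<lambda>z. Re (f z)" and x = x
          and f' = "\<lambda>y v. Re (dir_deriv v f y)" and v = w and w = v])
         (use has_derivative_Re[OF d] has_derivative_Re[OF d2] in auto)
    show "Im (dir_deriv v (dir_deriv w f) x) = Im (dir_deriv w (dir_deriv v f) x)"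
      by (rule symmetric_second_derivative_real[where f = "\<lambda>z. Im (f z)" and x = x
          and f' = "\<lambda>y v. Im (dir_deriv v f y)" and v = w and w = v])
         (use has_derivative_Im[OF d] has_derivative_Im[OF d2] in auto)
  qed
qed

text \<open>\<open>c = -\<i>\<close> yields \<^const>\<open>wirt\<close> and \<open>c = \<i>\<close> yields \<^const>\<open>wirt_bar\<close>.\<close>

definition wirt_gen :: "complex \<Rightarrow> 'n::finite \<Rightarrow> 'n cfun \<Rightarrow> 'n cfun" where
  "wirt_gen c k f = (\<lambda>x. (dir_deriv (axis k 1) f x + c * dir_deriv (axis k \<i>) f x) / 2)"

definition D_gen :: "complex \<Rightarrow> nat ^ 'n \<Rightarrow> 'n::finite cfun \<Rightarrow> 'n cfun" where
  "D_gen c R f = foldr (\<lambda>k. wirt_gen c k ^^ (R $ k)) coords f"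

lemma wirt_eq: "wirt = wirt_gen (- \<i>)"
  and wirt_bar_eq: "wirt_bar = wirt_gen \<i>"
  by (simp_all add: wirt_gen_def wirt_def wirt_bar_def fun_eq_iff)

lemma D_z_eq: "D_z = D_gen (- \<i>)"
  and D_zbar_eq: "D_zbar = D_gen \<i>"
  by (simp_all add: D_gen_def D_z_def D_zbar_def wirt_eq wirt_bar_eq fun_eq_iff)

lemma wirt_gen_alt: "wirt_gen c k f = (\<lambda>x. (1/2) * dir_deriv (axis k 1) f x + (c/2) * dir_deriv (axis k \<i>) f x)"
  by (simp add: wirt_gen_def fun_eq_iff add_divide_distrib)

lemma smooth_wirt_gen: "smooth f \<Longrightarrow> smooth (wirt_gen c k f)"
  unfolding wirt_gen_alt by (intro smooth_add smooth_cmult smooth_dir_deriv)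

lemma flat_wirt_gen: "flat p f \<Longrightarrow> flat p (wirt_gen c k f)"
  unfolding wirt_gen_alt by (intro flat_add flat_cmult flat_dir_deriv)

lemma dir_deriv_lincomb:
  "smooth f \<Longrightarrow> smooth g \<Longrightarrow>
    dir_deriv v (\<lambda>x. a * f x + b * g x) = (\<lambda>x. a * dir_deriv v f x + b * dir_deriv v g x)"
  by (simp add: fun_eq_iff dir_deriv_add dir_deriv_cmult smooth_differentiable smooth_cmult)

lemma wirt_gen_lincomb:
  "smooth f \<Longrightarrow> smooth g \<Longrightarrow>
    wirt_gen c k (\<lambda>x. a * f x + b * g x) = (\<lambda>x. a * wirt_gen c k f x + b * wirt_gen c k g x)"
  by (simp add: wirt_gen_alt dir_deriv_lincomb fun_eq_iff algebra_simps)

lemma wirt_gen_commute: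
  "smooth f \<Longrightarrow> wirt_gen c k (wirt_gen d j f) = wirt_gen d j (wirt_gen c k f)"
  unfolding wirt_gen_alt
  by (simp only: dir_deriv_lincomb smooth_dir_deriv dir_deriv_commute[of f "axis j _" "axis k _"])
     (simp add: fun_eq_iff algebra_simps)

text \<open>\<open>D_gen\<close> over an arbitrary list of coordinates, since the fixed list
  \<open>coords\<close> does not admit an induction.\<close>

definition wirt_list :: "complex \<Rightarrow> nat ^ 'n \<Rightarrow> 'n::finite list \<Rightarrow> 'n cfun \<Rightarrow> 'n cfun" where
  "wirt_list c R ks f = foldr (\<lambda>k. wirt_gen c k ^^ (R $ k)) ks f"

lemma wirt_list_simps [simp]:
  "wirt_list c R [] f = f"
  "wirt_list c R (k # ks) f = (wirt_gen c k ^^ (R $ k)) (wirt_list c R ks f)"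
  by (simp_all add: wirt_list_def)

lemma D_gen_wirt_list: "D_gen c R = wirt_list c R coords"
  by (simp add: fun_eq_iff D_gen_def wirt_list_def)

lemma smooth_wirt_gen_pow: "smooth f \<Longrightarrow> smooth ((wirt_gen c k ^^ m) f)"
  by (induction m) (auto intro: smooth_wirt_gen)

lemma smooth_wirt_list: "smooth f \<Longrightarrow> smooth (wirt_list c R ks f)"
  by (induction ks) (auto intro: smooth_wirt_gen_pow)

lemma wirt_gen_pow_commute:
  "smooth f \<Longrightarrow> wirt_gen d j ((wirt_gen c k ^^ m) f) = (wirt_gen c k ^^ m) (wirt_gen d j f)"
  by (induction m) (simp_all add: wirt_gen_commute smooth_wirt_gen_pow)

lemma wirt_gen_list_commute:
  "smooth f \<Longrightarrow> wirt_gen d j (wirt_list c R ks f) = wirt_list c R ks (wirt_gen d j f)"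
  by (induction ks) (simp_all add: wirt_gen_pow_commute smooth_wirt_list)

lemma wirt_list_cong: "(\<And>k. k \<in> set ks \<Longrightarrow> R $ k = R' $ k) \<Longrightarrow> wirt_list c R ks f = wirt_list c R' ks f"
  by (induction ks) auto

text \<open>The extra derivative commutes past the others to the place of \<open>j\<close>;
  distinctness makes this place unique, so exactly one exponent grows.\<close>

lemma wirt_list_wirt_gen:
  assumes "smooth f" "distinct ks" "j \<in> set ks"
  shows "wirt_list c R ks (wirt_gen c j f) = wirt_list c (R + axis j 1) ks f"
  using assms(2,3)
proof (induction ks)
  case (Cons k ks)
  show ?case
  proof (cases "k = j")
    case True
    have "wirt_list c (R + axis j 1) ks f = wirt_list c R ks f"
      using Cons.prems True by (intro wirt_list_cong) (auto simp: axis_def)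
    then show ?thesis
      using True assms(1) by (simp add: wirt_gen_list_commute[symmetric] funpow_swap1)
  next
    case False
    then show ?thesis using Cons by (simp add: axis_def)
  qed
qed simp

lemma coords: "distinct (coords :: 'n::finite list)" "set (coords :: 'n list) = UNIV"
proof -
  obtain ks :: "'n list" where "distinct ks \<and> set ks = UNIV"
    using finite_distinct_list[of "UNIV :: 'n set"] by auto
  then have "distinct (coords :: 'n list) \<and> set (coords :: 'n list) = UNIV"
    unfolding coords_def by (rule someI)
  then show "distinct (coords :: 'n list)" "set (coords :: 'n list) = UNIV" by auto
qed

lemma D_gen_wirt_gen: "smooth f \<Longrightarrow> D_gen c R (wirt_gen c j f) = D_gen c (R + axis j 1) f"
  by (simp add: D_gen_wirt_list wirt_list_wirt_gen coords)

lemma D_gen_commute: "smooth f \<Longrightarrow> wirt_gen d j (D_gen c R f) = D_gen c R (wirt_gen d j f)"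
  by (simp add: D_gen_wirt_list wirt_gen_list_commute)

lemma smooth_D_gen: "smooth f \<Longrightarrow> smooth (D_gen c R f)"
  by (simp add: D_gen_wirt_list smooth_wirt_list)

lemma D_gen_zero [simp]: "D_gen c 0 f = f"
proof -
  have "wirt_list c 0 ks f = f" for ks by (induction ks) auto
  then show ?thesis by (simp add: D_gen_wirt_list)
qed

lemma D_gen_lincomb:
  assumes "smooth f" "smooth g"
  shows "D_gen c R (\<lambda>x. a * f x + b * g x) = (\<lambda>x. a * D_gen c R f x + b * D_gen c R g x)"
proof -
  have pow: "(wirt_gen c k ^^ m) (\<lambda>x. a * f x + b * g x)
      = (\<lambda>x. a * (wirt_gen c k ^^ m) f x + b * (wirt_gen c k ^^ m) g x)"
    if "smooth f" "smooth g" for f g :: "'a cfun" and k m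
    by (induction m) (simp_all add: wirt_gen_lincomb smooth_wirt_gen_pow that)
  have "wirt_list c R ks (\<lambda>x. a * f x + b * g x)
      = (\<lambda>x. a * wirt_list c R ks f x + b * wirt_list c R ks g x)" for ks
    by (induction ks) (simp_all add: pow smooth_wirt_list assms)
  then show ?thesis by (simp add: D_gen_wirt_list)
qed

lemma flat_D_gen: "flat p f \<Longrightarrow> flat p (D_gen c R f)"
proof -
  assume "flat p f"
  then have "flat p ((wirt_gen c k ^^ m) f)" if "flat p f" for f k m
    using that by (induction m) (auto intro: flat_wirt_gen)
  then have "flat p (wirt_list c R ks f)" for ks
    using \<open>flat p f\<close> by (induction ks) auto
  then show ?thesis by (simp add: D_gen_wirt_list)
qed

text \<open>The real-linear differential splits into its complex-linear and antilinear parts, so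
  Wirtinger derivatives control the derivatives in all real directions.\<close>

lemma dir_deriv_wirt_gen:
  assumes "f differentiable (at x)"
  shows "dir_deriv v f x = (\<Sum>k\<in>UNIV. v $ k * wirt_gen (- \<i>) k f x + cnj (v $ k) * wirt_gen \<i> k f x)"
proof -
  have lin: "linear (\<lambda>v. dir_deriv v f x)"
    using has_derivative_dir_deriv[OF assms]
    by (rule has_derivative_linear)
  have v: "v = (\<Sum>k\<in>UNIV. Re (v $ k) *\<^sub>R axis k 1 + Im (v $ k) *\<^sub>R axis k \<i>)"
    by (simp add: vec_eq_iff axis_def sum.distrib complex_eq_iff if_distrib[of "(*\<^sub>R) _"] cong: if_cong)
  have "dir_deriv v f x = (\<Sum>k\<in>UNIV. Re (v $ k) *\<^sub>R dir_deriv (axis k 1) f x + Im (v $ k) *\<^sub>R dir_deriv (axis k \<i>) f x)"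
    using assms
    by (subst v, subst linear_sum[OF lin])
       (simp add: dir_deriv_add_direction dir_deriv_scaleR_direction smooth_differentiable)
  also have "\<dots> = (\<Sum>k\<in>UNIV. v $ k * wirt_gen (- \<i>) k f x + cnj (v $ k) * wirt_gen \<i> k f x)"
    by (intro sum.cong refl) (simp add: wirt_gen_def complex_eq_iff field_simps)
  finally show ?thesis .
qed

text \<open>The smooth functions all of whose mixed Wirtinger derivatives vanish at \<open>p\<close>
  form a complex vector space stable under both kinds of Wirtinger derivative, hence under all
  directional derivatives.\<close>

lemma flatI_wirtinger:
  assumes "smooth f" "\<And>R S. D_z R (D_zbar S f) p = 0"
  shows "flat p f"
proof (rule flat_coinduct)
  let ?F = "{f. smooth f \<and> (\<forall>R S. D_z R (D_zbar S f) p = 0)}"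
  show "f \<in> ?F" using assms by blast
  show "u p = 0" if "u \<in> ?F" for u
    using that by (auto simp: D_z_eq D_zbar_eq dest!: spec[of _ 0])
  have lin: "(\<lambda>x. a * u x + b * g x) \<in> ?F" if "u \<in> ?F" "g \<in> ?F" for a b u g
    using that by (auto simp: D_z_eq D_zbar_eq D_gen_lincomb smooth_D_gen intro!: smooth_add smooth_cmult)
  have zero: "(\<lambda>x. 0) \<in> ?F" using lin[OF \<open>f \<in> ?F\<close> \<open>f \<in> ?F\<close>, of 0 0] by simp
  have sum: "(\<lambda>x. \<Sum>i\<in>I. g i x) \<in> ?F" if "\<And>i. i \<in> I \<Longrightarrow> g i \<in> ?F" for I :: "'a set" and g
    using that
  proof (induction I rule: infinite_finite_induct)
    case (insert i I)
    then show ?case using lin[of "g i" "\<lambda>x. \<Sum>i\<in>I. g i x" 1 1] by auto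
  qed (use zero in auto)
  show "dir_deriv v u \<in> ?F" if u: "u \<in> ?F" for u v
  proof -
    have "D_gen (- \<i>) R (D_gen \<i> S (wirt_gen (- \<i>) k u)) = D_gen (- \<i>) (R + axis k 1) (D_gen \<i> S u)" for k R S
      using u by (simp only: mem_Collect_eq D_gen_commute[symmetric]) (simp add: D_gen_wirt_gen smooth_D_gen)
    then have "wirt_gen (- \<i>) k u \<in> ?F" for k
      using u by (simp add: D_z_eq D_zbar_eq smooth_wirt_gen)
    moreover have "wirt_gen \<i> k u \<in> ?F" for k
      using u by (auto simp: D_z_eq D_zbar_eq D_gen_wirt_gen smooth_wirt_gen)
    moreover have eq: "dir_deriv v u = (\<lambda>x. \<Sum>k\<in>UNIV. v $ k * wirt_gen (- \<i>) k u x + cnj (v $ k) * wirt_gen \<i> k u x)"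
      using u by (simp add: dir_deriv_wirt_gen smooth_differentiable fun_eq_iff)
    ultimately show ?thesis
      using sum[of UNIV "\<lambda>k x. v $ k * wirt_gen (- \<i>) k u x + cnj (v $ k) * wirt_gen \<i> k u x", OF lin] eq
      by simp
  qed
qed auto

lemma flat_wirtinger: "flat p f \<Longrightarrow> D_z R (D_zbar S f) p = 0"
  by (simp add: D_z_eq D_zbar_eq flat_at flat_D_gen)

section \<open>Entire expansions\<close>

text \<open>Such bounds multiply up to a factor \<open>6\<close>, so the monomials of degree \<open>d\<close> satisfy them with a
  constant of the form \<open>K * B ^ d\<close>, and an entire power series can be differentiated term by term.\<close>

definition quad_approx :: "complex ^ 'n \<Rightarrow> 'n::finite cfun \<Rightarrow> real \<Rightarrow> bool" where
  "quad_approx x F A \<longleftrightarrow> F differentiable (at x) \<and> norm (F x) \<le> A \<and>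
     (\<forall>h. norm (dir_deriv h F x) \<le> A * norm h) \<and>
     (\<forall>h. norm h \<le> 1 \<longrightarrow> norm (F (x + h) - F x - dir_deriv h F x) \<le> A * (norm h)\<^sup>2)"

lemma quad_approx_nonneg: "quad_approx x F A \<Longrightarrow> A \<ge> 0"
  unfolding quad_approx_def by (meson norm_ge_zero order_trans)

lemma quad_approx_const: "quad_approx x (\<lambda>z. c) (norm c)"
proof -
  have "dir_deriv h (\<lambda>z. c) x = 0" for h
    by (rule dir_deriv_eqI) (rule has_derivative_const)
  then show ?thesis by (simp add: quad_approx_def)
qed

text \<open>An affine function has no remainder; the summand 1 accounts for the derivative, a
  coordinate projection of norm at most 1.\<close>

lemma quad_approx_coord: "quad_approx x (\<lambda>z. z $ k - p $ k) (norm (x - p) + 1)"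
proof -
  have D: "((\<lambda>z. z $ k - p $ k) has_derivative (\<lambda>h. h $ k)) (at x)"
    by (auto intro!: derivative_eq_intros bounded_linear.has_derivative[OF bounded_linear_vec_nth])
  have d: "dir_deriv h (\<lambda>z. z $ k - p $ k) x = h $ k" for h
    by (rule dir_deriv_eqI[OF D])
  have "norm (h $ k) \<le> (norm (x - p) + 1) * norm h" for h :: "complex ^ 'a"
    using Finite_Cartesian_Product.norm_nth_le[of h k]
      mult_right_mono[of 1 "norm (x - p) + 1" "norm h"] by simp
  moreover have "norm (x $ k - p $ k) \<le> norm (x - p) + 1"
    using Finite_Cartesian_Product.norm_nth_le[of "x - p" k] by simp
  ultimately show ?thesis
    using D by (auto simp: quad_approx_def d differentiable_def)
qed

lemma quad_approx_cnj:
  assumes "quad_approx x F A"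
  shows "quad_approx x (\<lambda>z. cnj (F z)) A"
proof -
  have "norm (cnj u - cnj v - cnj w) = norm (u - v - w)" for u v w
    by (metis complex_cnj_diff complex_mod_cnj)
  then show ?thesis
    using assms by (auto simp: quad_approx_def dir_deriv_cnj differentiable_cnj)
qed

lemma quad_approx_mult:
  assumes "quad_approx x F A" "quad_approx x G B"
  shows "quad_approx x (\<lambda>z. F z * G z) (6 * A * B)"
proof -
  note A = assms(1)[unfolded quad_approx_def] and B = assms(2)[unfolded quad_approx_def]
  have nn: "A \<ge> 0" "B \<ge> 0" using assms quad_approx_nonneg by blast+
  then have AB: "A * B \<ge> 0" by simp
  have d: "dir_deriv h (\<lambda>z. F z * G z) x = F x * dir_deriv h G x + dir_deriv h F x * G x" for h
    using A B by (simp add: dir_deriv_mult)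
  have mul: "norm (u * v) \<le> A * B * (s * t)" if "norm u \<le> A * s" "norm v \<le> B * t" "s \<ge> 0" "t \<ge> 0"
    for u v :: complex and s t
  proof -
    have "norm u * norm v \<le> (A * s) * (B * t)"
      using that nn by (intro mult_mono) auto
    then show ?thesis by (simp add: norm_mult mult_ac)
  qed
  show ?thesis unfolding quad_approx_def
  proof (intro conjI allI impI)
    show "(\<lambda>z. F z * G z) differentiable (at x)" using A B by (auto intro: differentiable_mult)
    show "norm (F x * G x) \<le> 6 * A * B"
      using mul[of "F x" 1 "G x" 1] A B AB by simp
    show "norm (dir_deriv h (\<lambda>z. F z * G z) x) \<le> 6 * A * B * norm h" for h
    proof -
      have "norm (F x * dir_deriv h G x + dir_deriv h F x * G x) \<le> A * B * (1 * norm h) + A * B * (norm h * 1)"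
        using A B by (intro norm_triangle_le add_mono mul) auto
      also have "\<dots> = 2 * (A * B * norm h)" by simp
      also have "\<dots> \<le> 6 * (A * B * norm h)" using AB by (intro mult_right_mono) auto
      finally show ?thesis by (simp add: d mult_ac)
    qed
    fix h :: "complex ^ 'a" assume h: "norm h \<le> 1"
    define r s where "r = F (x + h) - F x - dir_deriv h F x" and "s = G (x + h) - G x - dir_deriv h G x"
    define F' G' where "F' = dir_deriv h F x" and "G' = dir_deriv h G x"
    define t where "t = norm h"
    have t: "0 \<le> t" "t \<le> 1" using h by (auto simp: t_def)
    have b: "norm (F x) \<le> A * 1" "norm (G x) \<le> B * 1" "norm F' \<le> A * t" "norm G' \<le> B * t"
      "norm r \<le> A * t\<^sup>2" "norm s \<le> B * t\<^sup>2"
      using A B h by (auto simp: F'_def G'_def r_def s_def t_def)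
    have t3: "t * t\<^sup>2 \<le> t\<^sup>2" "t\<^sup>2 * t \<le> t\<^sup>2" "t\<^sup>2 * t\<^sup>2 \<le> t\<^sup>2"
      using t by (auto simp: mult_left_le mult_left_le_one_le power_le_one simp del: power_add_numeral2 power_add_numeral)
    have "F (x + h) = F x + F' + r" "G (x + h) = G x + G' + s"
      by (simp_all add: F'_def G'_def r_def s_def)
    \<comment> \<open>Six products of values, linear parts and remainders are left, each at least of
      second order in \<open>t \<le> 1\<close>: this is the origin of the factor 6.\<close>
    then have "F (x + h) * G (x + h) - F x * G x - (F x * G' + F' * G x)
        = F' * G' + F x * s + r * G x + F' * s + r * G' + r * s"
      by (simp add: algebra_simps)
    also have "norm \<dots> \<le> A * B * (t * t) + A * B * (1 * t\<^sup>2) + A * B * (t\<^sup>2 * 1)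
        + A * B * (t * t\<^sup>2) + A * B * (t\<^sup>2 * t) + A * B * (t\<^sup>2 * t\<^sup>2)"
      using b t by (intro norm_triangle_le add_mono mul) auto
    also have "\<dots> \<le> A * B * t\<^sup>2 + A * B * t\<^sup>2 + A * B * t\<^sup>2 + A * B * t\<^sup>2 + A * B * t\<^sup>2 + A * B * t\<^sup>2"
      using AB t3 by (intro add_mono mult_left_mono) (auto simp: power2_eq_square)
    finally show "norm (F (x + h) * G (x + h) - F x * G x - dir_deriv h (\<lambda>z. F z * G z) x) \<le> 6 * A * B * (norm h)\<^sup>2"
      by (simp add: d F'_def G'_def t_def)
  qed
qed

lemma quad_approx_power:
  assumes "quad_approx x F A"
  shows "quad_approx x (\<lambda>z. F z ^ r) ((6 * A) ^ r)"
proof (induction r)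
  case 0
  show ?case using quad_approx_const[of x 1] by simp
next
  case (Suc r)
  show ?case using quad_approx_mult[OF assms Suc] by simp
qed

lemma quad_approx_prod:
  assumes "finite K" "\<And>k. k \<in> K \<Longrightarrow> quad_approx x (F k) (B k)"
  shows "quad_approx x (\<lambda>z. \<Prod>k\<in>K. F k z) (\<Prod>k\<in>K. 6 * B k)"
  using assms
proof (induction K)
  case empty
  show ?case using quad_approx_const[of x 1] by simp
next
  case (insert k K)
  then show ?case using quad_approx_mult[of x "F k" "B k" "\<lambda>z. \<Prod>k\<in>K. F k z"] by simp
qed

section \<open>Monomials and termwise differentiation\<close>

definition mono_at :: "complex ^ 'n \<Rightarrow> nat ^ 'n \<Rightarrow> 'n::finite cfun" where
  "mono_at p R z = (\<Prod>k\<in>UNIV. (z $ k - p $ k) ^ (R $ k))"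

lemma quad_approx_mono_at:
  fixes p x :: "complex ^ 'n"
  shows "quad_approx x (mono_at p R) (6 ^ CARD('n) * (6 * (norm (x - p) + 1)) ^ mi_abs R)"
proof -
  have "quad_approx x (\<lambda>z. \<Prod>k\<in>UNIV. (z $ k - p $ k) ^ (R $ k))
      (\<Prod>k\<in>UNIV. 6 * (6 * (norm (x - p) + 1)) ^ (R $ k))"
    by (intro quad_approx_prod quad_approx_power quad_approx_coord) simp
  then show ?thesis
    by (simp add: mono_at_def[abs_def] prod.distrib mi_abs_def power_sum)
qed

text \<open>Linear parts and remainders are summed separately. The bounds \<open>A i\<close> add up
  to \<open>M\<close>, so the sum of the linear parts is bounded linear and differs from the
  increment of \<open>f\<close> by at most \<open>M * norm h ^ 2\<close>.\<close>

lemma has_derivative_infsum: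
  fixes f :: "'n::finite cfun"
  assumes f: "\<And>z. ((\<lambda>i. F i z) has_sum f z) UNIV"
    and F: "\<And>i. quad_approx x (F i) (A i)" and A: "A summable_on UNIV"
  shows "f differentiable (at x)" "((\<lambda>i. dir_deriv v (F i) x) has_sum dir_deriv v f x) UNIV"
proof -
  define M where "M = infsum A UNIV"
  have M: "(A has_sum M) UNIV" using A by (simp add: M_def)
  have Mh: "((\<lambda>i. A i * c) has_sum M * c) UNIV" for c
    by (rule has_sum_cmult_left[OF M])
  have "M \<ge> 0" unfolding M_def by (intro infsum_nonneg) (use F quad_approx_nonneg in blast)
  note F' = F[unfolded quad_approx_def]
  have bd: "norm (dir_deriv h (F i) x) \<le> A i * norm h" for i h using F' by blast
  define L where "L h = (\<Sum>\<^sub>\<infinity>i. dir_deriv h (F i) x)" for h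
  have L: "((\<lambda>i. dir_deriv h (F i) x) has_sum L h) UNIV" for h
  proof -
    have "(\<lambda>i. dir_deriv h (F i) x) summable_on UNIV"
      unfolding summable_on_iff_abs_summable_on_complex
      using Mh[of "norm h"] bd by (intro Infinite_Sum.abs_summable_on_comparison_test') (auto simp: summable_on_def)
    then show ?thesis by (simp add: L_def)
  qed
  have lin: "bounded_linear L"
  proof (rule bounded_linear_intro)
    have "dir_deriv (h + k) (F i) x = dir_deriv h (F i) x + dir_deriv k (F i) x" for h k i
      using F' by (simp add: dir_deriv_add_direction)
    then show "L (h + k) = L h + L k" for h k
      using has_sum_add[OF L[of h] L[of k]] by (simp add: infsumI L_def)
    have "dir_deriv (c *\<^sub>R h) (F i) x = of_real c * dir_deriv h (F i) x" for h i and c :: real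
      using F' by (simp add: dir_deriv_scaleR_direction scaleR_conv_of_real[where 'a = complex])
    then show "L (c *\<^sub>R h) = c *\<^sub>R L h" for h and c :: real
      using has_sum_cmult_right[OF L[of h], of "of_real c"] by (simp add: infsumI L_def scaleR_conv_of_real[where 'a = complex])
    show "norm (L h) \<le> norm h * M" for h
      using norm_infsum_le[OF L Mh bd, of h] by (simp add: mult.commute)
  qed
  have rem: "norm (f (x + h) - f x - L h) \<le> M * (norm h)\<^sup>2" if "norm h \<le> 1" for h
  proof -
    have "((\<lambda>i. F i (x + h) + - F i x + - dir_deriv h (F i) x) has_sum (f (x + h) + - f x + - L h)) UNIV"
      by (intro has_sum_add f L has_sum_uminusI)
    then have "norm (f (x + h) + - f x + - L h) \<le> M * (norm h)\<^sup>2"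
      by (rule norm_infsum_le[OF _ Mh]) (use F' that in auto)
    then show ?thesis by simp
  qed
  have der: "(f has_derivative L) (at x)"
    unfolding has_derivative_at_alt
  proof (intro conjI lin allI impI)
    fix e :: real assume e: "0 < e"
    \<comment> \<open>The bound 1 keeps the quadratic estimate valid, the other one gives
      \<open>M * d \<le> e\<close>; \<open>M + 1\<close> avoids a division by zero.\<close>
    define d where "d = min 1 (e / (M + 1))"
    have d: "d > 0" "d \<le> 1" "M * d \<le> e"
    proof -
      show "d > 0" "d \<le> 1" using e \<open>M \<ge> 0\<close> by (auto simp: d_def)
      have "M * d \<le> M * (e / (M + 1))" using \<open>M \<ge> 0\<close> by (intro mult_left_mono) (auto simp: d_def)
      also have "\<dots> \<le> e" using \<open>M \<ge> 0\<close> e by (simp add: field_simps)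
      finally show "M * d \<le> e" .
    qed
    show "\<exists>d>0. \<forall>y. norm (y - x) < d \<longrightarrow> norm (f y - f x - L (y - x)) \<le> e * norm (y - x)"
    proof (intro exI[of _ d] conjI allI impI d)
      fix y assume y: "norm (y - x) < d"
      have "norm (f y - f x - L (y - x)) \<le> M * (norm (y - x))\<^sup>2"
        using rem[of "y - x"] y d by simp
      also have "\<dots> = M * norm (y - x) * norm (y - x)" by (simp add: power2_eq_square)
      also have "\<dots> \<le> e * norm (y - x)"
      proof (rule mult_right_mono)
        have "M * norm (y - x) \<le> M * d" using y \<open>M \<ge> 0\<close> by (intro mult_left_mono) auto
        then show "M * norm (y - x) \<le> e" using d by simp
      qed simp
      finally show "norm (f y - f x - L (y - x)) \<le> e * norm (y - x)" .
    qed
  qed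
  then show "f differentiable (at x)" by (auto simp: differentiable_def)
  show "((\<lambda>i. dir_deriv v (F i) x) has_sum dir_deriv v f x) UNIV"
    using L[of v] dir_deriv_eqI[OF der] by simp
qed

section \<open>Taylor expansions in z and its conjugate\<close>

definition taylor_term :: "complex ^ 'n \<Rightarrow> (nat ^ 'n \<Rightarrow> nat ^ 'n \<Rightarrow> complex) \<Rightarrow>
    (nat ^ 'n) \<times> (nat ^ 'n) \<Rightarrow> 'n::finite cfun" where
  "taylor_term p a i z = a (fst i) (snd i) * of_real (mwt 1 (fst i) * mwt 1 (snd i)) *
     (mono_at p (fst i) z * cnj (mono_at p (snd i) z))"

text \<open>The coefficients are normalised as derivatives, so that differentiating merely shifts an
  index of \<open>a\<close>.\<close>

definition expands :: "complex ^ 'n \<Rightarrow> (nat ^ 'n \<Rightarrow> nat ^ 'n \<Rightarrow> complex) \<Rightarrow> 'n::finite cfun \<Rightarrow> bool" where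
  "expands p a f \<longleftrightarrow> (\<forall>z. ((\<lambda>i. taylor_term p a i z) has_sum f z) UNIV)"

lemma mono_at_const: "mono_at p R (\<chi> k. p $ k + c) = c ^ mi_abs R"
  by (simp add: mono_at_def mi_abs_def power_sum)

lemma norm_mono_at_le:
  assumes "\<And>k. norm (z $ k - p $ k) \<le> w"
  shows "norm (mono_at p R z) \<le> w ^ mi_abs R"
proof -
  have "norm (mono_at p R z) \<le> (\<Prod>k\<in>UNIV. w ^ (R $ k))"
    unfolding mono_at_def prod_norm[symmetric]
    using assms by (intro prod_mono) (auto simp: norm_power intro: power_mono)
  then show ?thesis by (simp add: mi_abs_def power_sum)
qed

text \<open>At the point whose coordinates all exceed those of \<open>p\<close> by \<open>c\<close>,
  every monomial equals \<open>c\<close> to its degree, and unordered convergence of complex series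
  is absolute.\<close>

lemma expands_summable:
  assumes "expands p a f" "c \<ge> 0"
  shows "(\<lambda>i. norm (a (fst i) (snd i)) * (mwt 1 (fst i) * mwt 1 (snd i)) * c ^ (mi_abs (fst i) + mi_abs (snd i)))
    summable_on UNIV"
proof -
  have "(\<lambda>i. taylor_term p a i (\<chi> k. p $ k + of_real c)) summable_on UNIV"
    using assms(1) by (auto simp: expands_def summable_on_def)
  then have "(\<lambda>i. norm (taylor_term p a i (\<chi> k. p $ k + of_real c))) summable_on UNIV"
    by (simp add: summable_on_iff_abs_summable_on_complex)
  then show ?thesis
    using assms(2) by (simp add: taylor_term_def mono_at_const norm_mult norm_power power_add)
qed

text \<open>Up to \<open>K\<close>, which is the same for all terms, the bound is the summand of
  \<open>expands_summable\<close> with \<open>c = 6 * (norm (x - p) + 1)\<close>, hence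
  summable.\<close>

lemma quad_approx_taylor_term:
  fixes p x :: "complex ^ 'n"
  shows "\<exists>K. \<forall>i. quad_approx x (taylor_term p a i) (K * (norm (a (fst i) (snd i)) * (mwt 1 (fst i) * mwt 1 (snd i)) *
      (6 * (norm (x - p) + 1)) ^ (mi_abs (fst i) + mi_abs (snd i))))"
proof (intro exI allI)
  fix i
  let ?c = "a (fst i) (snd i) * of_real (mwt 1 (fst i) * mwt 1 (snd i))"
  have "quad_approx x (\<lambda>z. ?c * (mono_at p (fst i) z * cnj (mono_at p (snd i) z)))
    (6 * norm ?c * (6 * (6 ^ CARD('n) * (6 * (norm (x - p) + 1)) ^ mi_abs (fst i)) *
      (6 ^ CARD('n) * (6 * (norm (x - p) + 1)) ^ mi_abs (snd i))))"
    by (intro quad_approx_mult quad_approx_const quad_approx_cnj quad_approx_mono_at)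
  then show "quad_approx x (taylor_term p a i) ((36 * 6 ^ CARD('n) * 6 ^ CARD('n)) * (norm (a (fst i) (snd i)) *
      (mwt 1 (fst i) * mwt 1 (snd i)) * (6 * (norm (x - p) + 1)) ^ (mi_abs (fst i) + mi_abs (snd i))))"
    by (simp add: taylor_term_def[abs_def] norm_mult power_add mult_ac)
qed

lemma expands_deriv:
  assumes "expands p a f"
  shows "f differentiable (at x)" "((\<lambda>i. dir_deriv v (taylor_term p a i) x) has_sum dir_deriv v f x) UNIV"
proof -
  obtain K where K: "\<And>i. quad_approx x (taylor_term p a i) (K * (norm (a (fst i) (snd i)) * (mwt 1 (fst i) * mwt 1 (snd i)) *
      (6 * (norm (x - p) + 1)) ^ (mi_abs (fst i) + mi_abs (snd i))))"
    using quad_approx_taylor_term by metis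
  have "(\<lambda>i. K * (norm (a (fst i) (snd i)) * (mwt 1 (fst i) * mwt 1 (snd i)) *
      (6 * (norm (x - p) + 1)) ^ (mi_abs (fst i) + mi_abs (snd i)))) summable_on UNIV"
    by (intro summable_on_cmult_right expands_summable[OF assms]) simp
  from has_derivative_infsum[OF _ K this, of f] assms
  show "f differentiable (at x)" "((\<lambda>i. dir_deriv v (taylor_term p a i) x) has_sum dir_deriv v f x) UNIV"
    by (auto simp: expands_def)
qed

lemma mono_at_differentiable: "mono_at p R differentiable (at x)"
  using quad_approx_mono_at[of x p R] by (simp add: quad_approx_def)

text \<open>The truncated subtraction is harmless: if \<open>R $ k = 0\<close>, the factor in front
  vanishes.\<close>

lemma dir_deriv_mono_at:
  "dir_deriv (axis k t) (mono_at p R) x = t * (of_nat (R $ k) * mono_at p (R - axis k 1) x)"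
proof -
  have "((\<lambda>z. \<Prod>j\<in>UNIV. (z $ j - p $ j) ^ (R $ j)) has_derivative
      (\<lambda>h. \<Sum>j\<in>UNIV. (of_nat (R $ j) * (h $ j) * (x $ j - p $ j) ^ (R $ j - 1)) *
        (\<Prod>l\<in>UNIV - {j}. (x $ l - p $ l) ^ (R $ l)))) (at x)"
    by (rule has_derivative_prod)
       (auto intro!: derivative_eq_intros bounded_linear.has_derivative[OF bounded_linear_vec_nth])
  then have "dir_deriv (axis k t) (mono_at p R) x
      = (\<Sum>j\<in>UNIV. (of_nat (R $ j) * (axis k t $ j) * (x $ j - p $ j) ^ (R $ j - 1)) *
        (\<Prod>l\<in>UNIV - {j}. (x $ l - p $ l) ^ (R $ l)))"
    unfolding mono_at_def[abs_def] by (rule dir_deriv_eqI)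
  also have "\<dots> = (\<Sum>j\<in>UNIV. if j = k then of_nat (R $ k) * t * (x $ k - p $ k) ^ (R $ k - 1) *
        (\<Prod>l\<in>UNIV - {k}. (x $ l - p $ l) ^ (R $ l)) else 0)"
    by (intro sum.cong) (auto simp: axis_def)
  also have "\<dots> = of_nat (R $ k) * t * ((x $ k - p $ k) ^ (R $ k - 1) *
        (\<Prod>l\<in>UNIV - {k}. (x $ l - p $ l) ^ (R $ l)))"
    by simp
  also have "(x $ k - p $ k) ^ (R $ k - 1) * (\<Prod>l\<in>UNIV - {k}. (x $ l - p $ l) ^ (R $ l))
      = mono_at p (R - axis k 1) x"
    unfolding mono_at_def by (subst prod.remove[of _ k]) (auto simp: axis_def intro!: prod.cong)
  finally show ?thesis by simp
qed

lemma wirt_gen_taylor_term: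
  "wirt_gen (- \<i>) k (taylor_term p a i) x = a (fst i) (snd i) * of_real (mwt 1 (fst i) * mwt 1 (snd i)) *
     (of_nat (fst i $ k) * mono_at p (fst i - axis k 1) x * cnj (mono_at p (snd i) x))"
proof -
  have "dir_deriv (axis k t) (taylor_term p a i) x = a (fst i) (snd i) * of_real (mwt 1 (fst i) * mwt 1 (snd i)) *
     (mono_at p (fst i) x * cnj (t * (of_nat (snd i $ k) * mono_at p (snd i - axis k 1) x)) +
      t * (of_nat (fst i $ k) * mono_at p (fst i - axis k 1) x) * cnj (mono_at p (snd i) x))" for t
  proof -
    have "(\<lambda>z. cnj (mono_at p (snd i) z)) differentiable (at x)"
      by (intro differentiable_cnj mono_at_differentiable)
    then show ?thesis
      unfolding taylor_term_def[abs_def]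
      by (subst dir_deriv_cmult)
         (auto simp: dir_deriv_mult dir_deriv_cnj mono_at_differentiable dir_deriv_mono_at intro!: differentiable_mult)
  qed
  then show ?thesis
    by (simp add: wirt_gen_def algebra_simps)
qed

lemma mwt_add_axis: "mwt 1 (R + axis k 1) * real (R $ k + 1) = mwt 1 R"
proof -
  have *: "mwt 1 Q = 1 / fact (Q $ k) * (\<Prod>l\<in>UNIV - {k}. 1 / fact (Q $ l))" for Q :: "nat ^ 'a"
    by (simp add: mwt_prod prod.remove[of UNIV k])
  have "(\<Prod>l\<in>UNIV - {k}. 1 / fact ((R + axis k 1) $ l)) = (\<Prod>l\<in>UNIV - {k}. 1 / fact (R $ l) :: real)"
    by (intro prod.cong) (auto simp: axis_def)
  moreover have "1 / fact (Suc n) * real (n + 1) = (1 / fact n :: real)" for n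
    by (simp add: divide_simps)
  ultimately show ?thesis unfolding * by (simp add: axis_def mult.commute mult.left_commute)
qed

text \<open>Termwise differentiation kills the terms with \<open>R $ k = 0\<close>; the others are
  reindexed by \<open>R + axis k 1\<close>, and the exponent that comes down cancels against the
  factorial.\<close>

lemma expands_wirt:
  assumes "expands p a f"
  shows "expands p (\<lambda>R S. a (R + axis k 1) S) (wirt_gen (- \<i>) k f)"
  unfolding expands_def
proof
  fix x
  define T where "T i = a (fst i) (snd i) * of_real (mwt 1 (fst i) * mwt 1 (snd i)) *
     (of_nat (fst i $ k) * mono_at p (fst i - axis k 1) x * cnj (mono_at p (snd i) x))" for i
  let ?h = "\<lambda>i :: (nat ^ 'a) \<times> (nat ^ 'a). (fst i + axis k 1, snd i)"
  have "((\<lambda>i. (1/2) * dir_deriv (axis k 1) (taylor_term p a i) x + (- \<i>/2) * dir_deriv (axis k \<i>) (taylor_term p a i) x)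
     has_sum (1/2) * dir_deriv (axis k 1) f x + (- \<i>/2) * dir_deriv (axis k \<i>) f x) UNIV"
    by (intro has_sum_add has_sum_cmult_right expands_deriv[OF assms])
  then have "(T has_sum wirt_gen (- \<i>) k f x) UNIV"
    unfolding T_def wirt_gen_taylor_term[symmetric] unfolding wirt_gen_alt .
  also have "?this \<longleftrightarrow> (T has_sum wirt_gen (- \<i>) k f x) (range ?h)"
  proof (rule has_sum_cong_neutral)
    fix i assume i: "i \<in> UNIV - range ?h"
    have "fst i $ k = 0"
    proof (rule ccontr)
      assume "fst i $ k \<noteq> 0"
      then have "fst i = (fst i - axis k 1) + axis k 1" by (simp add: vec_eq_iff axis_def)
      then have "i = ?h (fst i - axis k 1, snd i)" by (simp add: prod_eq_iff)
      then show False using i by blast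
    qed
    then show "T i = 0" by (simp add: T_def)
  qed auto
  also have "\<dots> \<longleftrightarrow> ((T \<circ> ?h) has_sum wirt_gen (- \<i>) k f x) UNIV"
    by (rule has_sum_reindex) (auto simp: inj_on_def prod_eq_iff)
  also have "T \<circ> ?h = (\<lambda>i. taylor_term p (\<lambda>R S. a (R + axis k 1) S) i x)"
  proof
    fix i :: "(nat ^ 'a) \<times> (nat ^ 'a)"
    have "of_real (mwt 1 (fst i)) = of_real (mwt 1 (fst i + axis k 1)) * (of_nat (fst i $ k + 1) :: complex)"
      unfolding mwt_add_axis[of "fst i" k, symmetric] by simp
    moreover have "(fst i + axis k 1) $ k = fst i $ k + 1" by (simp add: axis_def)
    ultimately show "(T \<circ> ?h) i = taylor_term p (\<lambda>R S. a (R + axis k 1) S) i x"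
      by (simp add: T_def taylor_term_def)
  qed
  finally show "((\<lambda>i. taylor_term p (\<lambda>R S. a (R + axis k 1) S) i x) has_sum wirt_gen (- \<i>) k f x) UNIV" .
qed

lemma expands_cnj:
  assumes "expands p a f"
  shows "expands p (\<lambda>R S. cnj (a S R)) (\<lambda>z. cnj (f z))"
  unfolding expands_def
proof
  fix z
  have "((\<lambda>i. cnj (taylor_term p a i z)) has_sum cnj (f z)) UNIV"
    using assms by (simp add: expands_def)
  then have "((\<lambda>i. cnj (taylor_term p a (prod.swap i) z)) has_sum cnj (f z)) UNIV"
    using has_sum_reindex_bij_betw[of prod.swap UNIV UNIV "\<lambda>i. cnj (taylor_term p a i z)" "cnj (f z)"]
    by (simp del: has_sum_cnj_iff)
  then show "((\<lambda>i. taylor_term p (\<lambda>R S. cnj (a S R)) i z) has_sum cnj (f z)) UNIV"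
    by (simp add: taylor_term_def mult_ac)
qed

lemma expands_lincomb:
  assumes "expands p a f" "expands p b g"
  shows "expands p (\<lambda>R S. c * a R S + d * b R S) (\<lambda>z. c * f z + d * g z)"
  unfolding expands_def
proof
  fix z
  have "((\<lambda>i. c * taylor_term p a i z + d * taylor_term p b i z) has_sum c * f z + d * g z) UNIV"
    using assms by (intro has_sum_add has_sum_cmult_right) (auto simp: expands_def)
  then show "((\<lambda>i. taylor_term p (\<lambda>R S. c * a R S + d * b R S) i z) has_sum c * f z + d * g z) UNIV"
    by (simp add: taylor_term_def algebra_simps)
qed

lemma wirt_bar_via_cnj:
  assumes "f differentiable (at x)"
  shows "wirt_gen \<i> k f x = cnj (wirt_gen (- \<i>) k (\<lambda>z. cnj (f z)) x)"
  using assms by (simp add: wirt_gen_def dir_deriv_cnj)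

lemma expands_wirt_bar:
  assumes "expands p a f"
  shows "expands p (\<lambda>R S. a R (S + axis k 1)) (wirt_gen \<i> k f)"
proof -
  have "wirt_gen \<i> k f = (\<lambda>x. cnj (wirt_gen (- \<i>) k (\<lambda>z. cnj (f z)) x))"
    using expands_deriv(1)[OF assms] by (auto simp: wirt_bar_via_cnj)
  then show ?thesis
    using expands_cnj[OF expands_wirt[OF expands_cnj[OF assms], of k]] by simp
qed

lemma expands_sum:
  assumes "\<And>i. i \<in> I \<Longrightarrow> \<exists>a. expands p a (f i)"
  shows "\<exists>a. expands p a (\<lambda>z. \<Sum>i\<in>I. f i z)"
  using assms
proof (induction I rule: infinite_finite_induct)
  case (insert i I)
  obtain a where "expands p a (f i)" using insert.prems by auto
  moreover obtain b where "expands p b (\<lambda>z. \<Sum>i\<in>I. f i z)" using insert.IH insert.prems by auto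
  ultimately have "expands p a (f i)" "expands p b (\<lambda>z. \<Sum>i\<in>I. f i z)" .
  from expands_lincomb[OF this, of 1 1] insert.hyps show ?case by auto
qed (auto intro!: exI[of _ "\<lambda>_ _. 0"] simp: expands_def taylor_term_def)

text \<open>The functions expandable at \<open>p\<close> are stable under Wirtinger derivatives and
  finite linear combinations, hence under directional derivatives.\<close>

lemma smooth_expands:
  assumes "expands p a f"
  shows "smooth f"
proof (rule smooth_coinduct)
  show "f \<in> {f. \<exists>a. expands p a f}" using assms by blast
next
  fix u v assume "u \<in> {f. \<exists>a. expands p a f}"
  then obtain a where a: "expands p a u" by blast
  have "dir_deriv v u = (\<lambda>x. \<Sum>k\<in>UNIV. v $ k * wirt_gen (- \<i>) k u x + cnj (v $ k) * wirt_gen \<i> k u x)"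
    using expands_deriv(1)[OF a] by (simp add: dir_deriv_wirt_gen fun_eq_iff)
  moreover have "\<exists>a. expands p a (\<lambda>x. \<Sum>k\<in>UNIV. v $ k * wirt_gen (- \<i>) k u x + cnj (v $ k) * wirt_gen \<i> k u x)"
    by (rule expands_sum) (use expands_lincomb[OF expands_wirt[OF a] expands_wirt_bar[OF a]] in blast)
  ultimately show "dir_deriv v u \<in> {f. \<exists>a. expands p a f}" by simp
qed (auto intro: expands_deriv(1))

lemma expands_wirt_pow:
  assumes "expands p a f"
  shows "expands p (\<lambda>R S. a (R + axis k m) S) ((wirt_gen (- \<i>) k ^^ m) f)"
proof (induction m)
  case 0
  have *: "axis k 0 = (0 :: nat ^ _)" by simp
  show ?case unfolding * using assms by simp
next
  case (Suc m)
  have "R + axis k 1 + axis k m = R + axis k (Suc m)" for R :: "nat ^ 'a"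
    by (simp add: vec_eq_iff axis_def)
  then show ?case using expands_wirt[OF Suc, of k] by simp
qed

text \<open>The vector added to \<open>Q\<close> is the part of \<open>R\<close> already treated,
  namely the exponents of the coordinates in \<open>ks\<close>.\<close>

lemma expands_wirt_list:
  assumes "expands p a f" "distinct ks"
  shows "expands p (\<lambda>Q S. a (Q + (\<chi> k. if k \<in> set ks then R $ k else 0)) S) (wirt_list (- \<i>) R ks f)"
  using assms(2)
proof (induction ks)
  case Nil
  then show ?case using assms(1) by (simp add: zero_vec_def[symmetric])
next
  case (Cons k ks)
  have "Q + axis k (R $ k) + (\<chi> k. if k \<in> set ks then R $ k else 0)
      = Q + (\<chi> j. if j \<in> set (k # ks) then R $ j else 0)" for Q
    using Cons.prems by (auto simp: vec_eq_iff axis_def)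
  then show ?case
    using expands_wirt_pow[OF Cons.IH, of k "R $ k"] Cons.prems by simp
qed

lemma expands_D_gen:
  assumes "expands p a f"
  shows "expands p (\<lambda>Q S. a (Q + R) S) (D_gen (- \<i>) R f)"
  using expands_wirt_list[OF assms coords(1), of R] by (simp add: D_gen_wirt_list coords)

lemma D_gen_bar_via_cnj:
  assumes "smooth f"
  shows "D_gen \<i> S f = (\<lambda>x. cnj (D_gen (- \<i>) S (\<lambda>z. cnj (f z)) x))"
proof -
  have pow: "(wirt_gen \<i> k ^^ m) (\<lambda>x. cnj (f x)) = (\<lambda>x. cnj ((wirt_gen (- \<i>) k ^^ m) f x))"
    if "smooth f" for f :: "'a cfun" and k m
  proof (induction m)
    case (Suc m)
    have "smooth (\<lambda>x. cnj ((wirt_gen (- \<i>) k ^^ m) f x))"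
      by (intro smooth_cnj smooth_wirt_gen_pow that)
    then show ?case by (simp add: Suc fun_eq_iff wirt_bar_via_cnj smooth_differentiable)
  qed simp
  have "wirt_list \<i> S ks f = (\<lambda>x. cnj (wirt_list (- \<i>) S ks (\<lambda>z. cnj (f z)) x))" for ks
    by (induction ks) (simp_all add: pow smooth_wirt_list smooth_cnj assms)
  then show ?thesis by (simp add: D_gen_wirt_list)
qed

lemma expands_D_gen_bar:
  assumes "expands p a f"
  shows "expands p (\<lambda>R Q. a R (Q + S)) (D_gen \<i> S f)"
  using expands_cnj[OF expands_D_gen[OF expands_cnj[OF assms]], of S]
  by (simp add: D_gen_bar_via_cnj[OF smooth_expands[OF assms]])

lemma expands_D: "expands p a f \<Longrightarrow> expands p (\<lambda>K L. a (K + R) (L + S)) (D_z R (D_zbar S f))"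
  unfolding D_z_eq D_zbar_eq using expands_D_gen[OF expands_D_gen_bar, of p a f R S] by simp

text \<open>At the centre all monomials of positive degree vanish.\<close>

lemma expands_at:
  assumes "expands p a f"
  shows "f p = a 0 0"
proof -
  have m: "mono_at p R p = (if R = 0 then 1 else 0)" for R
    by (auto simp: mono_at_def vec_eq_iff power_0_left)
  have "((\<lambda>i. taylor_term p a i p) has_sum a 0 0) UNIV"
    by (rule has_sum_finite_neutralI[where B = "{(0, 0)}"]) (auto simp: taylor_term_def m)
  moreover have "((\<lambda>i. taylor_term p a i p) has_sum f p) UNIV"
    using assms by (simp add: expands_def)
  ultimately show ?thesis using has_sum_unique by blast
qed

lemma expands_coeff: "expands p a f \<Longrightarrow> D_z R (D_zbar S f) p = a R S"
  using expands_at[OF expands_D, of p a f R S] by simp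

section \<open>Real-analytic functions\<close>

type_synonym 'n mi2 = "(nat ^ 'n) \<times> (nat ^ 'n)"

definition deg2 :: "'n::finite mi2 \<Rightarrow> nat" where
  "deg2 i = mi_abs (fst i) + mi_abs (snd i)"

definition rmono :: "complex ^ 'n \<Rightarrow> 'n::finite mi2 \<Rightarrow> 'n cfun" where
  "rmono a i z = of_real ((\<Prod>k\<in>UNIV. Re (z $ k - a $ k) ^ (fst i $ k)) *
                          (\<Prod>k\<in>UNIV. Im (z $ k - a $ k) ^ (snd i $ k)))"

text \<open>A box in the real coordinates: on it a monomial is at most \<open>\<rho>\<close> to its
  degree in absolute value, with equality at the corners.\<close>

definition cube :: "complex ^ 'n \<Rightarrow> real \<Rightarrow> (complex ^ 'n) set" where
  "cube a \<rho> = {z. \<forall>k. \<bar>Re (z $ k - a $ k)\<bar> \<le> \<rho> \<and> \<bar>Im (z $ k - a $ k)\<bar> \<le> \<rho>}"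

text \<open>The number \<open>M\<close> bounds a weighted l1 norm of the coefficients. Such bounds
  multiply under products and add under countable sums, which makes expansions of composed
  expressions manageable.\<close>

definition rseries :: "complex ^ 'n \<Rightarrow> real \<Rightarrow> real \<Rightarrow> 'n::finite cfun \<Rightarrow> bool" where
  "rseries a \<rho> M f \<longleftrightarrow> (\<exists>c. (\<lambda>i. norm (c i) * \<rho> ^ deg2 i) summable_on UNIV \<and>
     (\<Sum>\<^sub>\<infinity>i. norm (c i) * \<rho> ^ deg2 i) \<le> M \<and>
     (\<forall>z\<in>cube a \<rho>. ((\<lambda>i. c i * rmono a i z) has_sum f z) UNIV))"

lemma deg2_add [simp]: "deg2 (i + j) = deg2 i + deg2 j"
  by (simp add: deg2_def)

lemma rmono_add: "rmono a (i + j) z = rmono a i z * rmono a j z"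
  by (simp add: rmono_def power_add prod.distrib mult_ac)

lemma rmono_zero [simp]: "rmono a 0 z = 1" and deg2_zero [simp]: "deg2 0 = 0"
  by (simp_all add: rmono_def deg2_def)

lemma norm_rmono_le:
  assumes "z \<in> cube a \<rho>"
  shows "norm (rmono a i z) \<le> \<rho> ^ deg2 i"
proof -
  have z: "\<bar>Re (z $ k - a $ k)\<bar> \<le> \<rho>" "\<bar>Im (z $ k - a $ k)\<bar> \<le> \<rho>" for k
    using assms by (auto simp: cube_def)
  then have "\<rho> \<ge> 0" by (meson abs_ge_zero order_trans)
  have "norm (rmono a i z) = (\<Prod>k\<in>UNIV. \<bar>Re (z $ k - a $ k)\<bar> ^ (fst i $ k)) *
      (\<Prod>k\<in>UNIV. \<bar>Im (z $ k - a $ k)\<bar> ^ (snd i $ k))"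
    unfolding rmono_def by (simp only: norm_of_real abs_mult abs_prod power_abs)
  also have "\<dots> \<le> (\<Prod>k\<in>UNIV. \<rho> ^ (fst i $ k)) * (\<Prod>k\<in>UNIV. \<rho> ^ (snd i $ k))"
    using z \<open>\<rho> \<ge> 0\<close> by (intro mult_mono prod_mono prod_nonneg conjI power_mono ballI) auto
  finally show ?thesis by (simp add: deg2_def mi_abs_def power_sum power_add)
qed

lemma has_sum_fibres:
  fixes f :: "'t \<Rightarrow> 'b :: banach"
  assumes "(f has_sum s) UNIV"
  shows "((\<lambda>i. infsum f {t. h t = i}) has_sum s) UNIV" "f summable_on {t. h t = i}"
proof -
  have b: "bij_betw (\<lambda>t. (h t, t)) UNIV (SIGMA i:UNIV. {t. h t = i})"
    by (rule bij_betwI[where g = snd]) auto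
  have s: "f summable_on {t. h t = i}" for i
    using assms by (meson subset_UNIV summable_on_def summable_on_subset_banach)
  have "((\<lambda>(i, t). f t) has_sum s) (SIGMA i:UNIV. {t. h t = i})"
    using has_sum_reindex_bij_betw[OF b, of "\<lambda>(i, t). f t" s] assms by simp
  then show "((\<lambda>i. infsum f {t. h t = i}) has_sum s) UNIV"
    by (rule has_sum_SigmaD) (use s in \<open>auto intro: has_sum_infsum\<close>)
  show "f summable_on {t. h t = i}" by (rule s)
qed

text \<open>Products and convergent sums of power series are both instances of this rearrangement, with
  pairs of exponents or pairs of a summand and an exponent as the index set.\<close>

lemma rseries_collect:
  fixes g :: "'t \<Rightarrow> complex" and h :: "'t \<Rightarrow> 'n::finite mi2"
  assumes \<rho>: "\<rho> > 0" and S: "((\<lambda>t. norm (g t) * \<rho> ^ deg2 (h t)) has_sum S) UNIV" and "S \<le> M"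
    and f: "\<And>z. z \<in> cube a \<rho> \<Longrightarrow> ((\<lambda>t. g t * rmono a (h t) z) has_sum f z) UNIV"
  shows "rseries a \<rho> M f"
proof -
  define T where "T i = {t. h t = i}" for i
  define c where "c i = infsum g (T i)" for i
  define m where "m i = (\<Sum>\<^sub>\<infinity>t\<in>T i. norm (g t) * \<rho> ^ deg2 (h t))" for i
  note fib = has_sum_fibres[OF S, of h, folded T_def]
  have gs: "(\<lambda>t. norm (g t)) summable_on T i" for i
  proof -
    have "(\<lambda>t. norm (g t) * \<rho> ^ deg2 i) summable_on T i"
      using fib(2)[of i] by (rule summable_on_cong[THEN iffD1, rotated]) (simp add: T_def)
    then have "(\<lambda>t. norm (g t) * \<rho> ^ deg2 i * inverse (\<rho> ^ deg2 i)) summable_on T i"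
      by (rule summable_on_cmult_left)
    moreover have "x * \<rho> ^ deg2 i * inverse (\<rho> ^ deg2 i) = x" for x
      using \<rho> by simp
    ultimately show ?thesis by (simp only:)
  qed
  then have g: "g summable_on T i" for i by (rule abs_summable_summable)
  have le: "norm (c i) * \<rho> ^ deg2 i \<le> m i" for i
  proof -
    have "m i = (\<Sum>\<^sub>\<infinity>t\<in>T i. norm (g t) * \<rho> ^ deg2 i)"
      unfolding m_def by (intro infsum_cong) (simp add: T_def)
    also have "\<dots> = (\<Sum>\<^sub>\<infinity>t\<in>T i. norm (g t)) * \<rho> ^ deg2 i"
      using gs by (intro infsum_cmult_left) auto
    finally show ?thesis
      unfolding c_def using norm_infsum_bound[OF gs[of i]] \<rho> by (simp add: mult_right_mono)
  qed
  have m: "(m has_sum S) UNIV" unfolding m_def by (rule fib(1))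
  have cs: "(\<lambda>i. norm (c i) * \<rho> ^ deg2 i) summable_on UNIV"
    using Infinite_Sum.abs_summable_on_comparison_test'[of m UNIV "\<lambda>i. norm (c i) * \<rho> ^ deg2 i"] m le \<rho>
    by (auto simp: summable_on_def)
  moreover have "(\<Sum>\<^sub>\<infinity>i. norm (c i) * \<rho> ^ deg2 i) \<le> M"
    using has_sum_mono[OF has_sum_infsum[OF cs] m] le \<open>S \<le> M\<close> by simp
  moreover have "((\<lambda>i. c i * rmono a i z) has_sum f z) UNIV" if "z \<in> cube a \<rho>" for z
  proof -
    have "(\<Sum>\<^sub>\<infinity>t\<in>T i. g t * rmono a (h t) z) = c i * rmono a i z" for i
    proof -
      have "(\<Sum>\<^sub>\<infinity>t\<in>T i. g t * rmono a (h t) z) = (\<Sum>\<^sub>\<infinity>t\<in>T i. g t * rmono a i z)"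
        by (intro infsum_cong) (simp add: T_def)
      then show ?thesis unfolding c_def using g by (simp add: infsum_cmult_left)
    qed
    then show ?thesis using has_sum_fibres(1)[OF f[OF that], of h] by (simp add: T_def)
  qed
  ultimately show ?thesis unfolding rseries_def by blast
qed

lemma rseries_monomial:
  assumes "\<rho> > 0" "norm c * \<rho> ^ deg2 i \<le> M"
  shows "rseries a \<rho> M (\<lambda>z. c * rmono a i z)"
  by (rule rseries_collect[where g = "\<lambda>_ :: unit. c" and h = "\<lambda>_. i"])
     (use assms in \<open>auto simp: UNIV_unit intro: has_sum_finiteI\<close>)

lemma has_sum_times:
  fixes x :: "'a \<Rightarrow> 'c :: {real_normed_field, banach}"
  assumes "(x has_sum X) UNIV" "(y has_sum Y) UNIV"
    "(\<lambda>i. norm (x i)) summable_on UNIV" "(\<lambda>i. norm (y i)) summable_on UNIV"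
  shows "((\<lambda>(i, j). x i * y j) has_sum X * Y) UNIV"
proof -
  have "(\<lambda>(i, j). norm (x i * y j)) summable_on (SIGMA i:UNIV. UNIV)"
  proof (rule summable_on_SigmaI)
    show "((\<lambda>j. case (i, j) of (i, j) \<Rightarrow> norm (x i * y j)) has_sum norm (x i) * (\<Sum>\<^sub>\<infinity>j. norm (y j))) UNIV" for i
      using assms(4) by (simp add: norm_mult has_sum_cmult_right)
    show "(\<lambda>i. norm (x i) * (\<Sum>\<^sub>\<infinity>j. norm (y j))) summable_on UNIV"
      using assms(3) by (rule summable_on_cmult_left)
  qed auto
  then have s: "(\<lambda>(i, j). x i * y j) summable_on (SIGMA i:UNIV. UNIV)"
    by (rule abs_summable_summable[OF summable_on_cong[THEN iffD1, rotated]]) auto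
  have "((\<lambda>(i, j). x i * y j) has_sum X * Y) (SIGMA i:UNIV. UNIV)"
    by (rule has_sum_SigmaI[OF _ _ s, where g = "\<lambda>i. x i * Y"])
       (use assms in \<open>auto intro: has_sum_cmult_right has_sum_cmult_left\<close>)
  then show ?thesis by simp
qed

lemma rseriesE:
  assumes "rseries a \<rho> M f" "\<rho> > 0"
  obtains c S where "((\<lambda>i. norm (c i) * \<rho> ^ deg2 i) has_sum S) UNIV" "0 \<le> S" "S \<le> M"
    "\<And>z. z \<in> cube a \<rho> \<Longrightarrow> ((\<lambda>i. c i * rmono a i z) has_sum f z) UNIV"
    "\<And>z. z \<in> cube a \<rho> \<Longrightarrow> (\<lambda>i. norm (c i * rmono a i z)) summable_on UNIV"
proof -
  obtain c where c: "(\<lambda>i. norm (c i) * \<rho> ^ deg2 i) summable_on UNIV"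
    "(\<Sum>\<^sub>\<infinity>i. norm (c i) * \<rho> ^ deg2 i) \<le> M"
    "\<And>z. z \<in> cube a \<rho> \<Longrightarrow> ((\<lambda>i. c i * rmono a i z) has_sum f z) UNIV"
    using assms(1) unfolding rseries_def by blast
  show ?thesis
  proof (rule that[OF has_sum_infsum[OF c(1)] _ c(2,3)])
    show "(\<Sum>\<^sub>\<infinity>i. norm (c i) * \<rho> ^ deg2 i) \<ge> 0"
      using assms(2) by (intro infsum_nonneg) auto
    show "(\<lambda>i. norm (c i * rmono a i z)) summable_on UNIV" if "z \<in> cube a \<rho>" for z
    proof -
      have "(\<lambda>i. c i * rmono a i z) summable_on UNIV"
        using c(3)[OF that] by (auto simp: summable_on_def)
      then show ?thesis by (simp only: summable_on_iff_abs_summable_on_complex)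
    qed
  qed
qed

lemma rseries_mult:
  assumes "rseries a \<rho> M f" "rseries a \<rho> N g" "\<rho> > 0"
  shows "rseries a \<rho> (M * N) (\<lambda>z. f z * g z)"
proof -
  obtain c S where c: "((\<lambda>i. norm (c i) * \<rho> ^ deg2 i) has_sum S) UNIV" "0 \<le> S" "S \<le> M"
    "\<And>z. z \<in> cube a \<rho> \<Longrightarrow> ((\<lambda>i. c i * rmono a i z) has_sum f z) UNIV"
    "\<And>z. z \<in> cube a \<rho> \<Longrightarrow> (\<lambda>i. norm (c i * rmono a i z)) summable_on UNIV"
    by (rule rseriesE[OF assms(1,3)]) (rule that)
  obtain d T where d: "((\<lambda>i. norm (d i) * \<rho> ^ deg2 i) has_sum T) UNIV" "0 \<le> T" "T \<le> N"
    "\<And>z. z \<in> cube a \<rho> \<Longrightarrow> ((\<lambda>i. d i * rmono a i z) has_sum g z) UNIV"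
    "\<And>z. z \<in> cube a \<rho> \<Longrightarrow> (\<lambda>i. norm (d i * rmono a i z)) summable_on UNIV"
    by (rule rseriesE[OF assms(2,3)]) (rule that)
  show ?thesis
  proof (rule rseries_collect[where g = "\<lambda>(i, j). c i * d j" and h = "\<lambda>(i, j). i + j" and S = "S * T"])
    have "(\<lambda>i. norm (norm (c i) * \<rho> ^ deg2 i)) summable_on UNIV" "(\<lambda>i. norm (norm (d i) * \<rho> ^ deg2 i)) summable_on UNIV"
      using c(1) d(1) assms(3) by (auto simp: summable_on_def abs_mult)
    from has_sum_times[OF c(1) d(1) this]
    show "((\<lambda>t. norm (case t of (i, j) \<Rightarrow> c i * d j) * \<rho> ^ deg2 (case t of (i, j) \<Rightarrow> i + j)) has_sum S * T) UNIV"
      by (simp add: case_prod_unfold norm_mult power_add mult_ac)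
    show "S * T \<le> M * N" using c d by (intro mult_mono) auto
    fix z assume z: "z \<in> cube a \<rho>"
    show "((\<lambda>t. (case t of (i, j) \<Rightarrow> c i * d j) * rmono a (case t of (i, j) \<Rightarrow> i + j) z) has_sum f z * g z) UNIV"
      using has_sum_times[OF c(4)[OF z] d(4)[OF z] c(5)[OF z] d(5)[OF z]]
      by (simp add: case_prod_unfold rmono_add mult_ac)
  qed (rule assms)
qed

lemma rseries_infsum:
  assumes \<rho>: "\<rho> > 0" and F: "\<And>s. rseries a \<rho> (M s) (F s)" and M: "(M has_sum N) UNIV"
    and f: "\<And>z. z \<in> cube a \<rho> \<Longrightarrow> ((\<lambda>s. F s z) has_sum f z) UNIV"
  shows "rseries a \<rho> N f"
proof -
  define Q where "Q s c S \<longleftrightarrow> ((\<lambda>i. norm (c i) * \<rho> ^ deg2 i) has_sum S) UNIV \<and> 0 \<le> S \<and> S \<le> M s \<and>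
    (\<forall>z\<in>cube a \<rho>. ((\<lambda>i. c i * rmono a i z) has_sum F s z) UNIV)" for s c S
  have "\<exists>c S. Q s c S" for s
    by (rule rseriesE[OF F[of s] \<rho>]) (unfold Q_def, blast)
  then obtain c S where "\<And>s. Q s (c s) (S s)"
    by metis
  then have c: "\<And>s. ((\<lambda>i. norm (c s i) * \<rho> ^ deg2 i) has_sum S s) UNIV"
    "\<And>s. 0 \<le> S s" "\<And>s. S s \<le> M s"
    "\<And>s z. z \<in> cube a \<rho> \<Longrightarrow> ((\<lambda>i. c s i * rmono a i z) has_sum F s z) UNIV"
    unfolding Q_def by blast+
  have "(\<lambda>s. norm (S s)) summable_on UNIV"
    by (rule Infinite_Sum.abs_summable_on_comparison_test') (use M c in \<open>auto simp: summable_on_def\<close>)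
  then have Ss: "(S has_sum infsum S UNIV) UNIV"
    using c(2) by simp
  have sN: "infsum S UNIV \<le> N" using has_sum_mono[OF Ss M] c(3) by simp
  have "(\<lambda>(s, i). norm (c s i) * \<rho> ^ deg2 i) summable_on (SIGMA s:UNIV. UNIV)"
    by (rule summable_on_SigmaI[where g = S]) (use c Ss \<rho> in \<open>auto simp: summable_on_def\<close>)
  then have abs: "(\<lambda>(s, i). norm (c s i) * \<rho> ^ deg2 i) summable_on UNIV" by simp
  show ?thesis
  proof (rule rseries_collect[where g = "\<lambda>(s, i). c s i" and h = snd])
    have "((\<lambda>(s, i). norm (c s i) * \<rho> ^ deg2 i) has_sum infsum S UNIV) (SIGMA s:UNIV. UNIV)"
      by (rule has_sum_SigmaI[where g = S]) (use c Ss abs in auto)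
    then show "((\<lambda>t. norm (case t of (s, i) \<Rightarrow> c s i) * \<rho> ^ deg2 (snd t)) has_sum infsum S UNIV) UNIV"
      by (simp add: case_prod_unfold)
    fix z assume z: "z \<in> cube a \<rho>"
    have "(\<lambda>(s, i). c s i * rmono a i z) summable_on UNIV"
    proof (rule abs_summable_summable, rule Infinite_Sum.abs_summable_on_comparison_test'[OF abs])
      show "norm ((\<lambda>(s, i). c s i * rmono a i z) t) \<le> (\<lambda>(s, i). norm (c s i) * \<rho> ^ deg2 i) t" for t
        by (cases t) (simp add: norm_mult norm_rmono_le[OF z] mult_left_mono)
    qed
    then have "((\<lambda>(s, i). c s i * rmono a i z) has_sum f z) (SIGMA s:UNIV. UNIV)"
      by (intro has_sum_SigmaI[where g = "\<lambda>s. F s z"]) (use c f z in auto)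
    then show "((\<lambda>t. (case t of (s, i) \<Rightarrow> c s i) * rmono a (snd t) z) has_sum f z) UNIV"
      by (simp add: case_prod_unfold)
  qed (use \<rho> sN in auto)
qed

lemma rseries_mono: "rseries a \<rho> M f \<Longrightarrow> M \<le> N \<Longrightarrow> rseries a \<rho> N f"
  unfolding rseries_def by (meson order_trans)

lemma rseries_const: "\<rho> > 0 \<Longrightarrow> rseries a \<rho> (norm c) (\<lambda>z. c)"
  using rseries_monomial[of \<rho> c 0 "norm c" a] by simp

lemma rseries_add:
  assumes "\<rho> > 0" "rseries a \<rho> M f" "rseries a \<rho> N g"
  shows "rseries a \<rho> (M + N) (\<lambda>z. f z + g z)"
  by (rule rseries_infsum[where F = "\<lambda>b. if b then f else g" and M = "\<lambda>b. if b then M else N"])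
     (use assms in \<open>auto simp: UNIV_bool intro!: has_sum_finiteI\<close>)

lemma rseries_cnj:
  assumes "rseries a \<rho> M f"
  shows "rseries a \<rho> M (\<lambda>z. cnj (f z))"
proof -
  obtain c where c: "(\<lambda>i. norm (c i) * \<rho> ^ deg2 i) summable_on UNIV"
    "(\<Sum>\<^sub>\<infinity>i. norm (c i) * \<rho> ^ deg2 i) \<le> M"
    "\<And>z. z \<in> cube a \<rho> \<Longrightarrow> ((\<lambda>i. c i * rmono a i z) has_sum f z) UNIV"
    using assms unfolding rseries_def by blast
  have "((\<lambda>i. cnj (c i) * rmono a i z) has_sum cnj (f z)) UNIV" if "z \<in> cube a \<rho>" for z
  proof -
    have "((\<lambda>i. cnj (c i * rmono a i z)) has_sum cnj (f z)) UNIV"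
      using c(3)[OF that] by (simp only: has_sum_cnj_iff)
    then show ?thesis by (simp add: rmono_def)
  qed
  then show ?thesis using c unfolding rseries_def by (intro exI[of _ "\<lambda>i. cnj (c i)"]) auto
qed

lemma rseries_power: "\<rho> > 0 \<Longrightarrow> rseries a \<rho> M f \<Longrightarrow> rseries a \<rho> (M ^ r) (\<lambda>z. f z ^ r)"
proof (induction r)
  case 0
  then show ?case using rseries_const[of \<rho> a 1] by simp
next
  case (Suc r)
  then show ?case using rseries_mult[of a \<rho> M f "M ^ r" "\<lambda>z. f z ^ r"] by simp
qed

lemma rseries_prod:
  assumes "\<rho> > 0" "finite K" "\<And>k. k \<in> K \<Longrightarrow> rseries a \<rho> (M k) (f k)"
  shows "rseries a \<rho> (\<Prod>k\<in>K. M k) (\<lambda>z. \<Prod>k\<in>K. f k z)"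
  using assms(2,3)
proof (induction K)
  case empty
  then show ?case using rseries_const[of \<rho> a 1] assms(1) by simp
next
  case (insert k K)
  then show ?case using rseries_mult[of a \<rho> "M k" "f k" "\<Prod>k\<in>K. M k" "\<lambda>z. \<Prod>k\<in>K. f k z"] assms(1) by simp
qed

section \<open>Recentring coordinates and entire series\<close>

lemma rseries_coord: "rseries a 1 (norm (a - p) + 2) (\<lambda>z. z $ k - p $ k)"
proof -
  have delta: "(\<Prod>j\<in>UNIV. x j ^ (axis k 1 $ j)) = x k" for x :: "'a \<Rightarrow> real"
  proof -
    have "(\<Prod>j\<in>UNIV. x j ^ (axis k 1 $ j)) = (\<Prod>j\<in>UNIV. if j = k then x k else 1)"
      by (intro prod.cong) (auto simp: axis_def)
    then show ?thesis by simp
  qed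
  have 1: "rseries a 1 1 (\<lambda>z. of_real (Re (z $ k - a $ k)))"
  proof -
    have "rmono a (axis k 1, 0) z = of_real (Re (z $ k - a $ k))" for z
      unfolding rmono_def fst_conv snd_conv delta by simp
    then show ?thesis using rseries_monomial[of 1 1 "(axis k 1, 0)" 1 a] by simp
  qed
  have 2: "rseries a 1 1 (\<lambda>z. \<i> * of_real (Im (z $ k - a $ k)))"
  proof -
    have "rmono a (0, axis k 1) z = of_real (Im (z $ k - a $ k))" for z
      unfolding rmono_def fst_conv snd_conv delta by simp
    then show ?thesis using rseries_monomial[of 1 \<i> "(0, axis k 1)" 1 a] by simp
  qed
  \<comment> \<open>The constant contributes its norm; radius 1 makes the contributions of the real
    and the imaginary part equal to 1.\<close>
  have sum: "rseries a 1 (norm (a $ k - p $ k) + 1 + 1)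
      (\<lambda>z. (a $ k - p $ k) + of_real (Re (z $ k - a $ k)) + \<i> * of_real (Im (z $ k - a $ k)))"
    by (intro rseries_add rseries_const 1 2) auto
  have eq: "(a $ k - p $ k) + of_real (Re (z $ k - a $ k)) + \<i> * of_real (Im (z $ k - a $ k)) = z $ k - p $ k"
    for z :: "complex ^ 'a"
    by (simp add: complex_eq_iff)
  have "norm (a $ k - p $ k) + 1 + 1 \<le> norm (a - p) + 2"
    using Finite_Cartesian_Product.norm_nth_le[of "a - p" k] by simp
  then show ?thesis using rseries_mono sum[unfolded eq] by blast
qed

lemma rseries_mono_at: "rseries a 1 ((norm (a - p) + 2) ^ mi_abs R) (mono_at p R)"
proof -
  have "rseries a 1 (\<Prod>k\<in>UNIV. (norm (a - p) + 2) ^ (R $ k)) (\<lambda>z. \<Prod>k\<in>UNIV. (z $ k - p $ k) ^ (R $ k))"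
    by (intro rseries_prod rseries_power rseries_coord) auto
  then show ?thesis by (simp add: mono_at_def[abs_def] mi_abs_def power_sum)
qed

text \<open>Around \<open>b\<close> each Taylor term is a polynomial whose weighted norm is at most
  the modulus of its coefficient times a power of \<open>B\<close>, the exponent being the degree.
  These bounds are summable because the series converges everywhere.\<close>

lemma rseries_expands:
  assumes "expands p a f"
  shows "\<exists>M. rseries b 1 M f"
proof -
  define B where "B = norm (b - p) + 2"
  let ?M = "\<lambda>i. norm (a (fst i) (snd i)) * (mwt 1 (fst i) * mwt 1 (snd i)) * B ^ (mi_abs (fst i) + mi_abs (snd i))"
  have "rseries b 1 (infsum ?M UNIV) f"
  proof (rule rseries_infsum[where F = "taylor_term p a" and M = ?M])
    show "rseries b 1 (?M i) (taylor_term p a i)" for i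
    proof -
      have "rseries b 1 (norm (a (fst i) (snd i) * of_real (mwt 1 (fst i) * mwt 1 (snd i))) *
          (B ^ mi_abs (fst i) * B ^ mi_abs (snd i)))
          (\<lambda>z. a (fst i) (snd i) * of_real (mwt 1 (fst i) * mwt 1 (snd i)) *
            (mono_at p (fst i) z * cnj (mono_at p (snd i) z)))"
        unfolding B_def by (intro rseries_mult rseries_const rseries_cnj rseries_mono_at) auto
      then show ?thesis by (simp add: taylor_term_def[abs_def] norm_mult power_add)
    qed
    show "(?M has_sum infsum ?M UNIV) UNIV"
      by (rule has_sum_infsum, rule expands_summable[OF assms]) (simp add: B_def)
  qed (use assms in \<open>auto simp: expands_def\<close>)
  then show ?thesis by blast
qed

lemma rseries_shrink:
  assumes "rseries a \<rho> M f" "0 < \<rho>'" "\<rho>' \<le> \<rho>"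
  shows "rseries a \<rho>' M f"
proof -
  obtain c where c: "(\<lambda>i. norm (c i) * \<rho> ^ deg2 i) summable_on UNIV"
    "(\<Sum>\<^sub>\<infinity>i. norm (c i) * \<rho> ^ deg2 i) \<le> M"
    "\<And>z. z \<in> cube a \<rho> \<Longrightarrow> ((\<lambda>i. c i * rmono a i z) has_sum f z) UNIV"
    using assms(1) unfolding rseries_def by blast
  have le: "norm (c i) * \<rho>' ^ deg2 i \<le> norm (c i) * \<rho> ^ deg2 i" for i
    using assms by (intro mult_left_mono power_mono) auto
  have s: "(\<lambda>i. norm (c i) * \<rho>' ^ deg2 i) summable_on UNIV"
    using Infinite_Sum.abs_summable_on_comparison_test'[OF c(1), of "\<lambda>i. norm (c i) * \<rho>' ^ deg2 i"] le assms
    by simp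
  have "cube a \<rho>' \<subseteq> cube a \<rho>"
    using assms(3) unfolding cube_def by (blast intro: order_trans)
  then show ?thesis
    using c s infsum_mono[OF s c(1) le] unfolding rseries_def
    by (intro exI[of _ c]) auto
qed

text \<open>Balls and cubes are interchangeable after shrinking. What is gained is absolute
  convergence with a bound on the whole cube, obtained from convergence at a single corner.\<close>

lemma real_analytic_rseries: "real_analytic f \<longleftrightarrow> (\<forall>a. \<exists>\<rho>>0. \<exists>M. rseries a \<rho> M f)"
proof
  assume ra: "real_analytic f"
  show "\<forall>a. \<exists>\<rho>>0. \<exists>M. rseries a \<rho> M f"
  proof
    fix a
    obtain r c where r: "r > 0" and c: "\<And>z. z \<in> ball a r \<Longrightarrow> ((\<lambda>(J, K). c J K * rmono a (J, K) z) has_sum f z) UNIV"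
      using ra[unfolded real_analytic_def] unfolding rmono_def fst_conv snd_conv by blast
    \<comment> \<open>The norm is at most the sum of the moduli of the coordinates, each at most
      \<open>2 * \<rho>\<close>; this gives \<open>r / 2\<close> in total.\<close>
    define \<rho> where "\<rho> = r / (4 * real CARD('a))"
    have \<rho>: "\<rho> > 0" using r by (simp add: \<rho>_def)
    have sub: "cube a \<rho> \<subseteq> ball a r"
    proof
      fix z assume z: "z \<in> cube a \<rho>"
      have "norm (z - a) \<le> (\<Sum>k\<in>UNIV. norm ((z - a) $ k))" unfolding norm_vec_def by (rule L2_set_le_sum) simp
      also have "\<dots> \<le> (\<Sum>k\<in>(UNIV :: 'a set). 2 * \<rho>)"
      proof (rule sum_mono)
        fix k
        have "norm ((z - a) $ k) \<le> \<bar>Re ((z - a) $ k)\<bar> + \<bar>Im ((z - a) $ k)\<bar>" by (rule cmod_le)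
        also have "\<dots> \<le> 2 * \<rho>"
          using z by (auto simp: cube_def dest!: spec[of _ k])
        finally show "norm ((z - a) $ k) \<le> 2 * \<rho>" .
      qed
      also have "\<dots> < r" using r by (simp add: \<rho>_def)
      finally show "z \<in> ball a r" by (simp add: dist_norm norm_minus_commute)
    qed
    \<comment> \<open>At this corner every real monomial equals \<open>\<rho>\<close> to its degree,
      so convergence there is summability of the weighted coefficients.\<close>
    define z0 where "z0 = (\<chi> k. a $ k + Complex \<rho> \<rho>)"
    have "z0 \<in> cube a \<rho>" using \<rho> by (simp add: cube_def z0_def)
    then have "(\<lambda>(J, K). c J K * rmono a (J, K) z0) summable_on UNIV"
      using c[of z0] sub unfolding summable_on_def by blast
    then have "(\<lambda>i. norm ((\<lambda>(J, K). c J K * rmono a (J, K) z0) i)) summable_on UNIV"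
      by (simp only: summable_on_iff_abs_summable_on_complex)
    moreover have "norm ((\<lambda>(J, K). c J K * rmono a (J, K) z0) i) = norm (c (fst i) (snd i)) * \<rho> ^ deg2 i" for i
    proof -
      have "rmono a j z0 = of_real (\<rho> ^ deg2 j)" for j
        by (simp add: rmono_def z0_def deg2_def mi_abs_def power_sum power_add)
      then show ?thesis using \<rho> by (simp add: case_prod_unfold norm_mult norm_power)
    qed
    ultimately have "(\<lambda>i. norm (c (fst i) (snd i)) * \<rho> ^ deg2 i) summable_on UNIV" by simp
    then have "rseries a \<rho> (\<Sum>\<^sub>\<infinity>i. norm (c (fst i) (snd i)) * \<rho> ^ deg2 i) f"
      unfolding rseries_def using c sub
      by (intro exI[of _ "\<lambda>i. c (fst i) (snd i)"]) (auto simp: case_prod_unfold)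
    then show "\<exists>\<rho>>0. \<exists>M. rseries a \<rho> M f" using \<rho> by blast
  qed
next
  assume rs: "\<forall>a. \<exists>\<rho>>0. \<exists>M. rseries a \<rho> M f"
  show "real_analytic f"
    unfolding real_analytic_def
  proof
    fix a
    obtain \<rho> M where \<rho>: "\<rho> > 0" "rseries a \<rho> M f" using rs by blast
    obtain c where c: "\<And>z. z \<in> cube a \<rho> \<Longrightarrow> ((\<lambda>i. c i * rmono a i z) has_sum f z) UNIV"
      using \<rho>(2) unfolding rseries_def by blast
    have "ball a \<rho> \<subseteq> cube a \<rho>"
    proof
      fix z assume "z \<in> ball a \<rho>"
      then have "norm (z - a) < \<rho>" by (simp add: dist_norm norm_minus_commute)
      then have "norm (z $ k - a $ k) \<le> \<rho>" for k
        using Finite_Cartesian_Product.norm_nth_le[of "z - a" k] by simp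
      then show "z \<in> cube a \<rho>"
        unfolding cube_def using abs_Re_le_cmod abs_Im_le_cmod by (blast intro: order_trans)
    qed
    then show "\<exists>r>0. \<exists>c. \<forall>z\<in>ball a r. ((\<lambda>(J, K). c J K * complex_of_real
        ((\<Prod>k\<in>UNIV. Re (z $ k - a $ k) ^ J $ k) * (\<Prod>k\<in>UNIV. Im (z $ k - a $ k) ^ K $ k))) has_sum f z) UNIV"
      using \<rho>(1) c by (intro exI[of _ \<rho>] conjI exI[of _ "\<lambda>J K. c (J, K)"]) (auto simp: rmono_def case_prod_unfold)
  qed
qed

lemma real_analytic_expands: "expands p a f \<Longrightarrow> real_analytic f"
  unfolding real_analytic_rseries using rseries_expands zero_less_one by blast

lemma real_analytic_common:
  assumes "real_analytic f" "real_analytic g"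
  obtains \<rho> M N where "\<rho> > 0" "rseries a \<rho> M f" "rseries a \<rho> N g"
proof -
  obtain \<rho> M \<rho>' N where r: "\<rho> > 0" "rseries a \<rho> M f" "\<rho>' > 0" "rseries a \<rho>' N g"
    using assms unfolding real_analytic_rseries by metis
  show ?thesis
    by (rule that[of "min \<rho> \<rho>'" M N]) (use r in \<open>auto intro: rseries_shrink[OF r(2)] rseries_shrink[OF r(4)]\<close>)
qed

lemma real_analytic_add:
  assumes "real_analytic f" "real_analytic g"
  shows "real_analytic (\<lambda>z. f z + g z)"
  unfolding real_analytic_rseries
proof
  fix a
  obtain \<rho> M N where "\<rho> > 0" "rseries a \<rho> M f" "rseries a \<rho> N g"
    by (rule real_analytic_common[OF assms])
  then show "\<exists>\<rho>>0. \<exists>M. rseries a \<rho> M (\<lambda>z. f z + g z)" using rseries_add by blast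
qed

lemma real_analytic_mult:
  assumes "real_analytic f" "real_analytic g"
  shows "real_analytic (\<lambda>z. f z * g z)"
  unfolding real_analytic_rseries
proof
  fix a
  obtain \<rho> M N where "\<rho> > 0" "rseries a \<rho> M f" "rseries a \<rho> N g"
    by (rule real_analytic_common[OF assms])
  then show "\<exists>\<rho>>0. \<exists>M. rseries a \<rho> M (\<lambda>z. f z * g z)" using rseries_mult by blast
qed

lemma real_analytic_const: "real_analytic (\<lambda>z. c)"
  unfolding real_analytic_rseries using rseries_const zero_less_one by blast

lemma real_analytic_cnj: "real_analytic f \<Longrightarrow> real_analytic (\<lambda>z. cnj (f z))"
  unfolding real_analytic_rseries using rseries_cnj by fast

lemma real_analytic_cmult: "real_analytic f \<Longrightarrow> real_analytic (\<lambda>z. c * f z)"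
  by (intro real_analytic_mult real_analytic_const)

lemma real_analytic_diff: "real_analytic f \<Longrightarrow> real_analytic g \<Longrightarrow> real_analytic (\<lambda>z. f z - g z)"
  using real_analytic_add[of f "\<lambda>z. -1 * g z"] real_analytic_cmult[of g "-1"] by simp

lemma real_analytic_sum: "(\<And>i. i \<in> I \<Longrightarrow> real_analytic (f i)) \<Longrightarrow> real_analytic (\<lambda>z. \<Sum>i\<in>I. f i z)"
  by (induction I rule: infinite_finite_induct) (auto intro: real_analytic_const real_analytic_add)

section \<open>The identity theorem for real-analytic functions\<close>

lemma rmono_line: "rmono a i (a + s *\<^sub>R v) = of_real s ^ deg2 i * rmono a i (a + v)"
  by (simp add: rmono_def deg2_def mi_abs_def power_mult_distrib prod.distrib power_sum power_add mult_ac)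

text \<open>On a line the terms of equal degree collapse into one power of \<open>s\<close>, leaving
  a power series in one variable.\<close>

lemma real_analytic_line:
  assumes "real_analytic f"
  obtains b \<epsilon> where "\<epsilon> > 0" "\<And>s :: real. \<bar>s\<bar> < \<epsilon> \<Longrightarrow> (\<lambda>m. b m * of_real s ^ m) sums f (a + s *\<^sub>R v)"
proof -
  obtain \<rho> M where \<rho>: "\<rho> > 0" "rseries a \<rho> M f" using assms unfolding real_analytic_rseries by metis
  obtain c where c: "\<And>z. z \<in> cube a \<rho> \<Longrightarrow> ((\<lambda>i. c i * rmono a i z) has_sum f z) UNIV"
    using \<rho>(2) unfolding rseries_def by blast
  define \<epsilon> where "\<epsilon> = \<rho> / (norm v + 1)"
  have \<epsilon>: "\<epsilon> > 0" using \<rho> by (simp add: \<epsilon>_def add_nonneg_pos)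
  have cube: "a + s *\<^sub>R v \<in> cube a \<rho>" if "\<bar>s\<bar> < \<epsilon>" for s
  proof -
    have "norm (s *\<^sub>R v $ k) \<le> \<rho>" for k
    proof -
      have "norm (s *\<^sub>R v $ k) \<le> \<bar>s\<bar> * (norm v + 1)"
        using Finite_Cartesian_Product.norm_nth_le[of v k] by (simp add: mult_left_mono)
      also have "\<dots> \<le> \<epsilon> * (norm v + 1)" using that by (intro mult_right_mono) auto
      also have "\<dots> = \<rho>" using add_nonneg_pos[of "norm v" 1] by (simp add: \<epsilon>_def)
      finally show ?thesis .
    qed
    then have "\<bar>Re (s *\<^sub>R v $ k)\<bar> \<le> \<rho>" "\<bar>Im (s *\<^sub>R v $ k)\<bar> \<le> \<rho>" for k
      using abs_Re_le_cmod abs_Im_le_cmod order_trans by blast+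
    then show ?thesis by (simp add: cube_def)
  qed
  define T where "T m = {i :: 'a mi2. deg2 i = m}" for m
  define b where "b m = (\<Sum>\<^sub>\<infinity>i\<in>T m. c i * rmono a i (a + v))" for m
  have hs: "((\<lambda>i. c i * (of_real s ^ deg2 i * rmono a i (a + v))) has_sum f (a + s *\<^sub>R v)) UNIV"
    if "\<bar>s\<bar> < \<epsilon>" for s
    using c[OF cube[OF that]] by (simp add: rmono_line)
  \<comment> \<open>The point \<open>a + v\<close> itself may lie outside the cube; summability is
    taken from the parameter \<open>\<epsilon> / 2\<close>, and the power is divided out.\<close>
  have sm: "(\<lambda>i. c i * rmono a i (a + v)) summable_on T m" for m
  proof -
    have "\<bar>\<epsilon> / 2\<bar> < \<epsilon>" using \<epsilon> by simp
    from has_sum_fibres(2)[OF hs[OF this], of deg2 m]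
    have "(\<lambda>i. c i * rmono a i (a + v) * of_real (\<epsilon> / 2) ^ m) summable_on T m"
      unfolding T_def by (rule summable_on_cong[THEN iffD1, rotated]) (simp add: mult_ac)
    then have "(\<lambda>i. c i * rmono a i (a + v) * of_real (\<epsilon> / 2) ^ m * inverse (of_real (\<epsilon> / 2) ^ m)) summable_on T m"
      by (rule summable_on_cmult_left)
    moreover have "c i * rmono a i (a + v) * of_real (\<epsilon> / 2) ^ m * inverse (of_real (\<epsilon> / 2) ^ m)
        = c i * rmono a i (a + v)" for i
    proof -
      have "(of_real (\<epsilon> / 2) :: complex) ^ m \<noteq> 0" using \<epsilon> by simp
      then show ?thesis by (metis mult.assoc mult.right_neutral right_inverse)
    qed
    ultimately show ?thesis by (simp only:)
  qed
  have "(\<lambda>m. b m * of_real s ^ m) sums f (a + s *\<^sub>R v)" if "\<bar>s\<bar> < \<epsilon>" for s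
  proof -
    have "(\<Sum>\<^sub>\<infinity>i\<in>T m. c i * (of_real s ^ deg2 i * rmono a i (a + v))) = b m * of_real s ^ m" for m
    proof -
      have "(\<Sum>\<^sub>\<infinity>i\<in>T m. c i * (of_real s ^ deg2 i * rmono a i (a + v)))
          = (\<Sum>\<^sub>\<infinity>i\<in>T m. c i * rmono a i (a + v) * of_real s ^ m)"
        by (intro infsum_cong) (simp add: T_def)
      then show ?thesis unfolding b_def using sm by (simp add: infsum_cmult_left)
    qed
    then show ?thesis
      using has_sum_fibres(1)[OF hs[OF that], of deg2] has_sum_imp_sums by (simp add: T_def)
  qed
  then show ?thesis using that \<epsilon> by blast
qed

text \<open>The lowest nonzero coefficient dominates: after division by \<open>x ^ m\<close> the
  series has the nonzero limit \<open>b m\<close> at 0.\<close>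

lemma power_series_lower_bound:
  fixes \<phi> :: "real \<Rightarrow> complex"
  assumes \<epsilon>: "\<epsilon> > 0" and sums: "\<And>s. \<bar>s\<bar> < \<epsilon> \<Longrightarrow> (\<lambda>m. b m * of_real s ^ m) sums \<phi> s"
    and nz: "b m0 \<noteq> 0"
  obtains m c \<delta> where "c > 0" "\<delta> > 0" "\<And>s. s \<noteq> 0 \<Longrightarrow> \<bar>s\<bar> < \<delta> \<Longrightarrow> norm (\<phi> s) \<ge> c * \<bar>s\<bar> ^ m"
proof -
  define m where "m = (LEAST m. b m \<noteq> 0)"
  have m: "b m \<noteq> 0"
    unfolding m_def using nz by (rule LeastI)
  have z: "b j = 0" if "j < m" for j
    using not_less_Least[OF that[unfolded m_def]] by simp
  define F where "F x = (\<Sum>j. b j * x ^ j)" for x :: complex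
  have "(\<lambda>j. b (j + m) * x ^ j) sums (F x / x ^ m)" if x: "x \<noteq> 0" "norm x < \<epsilon>" for x
  proof -
    obtain s where s: "norm x < s" "s < \<epsilon>" using x(2) dense by blast
    have "summable (\<lambda>j. b j * of_real s ^ j)"
    proof (rule sums_summable[OF sums])
      show "\<bar>s\<bar> < \<epsilon>" using norm_ge_zero[of x] s by linarith
    qed
    then have "summable (\<lambda>j. b j * x ^ j)"
      by (rule powser_inside) (use s in auto)
    then have "(\<lambda>j. b j * x ^ j) sums F x" by (simp add: F_def summable_sums)
    then have "(\<lambda>j. b (j + m) * x ^ (j + m)) sums F x"
      using z by (subst sums_iff_shift) simp
    then have "(\<lambda>j. b (j + m) * x ^ (j + m) / x ^ m) sums (F x / x ^ m)" by (rule sums_divide)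
    then show ?thesis using x(1) by (simp add: power_add)
  qed
  from powser_limit_0_strong[OF \<epsilon>, where a = "\<lambda>j. b (j + m)", OF this]
  have "((\<lambda>x. F x / x ^ m) \<longlongrightarrow> b m) (at 0)" by simp
  then have "((\<lambda>x. norm (F x / x ^ m)) \<longlongrightarrow> norm (b m)) (at 0)" by (rule tendsto_norm)
  then have "\<forall>\<^sub>F x in at 0. norm (b m) / 2 < norm (F x / x ^ m)"
    using m by (intro order_tendstoD(1)) auto
  then obtain d where d: "d > 0" "\<And>x. x \<noteq> 0 \<Longrightarrow> norm x < d \<Longrightarrow> norm (b m) / 2 < norm (F x / x ^ m)"
    by (auto simp: eventually_at)
  show ?thesis
  proof (rule that[of "norm (b m) / 2" "min d \<epsilon>" m])
    fix s :: real assume s: "s \<noteq> 0" "\<bar>s\<bar> < min d \<epsilon>"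
    have "F (of_real s) = \<phi> s" using sums[of s] s by (simp add: F_def sums_iff)
    then have "norm (b m) / 2 < norm (\<phi> s) / \<bar>s\<bar> ^ m"
      using d(2)[of "of_real s"] s by (simp add: norm_divide norm_power)
    then show "norm (b m) / 2 * \<bar>s\<bar> ^ m \<le> norm (\<phi> s)"
      using s by (simp add: field_simps)
  qed (use m d \<epsilon> in auto)
qed

lemma has_derivative_line:
  assumes "smooth u"
  shows "((\<lambda>t. u (p + t *\<^sub>R v)) has_derivative (\<lambda>h. h *\<^sub>R dir_deriv v u (p + t *\<^sub>R v))) (at t)"
proof -
  have "((\<lambda>t. u (p + t *\<^sub>R v)) has_derivative (\<lambda>h. dir_deriv (h *\<^sub>R v) u (p + t *\<^sub>R v))) (at t)"
    by (rule has_derivative_compose[OF _ has_derivative_dir_deriv[OF smooth_differentiable[OF assms]]])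
       (auto intro!: derivative_eq_intros)
  then show ?thesis using assms by (simp add: dir_deriv_scaleR_direction smooth_differentiable)
qed

text \<open>The mean value inequality along the line raises the order by one; the induction is over
  all flat functions because the directional derivative is flat again.\<close>

lemma flat_line_bound:
  assumes "flat p u"
  shows "\<exists>C\<ge>0. \<forall>t. \<bar>t\<bar> \<le> 1 \<longrightarrow> norm (u (p + t *\<^sub>R v)) \<le> C * \<bar>t\<bar> ^ m"
  using assms
proof (induction m arbitrary: u)
  case 0
  then have "smooth u" by (simp add: flat_def)
  have "continuous_on {-1..1} (\<lambda>t. u (p + t *\<^sub>R v))"
    using has_derivative_continuous[OF has_derivative_line[OF \<open>smooth u\<close>]]
    by (intro continuous_at_imp_continuous_on) blast
  then have "bounded ((\<lambda>t. u (p + t *\<^sub>R v)) ` {-1..1})"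
    by (intro compact_imp_bounded compact_continuous_image) auto
  then obtain C where C: "\<And>t. t \<in> {-1..1} \<Longrightarrow> norm (u (p + t *\<^sub>R v)) \<le> C"
    unfolding bounded_iff by blast
  then have "C \<ge> 0" using C[of 0] by (meson atLeastAtMost_iff norm_ge_zero order_trans zero_le_one neg_le_0_iff_le)
  then show ?case using C by (intro exI[of _ C]) (auto simp: abs_le_iff)
next
  case (Suc m)
  have sm: "smooth u" using Suc.prems by (simp add: flat_def)
  obtain C where C: "C \<ge> 0" "\<And>t. \<bar>t\<bar> \<le> 1 \<Longrightarrow> norm (dir_deriv v u (p + t *\<^sub>R v)) \<le> C * \<bar>t\<bar> ^ m"
    using Suc.IH[OF flat_dir_deriv[OF Suc.prems]] by metis
  have "norm (u (p + t *\<^sub>R v)) \<le> C * \<bar>t\<bar> ^ Suc m" if t: "\<bar>t\<bar> \<le> 1" for t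
  proof -
    have "norm (u (p + t *\<^sub>R v) - u (p + 0 *\<^sub>R v)) \<le> (C * \<bar>t\<bar> ^ m) * norm (t - 0)"
    proof (rule differentiable_bound[where S = "{-\<bar>t\<bar>..\<bar>t\<bar>}" and f = "\<lambda>t. u (p + t *\<^sub>R v)"
        and f' = "\<lambda>s h. h *\<^sub>R dir_deriv v u (p + s *\<^sub>R v)"])
      fix s assume s: "s \<in> {-\<bar>t\<bar>..\<bar>t\<bar>}"
      then have "\<bar>s\<bar> \<le> \<bar>t\<bar>" by auto
      show "((\<lambda>t. u (p + t *\<^sub>R v)) has_derivative (\<lambda>h. h *\<^sub>R dir_deriv v u (p + s *\<^sub>R v))) (at s within {-\<bar>t\<bar>..\<bar>t\<bar>})"
        by (rule has_derivative_at_withinI[OF has_derivative_line[OF sm]])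
      have "norm (dir_deriv v u (p + s *\<^sub>R v)) \<le> C * \<bar>s\<bar> ^ m" using C(2)[of s] \<open>\<bar>s\<bar> \<le> \<bar>t\<bar>\<close> t by simp
      also have "\<dots> \<le> C * \<bar>t\<bar> ^ m" using C(1) \<open>\<bar>s\<bar> \<le> \<bar>t\<bar>\<close> by (intro mult_left_mono power_mono) auto
      finally show "onorm (\<lambda>h. h *\<^sub>R dir_deriv v u (p + s *\<^sub>R v)) \<le> C * \<bar>t\<bar> ^ m"
        by (intro onorm_bound) (use C in \<open>auto simp: mult.commute intro!: mult_left_mono\<close>)
    qed auto
    then show ?thesis using flat_at[OF Suc.prems] by (simp add: mult_ac)
  qed
  then show ?case using C(1) by blast
qed

text \<open>Connectedness of the line through \<open>p\<close> and \<open>z\<close>. A local power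
  series with a nonzero coefficient is bounded below by a power of \<open>|s|\<close>; flatness
  excludes this at \<open>p\<close>, and accumulating zeros exclude it at limits of points of
  \<open>Z\<close>.\<close>

lemma real_analytic_flat_zero:
  assumes ra: "real_analytic f" and fl: "flat p f"
  shows "f = (\<lambda>z. 0)"
proof
  fix z
  define v where "v = z - p"
  define \<phi> where "\<phi> t = f (p + t *\<^sub>R v)" for t
  define Z where "Z = {t. \<exists>\<epsilon>>0. \<forall>s. \<bar>s\<bar> < \<epsilon> \<longrightarrow> \<phi> (t + s) = 0}"
  \<comment> \<open>A criterion for local vanishing that serves both cases: no lower bound by a
    power holds near \<open>t\<close>.\<close>
  have local: "t \<in> Z" if H: "\<And>m c \<delta>. c > 0 \<Longrightarrow> \<delta> > 0 \<Longrightarrow> \<exists>s. s \<noteq> 0 \<and> \<bar>s\<bar> < \<delta> \<and> norm (\<phi> (t + s)) < c * \<bar>s\<bar> ^ m" for t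
  proof -
    obtain b \<epsilon> where b: "\<epsilon> > 0" "\<And>s :: real. \<bar>s\<bar> < \<epsilon> \<Longrightarrow> (\<lambda>m. b m * of_real s ^ m) sums f ((p + t *\<^sub>R v) + s *\<^sub>R v)"
      using real_analytic_line[OF ra] by metis
    have e: "f ((p + t *\<^sub>R v) + s *\<^sub>R v) = \<phi> (t + s)" for s by (simp add: \<phi>_def algebra_simps)
    have "b m = 0" for m
    proof (rule ccontr)
      assume "b m \<noteq> 0"
      note lower = power_series_lower_bound[OF b(1), of b "\<lambda>s. \<phi> (t + s)", OF b(2)[unfolded e] this]
      show False
      proof (rule lower)
        fix m' c \<delta>
        assume "c > 0" "\<delta> > 0" "\<And>s. s \<noteq> 0 \<Longrightarrow> \<bar>s\<bar> < \<delta> \<Longrightarrow> norm (\<phi> (t + s)) \<ge> c * \<bar>s\<bar> ^ m'"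
        then show False using H[of c \<delta> m'] by (meson not_less)
      qed
    qed
    then have "\<phi> (t + s) = 0" if "\<bar>s\<bar> < \<epsilon>" for s
      using b(2)[OF that] by (simp add: e sums_iff)
    then show ?thesis using b(1) unfolding Z_def by blast
  qed
  have "open Z"
    unfolding open_dist
  proof
    fix t assume "t \<in> Z"
    then obtain \<epsilon> where \<epsilon>: "\<epsilon> > 0" "\<And>s. \<bar>s\<bar> < \<epsilon> \<Longrightarrow> \<phi> (t + s) = 0" unfolding Z_def by blast
    have "y \<in> Z" if "dist y t < \<epsilon> / 2" for y
    proof -
      have "\<phi> (y + s) = 0" if "\<bar>s\<bar> < \<epsilon> / 2" for s
      proof -
        have "\<bar>y - t + s\<bar> < \<epsilon>" using that \<open>dist y t < \<epsilon> / 2\<close> unfolding dist_real_def by linarith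
        moreover have "t + (y - t + s) = y + s" by simp
        ultimately show ?thesis using \<epsilon>(2) by metis
      qed
      then show ?thesis unfolding Z_def using \<epsilon>(1) half_gt_zero by blast
    qed
    then show "\<exists>e>0. \<forall>y. dist y t < e \<longrightarrow> y \<in> Z" using \<epsilon>(1) half_gt_zero by blast
  qed
  moreover have "closed Z"
    unfolding closure_subset_eq[symmetric]
  proof
    fix t assume "t \<in> closure Z"
    then have cl: "\<forall>e>0. \<exists>y\<in>Z. dist y t < e" by (simp add: closure_approachable)
    show "t \<in> Z"
    proof (rule local)
      fix m and c \<delta> :: real assume "c > 0" "\<delta> > 0"
      obtain y where y: "y \<in> Z" "\<bar>y - t\<bar> < \<delta> / 2"
        using cl \<open>\<delta> > 0\<close> by (metis dist_real_def half_gt_zero)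
      obtain \<epsilon> where \<epsilon>: "\<epsilon> > 0" "\<And>s. \<bar>s\<bar> < \<epsilon> \<Longrightarrow> \<phi> (y + s) = 0" using y(1) unfolding Z_def by blast
      define \<eta> where "\<eta> = min \<epsilon> \<delta> / 2"
      have \<eta>: "\<eta> > 0" "\<eta> < \<epsilon>" "\<eta> \<le> \<delta> / 2" using \<epsilon> \<open>\<delta> > 0\<close> by (auto simp: \<eta>_def)
      \<comment> \<open>The approximating parameter may be \<open>t\<close> itself, while the test
        point must differ from \<open>t\<close>; in that case \<open>\<eta>\<close> is used, where
        \<open>\<phi>\<close> vanishes as well.\<close>
      define s where "s = (if y = t then \<eta> else y - t)"
      have "s \<noteq> 0" "\<bar>s\<bar> < \<delta>" "\<phi> (t + s) = 0"
        using y \<eta> \<epsilon>(1) \<epsilon>(2)[of \<eta>] \<epsilon>(2)[of 0] \<open>\<delta> > 0\<close> by (auto simp: s_def)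
      then show "\<exists>s. s \<noteq> 0 \<and> \<bar>s\<bar> < \<delta> \<and> norm (\<phi> (t + s)) < c * \<bar>s\<bar> ^ m"
        using \<open>c > 0\<close> by (intro exI[of _ s]) auto
    qed
  qed
  moreover have "0 \<in> Z"
  proof (rule local)
    fix m and c \<delta> :: real assume "c > 0" "\<delta> > 0"
    obtain C where C: "C \<ge> 0" "\<And>t. \<bar>t\<bar> \<le> 1 \<Longrightarrow> norm (\<phi> t) \<le> C * \<bar>t\<bar> ^ Suc m"
      using flat_line_bound[OF fl, of v "Suc m"] unfolding \<phi>_def by metis
    \<comment> \<open>With \<open>C * s < c\<close> the estimate of order \<open>Suc m\<close> falls
      below \<open>c * s ^ m\<close>.\<close>
    define s where "s = min (min 1 (\<delta> / 2)) (c / (2 * (C + 1)))"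
    have "s \<le> \<delta> / 2" "s \<le> 1" unfolding s_def by linarith+
    then have "s < \<delta>" using \<open>\<delta> > 0\<close> by linarith
    moreover have "s > 0" using \<open>c > 0\<close> \<open>\<delta> > 0\<close> C(1) by (simp add: s_def)
    ultimately have s: "0 < s" "s \<le> 1" "s < \<delta>" using \<open>s \<le> 1\<close> by auto
    have "C * s < c"
    proof -
      have "C * s \<le> C * (c / (2 * (C + 1)))" using C(1) by (intro mult_left_mono) (auto simp: s_def)
      also have "\<dots> < c" using C(1) \<open>c > 0\<close> by (simp add: field_simps add_nonneg_pos)
      finally show ?thesis .
    qed
    have "norm (\<phi> s) \<le> (C * s) * s ^ m" using C(2)[of s] s by simp
    also have "\<dots> < c * s ^ m" using \<open>C * s < c\<close> s by (intro mult_strict_right_mono) auto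
    finally show "\<exists>s. s \<noteq> 0 \<and> \<bar>s\<bar> < \<delta> \<and> norm (\<phi> (0 + s)) < c * \<bar>s\<bar> ^ m"
      using s by (intro exI[of _ s]) auto
  qed
  ultimately have "Z = UNIV" using clopen[of Z] by auto
  then obtain \<epsilon> where "\<epsilon> > 0" "\<And>s. \<bar>s\<bar> < \<epsilon> \<Longrightarrow> \<phi> (1 + s) = 0" unfolding Z_def by blast
  from this(2)[of 0] this(1) show "f z = 0" by (simp add: \<phi>_def v_def)
qed

section \<open>Convexity of the seminorms\<close>

lemma power_mean_two_ennreal:
  assumes "s + t = 1" "s \<ge> 0" "t \<ge> 0"
  shows "(ennreal s * x + ennreal t * y)\<^sup>2 \<le> ennreal s * x\<^sup>2 + ennreal t * y\<^sup>2"
proof -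
  have "(\<Sum>\<^sub>\<infinity>b\<in>UNIV. (if b then ennreal s else ennreal t) * (if b then x else y)) ^ 2 ^ 1
     \<le> (\<Sum>\<^sub>\<infinity>b\<in>UNIV. if b then ennreal s else ennreal t) ^ (2 ^ 1 - 1) *
       (\<Sum>\<^sub>\<infinity>b\<in>UNIV. (if b then ennreal s else ennreal t) * (if b then x else y) ^ 2 ^ 1)"
    by (rule infsum_power_mean)
  moreover have "ennreal t + ennreal s = 1"
    using assms by (simp flip: ennreal_plus add: add.commute)
  ultimately show ?thesis by (simp add: UNIV_bool add.commute power2_eq_square)
qed

lemma shift_op_lincomb:
  "shift_op w (\<lambda>M. c * y M + d * z M) R = c * shift_op w y R + d * shift_op w z R"
proof -
  have "ennreal (mwt w K) * (c * y (R + K) + d * z (R + K))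
      = c * (ennreal (mwt w K) * y (R + K)) + d * (ennreal (mwt w K) * z (R + K))" for K
    by (simp add: distrib_left mult_ac)
  then show ?thesis by (simp add: shift_op_def infsum_add infsum_cmult_ennreal)
qed

lemma binom_op_lincomb: "binom_op (\<lambda>M. c * y M + d * z M) R = c * binom_op y R + d * binom_op z R"
  by (simp add: binom_op_def distrib_left sum.distrib sum_distrib_left mult_ac)

lemma binom_op_mono: "(\<And>M. y M \<le> z M) \<Longrightarrow> binom_op y R \<le> binom_op z R"
  unfolding binom_op_def by (intro sum_mono mult_left_mono) auto

lemma wick_step_convex:
  assumes st: "s + t = 1" "s \<ge> 0" "t \<ge> 0" and X: "\<And>R S. X R S \<le> ennreal s * Y R S + ennreal t * Z R S"
  shows "wick_step X R S \<le> ennreal s * wick_step Y R S + ennreal t * wick_step Z R S"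
proof -
  have "binom_op (\<lambda>I. binom_op (X I) M) R
      \<le> ennreal s * binom_op (\<lambda>I. binom_op (Y I) M) R + ennreal t * binom_op (\<lambda>I. binom_op (Z I) M) R" for M
    unfolding binom_op_lincomb[symmetric] by (intro binom_op_mono X)
  then have "(binom_op (\<lambda>I. binom_op (X I) M) R)\<^sup>2
      \<le> ennreal s * (binom_op (\<lambda>I. binom_op (Y I) M) R)\<^sup>2 + ennreal t * (binom_op (\<lambda>I. binom_op (Z I) M) R)\<^sup>2" for M
    by (rule order_trans[OF power_mono power_mean_two_ennreal[OF st]]) simp
  then show ?thesis
    unfolding wick_step_def shift_op_lincomb[symmetric] by (intro shift_op_mono)
qed

text \<open>Every ingredient of the recursion is monotone and either linear or a square, so a convex
  bound on arrays passes through all levels.\<close>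

lemma wick_array_convex:
  assumes st: "s + t = 1" "s \<ge> 0" "t \<ge> 0" and X: "\<And>R S. X R S \<le> ennreal s * Y R S + ennreal t * Z R S"
  shows "wick_array m l X R S \<le> ennreal s * wick_array m l Y R S + ennreal t * wick_array m l Z R S"
proof (induction m arbitrary: l R S)
  case 0
  have "(X R M)\<^sup>2 \<le> ennreal s * (Y R M)\<^sup>2 + ennreal t * (Z R M)\<^sup>2" for M
    by (rule order_trans[OF power_mono[OF X] power_mean_two_ennreal[OF st]]) simp
  then show ?case
    unfolding wick_array.simps shift_op_lincomb[symmetric] by (intro shift_op_mono)
next
  case (Suc m)
  show ?case using Suc by (auto intro!: wick_step_convex[OF st])
qed

lemma shift_op_cmult: "shift_op w (\<lambda>M. c * y M) R = c * shift_op w y R"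
  using shift_op_lincomb[of w c y 0 y R] by simp

lemma binom_op_cmult: "binom_op (\<lambda>M. c * y M) R = c * binom_op y R"
  using binom_op_lincomb[of c y 0 y R] by simp

lemma wick_step_cmult: "wick_step (\<lambda>R S. c * Y R S) R S = c\<^sup>2 * wick_step Y R S"
  by (simp add: wick_step_def binom_op_cmult power_mult_distrib shift_op_cmult)

lemma wick_array_cmult: "wick_array m l (\<lambda>R S. c * X R S) R S = c ^ (2 ^ Suc m) * wick_array m l X R S"
proof (induction m arbitrary: l R S)
  case 0
  show ?case by (simp add: power_mult_distrib shift_op_cmult)
next
  case (Suc m)
  have "wick_array m l (\<lambda>R S. c * X R S) = (\<lambda>R S. c ^ (2 ^ Suc m) * wick_array m l X R S)" for l
    using Suc by (simp add: fun_eq_iff)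
  then show ?case
    by (simp only: wick_array.simps wick_step_cmult if_distrib power_mult[symmetric] split: if_split)
       (simp add: wick_step_cmult power_mult[symmetric] mult.commute)
qed

text \<open>\<open>Y + Z\<close> is the convex combination of \<open>Y / (1 - t)\<close> and
  \<open>Z / t\<close>, and the recursion is homogeneous of degree \<open>2 ^ Suc m\<close>. For
  small \<open>t\<close> the first factor is close to 1, which is what the openness of balls
  requires.\<close>

lemma wick_array_add:
  assumes t: "0 < t" "t < 1" and X: "\<And>R S. X R S \<le> Y R S + Z R S"
  shows "wick_array m l X R S \<le> ennreal ((1 - t) * (1 / (1 - t)) ^ (2 ^ Suc m)) * wick_array m l Y R S
    + ennreal (t * (1 / t) ^ (2 ^ Suc m)) * wick_array m l Z R S"
proof -
  have "X R S \<le> ennreal (1 - t) * (ennreal (1 / (1 - t)) * Y R S) + ennreal t * (ennreal (1 / t) * Z R S)" for R S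
  proof -
    have "ennreal (1 - t) * (ennreal (1 / (1 - t)) * Y R S) = Y R S"
      using t by (simp add: mult.assoc[symmetric] ennreal_mult[symmetric])
    moreover have "ennreal t * (ennreal (1 / t) * Z R S) = Z R S"
      using t by (simp add: mult.assoc[symmetric] ennreal_mult[symmetric])
    ultimately show ?thesis using X by simp
  qed
  then have "wick_array m l X R S
      \<le> ennreal (1 - t) * wick_array m l (\<lambda>R S. ennreal (1 / (1 - t)) * Y R S) R S
        + ennreal t * wick_array m l (\<lambda>R S. ennreal (1 / t) * Z R S) R S"
    using t by (intro wick_array_convex) auto
  then have "wick_array m l X R S \<le> ennreal (1 - t) * (ennreal (1 / (1 - t)) ^ (2 ^ Suc m) * wick_array m l Y R S)
     + ennreal t * (ennreal (1 / t) ^ (2 ^ Suc m) * wick_array m l Z R S)"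
    by (simp only: wick_array_cmult)
  then show ?thesis using t by (simp add: ennreal_mult ennreal_power mult.assoc)
qed

lemma ennreal_norm_le_infsum:
  assumes "(f has_sum s) UNIV"
  shows "ennreal (norm (s :: complex)) \<le> (\<Sum>\<^sub>\<infinity>i. ennreal (norm (f i)))"
proof -
  have a: "(\<lambda>i. norm (f i)) summable_on UNIV"
    using assms summable_on_iff_abs_summable_on_complex[of f UNIV] unfolding summable_on_def by blast
  have "norm s \<le> (\<Sum>\<^sub>\<infinity>i. norm (f i))"
    using norm_infsum_bound[OF a] assms by (simp add: infsumI)
  then have "ennreal (norm s) \<le> ennreal (\<Sum>\<^sub>\<infinity>i. norm (f i))" by (rule ennreal_leI)
  also have "\<dots> = (\<Sum>\<^sub>\<infinity>i. ennreal (norm (f i)))"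
    unfolding infsum_ennreal_SUP infsum_nonneg_is_SUPREMUM_ennreal[OF a norm_ge_zero]
    by (intro SUP_cong) (auto simp: sum_ennreal)
  finally show ?thesis .
qed

lemma summable_on_if_ennreal_finite:
  fixes f :: "'a \<Rightarrow> complex"
  assumes "(\<Sum>\<^sub>\<infinity>i. ennreal (norm (f i))) < top"
  shows "f summable_on UNIV"
proof -
  obtain B where B: "(\<Sum>\<^sub>\<infinity>i. ennreal (norm (f i))) = ennreal B" "B \<ge> 0"
    using assms by (cases "\<Sum>\<^sub>\<infinity>i. ennreal (norm (f i))") auto
  have "(\<lambda>i. norm (f i)) summable_on UNIV"
  proof (rule nonneg_bdd_above_summable_on)
    show "bdd_above (sum (\<lambda>i. norm (f i)) ` {F. F \<subseteq> UNIV \<and> finite F})"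
    proof (rule bdd_aboveI2)
      fix F :: "'a set" assume F: "F \<in> {F. F \<subseteq> UNIV \<and> finite F}"
      have "ennreal (\<Sum>i\<in>F. norm (f i)) = (\<Sum>\<^sub>\<infinity>i\<in>F. ennreal (norm (f i)))"
        using F by (simp add: sum_ennreal)
      also have "\<dots> \<le> ennreal B"
        unfolding B(1)[symmetric] by (rule infsum_mono_set_ennreal) simp
      finally show "(\<Sum>i\<in>F. norm (f i)) \<le> B" using B(2) by (simp add: ennreal_le_iff)
    qed
  qed simp
  then show ?thesis by (rule abs_summable_summable)
qed

section \<open>From arrays of derivatives back to the seminorms\<close>

definition jet_array :: "complex ^ 'n \<Rightarrow> real \<Rightarrow> 'n::finite cfun \<Rightarrow> nat ^ 'n \<Rightarrow> nat ^ 'n \<Rightarrow> ennreal" where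
  "jet_array p hbar f R S = ennreal (sqrt (2 * hbar) ^ (mi_abs R + mi_abs S) * cmod (D_z R (D_zbar S f) p))"

text \<open>The base level squares the array, so a factor \<open>sqrt (2 * hbar)\<close> per
  derivative yields the \<open>2 * hbar\<close> of the definition; the higher levels are the same
  recursion.\<close>

lemma wick_h_array:
  assumes "hbar > 0"
  shows "wick_h p hbar m l R S f = wick_array m l (jet_array p hbar f) R S"
proof (induction m arbitrary: l R S)
  case 0
  have "ennreal ((2 * hbar) ^ (mi_abs R + mi_abs S + mi_abs N) / real (mi_fact N) * (cmod (D_z R (D_zbar (N + S) f) p))\<^sup>2)
      = ennreal (mwt 1 N) * (jet_array p hbar f R (S + N))\<^sup>2" for N
  proof -
    have "(2 * hbar) ^ (mi_abs R + mi_abs S + mi_abs N) / real (mi_fact N) * (cmod (D_z R (D_zbar (N + S) f) p))\<^sup>2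
      = mwt 1 N * (sqrt (2 * hbar) ^ (mi_abs R + mi_abs (S + N)) * cmod (D_z R (D_zbar (S + N) f) p))\<^sup>2"
    proof -
      have "(sqrt (2 * hbar) ^ k)\<^sup>2 = (2 * hbar) ^ k" for k
        using assms by (metis less_imp_le mult_nonneg_nonneg power_commutes power_mult_distrib power2_eq_square
            real_sqrt_pow2 zero_le_numeral)
      then show ?thesis
        by (simp add: mwt_def power_mult_distrib add.commute add.left_commute)
    qed
    then show ?thesis
      unfolding jet_array_def using assms
      by (subst ennreal_power, simp, simp only: ennreal_mult mwt_nonneg zero_le_one zero_le_power2)
  qed
  then show ?case by (simp add: shift_op_def)
next
  case (Suc m)
  have w: "1 / of_nat (mi_fact N) = ennreal (mwt 1 N)" for N :: "nat ^ 'a"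
    using mi_fact_pos[of N] by (simp add: mwt_def ennreal_of_nat_eq_real_of_nat divide_ennreal flip: ennreal_1)
  show ?case
    unfolding wick_h.simps wick_array.simps wick_step_def shift_op_def w Suc
    by (simp add: binom_op_def sum_distrib_left mult.assoc add.commute)
qed

lemma wick_seminorm_finite_iff: "wick_seminorm p hbar m l R S f < \<infinity> \<longleftrightarrow> wick_h p hbar m l R S f < \<infinity>"
  by (simp add: wick_seminorm_def less_top)

text \<open>Balls of the seminorm become balls of \<open>wick_h\<close>, for which estimates can be
  made without roots.\<close>

lemma wick_seminorm_less_iff:
  assumes "\<epsilon> > 0"
  shows "wick_seminorm p hbar m l R S f < ennreal \<epsilon> \<longleftrightarrow> wick_h p hbar m l R S f < ennreal (\<epsilon> ^ (2 ^ Suc m))"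
proof (cases "wick_h p hbar m l R S f")
  case (real x)
  have "root (2 ^ Suc m) x < \<epsilon> \<longleftrightarrow> x < \<epsilon> ^ (2 ^ Suc m)"
  proof -
    have "root (2 ^ Suc m) x < \<epsilon> \<longleftrightarrow> root (2 ^ Suc m) x < root (2 ^ Suc m) (\<epsilon> ^ (2 ^ Suc m))"
      using assms by (simp add: real_root_power_cancel del: power_Suc)
    then show ?thesis by (simp del: power_Suc)
  qed
  then show ?thesis using real assms by (simp add: wick_seminorm_def ennreal_less_iff del: power_Suc)
qed (simp add: wick_seminorm_def)

lemma A_tilde_iff:
  "f \<in> A_tilde p hbar \<longleftrightarrow> smooth f \<and> (\<forall>m l R S. l < 2 ^ m \<longrightarrow> wick_h p hbar m l R S f < \<infinity>)"
  unfolding A_tilde_def mem_Collect_eq wick_seminorm_finite_iff ..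

lemma D_lincomb:
  "smooth f \<Longrightarrow> smooth g \<Longrightarrow>
    D_z R (D_zbar S (\<lambda>x. a * f x + b * g x)) = (\<lambda>x. a * D_z R (D_zbar S f) x + b * D_z R (D_zbar S g) x)"
  by (simp add: D_z_eq D_zbar_eq D_gen_lincomb smooth_D_gen)

lemma jet_array_diff_le:
  assumes "smooth f" "smooth g" "smooth k" "hbar > 0"
  shows "jet_array p hbar (\<lambda>z. k z - f z) R S
    \<le> jet_array p hbar (\<lambda>z. g z - f z) R S + jet_array p hbar (\<lambda>z. k z - g z) R S"
proof -
  have D: "D_z R (D_zbar S (\<lambda>z. u z - v z)) p = D_z R (D_zbar S u) p - D_z R (D_zbar S v) p"
    if "smooth u" "smooth v" for u v
    using D_lincomb[OF that, of R S 1 "-1"] by simp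
  have "cmod (D_z R (D_zbar S k) p - D_z R (D_zbar S f) p)
      \<le> cmod (D_z R (D_zbar S g) p - D_z R (D_zbar S f) p) + cmod (D_z R (D_zbar S k) p - D_z R (D_zbar S g) p)"
    using norm_triangle_ineq[of "D_z R (D_zbar S g) p - D_z R (D_zbar S f) p" "D_z R (D_zbar S k) p - D_z R (D_zbar S g) p"]
    by simp
  then have "sqrt (2 * hbar) ^ (mi_abs R + mi_abs S) * cmod (D_z R (D_zbar S k) p - D_z R (D_zbar S f) p)
      \<le> sqrt (2 * hbar) ^ (mi_abs R + mi_abs S) * cmod (D_z R (D_zbar S g) p - D_z R (D_zbar S f) p)
       + sqrt (2 * hbar) ^ (mi_abs R + mi_abs S) * cmod (D_z R (D_zbar S k) p - D_z R (D_zbar S g) p)"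
    using assms(4) unfolding distrib_left[symmetric] by (intro mult_left_mono) auto
  then show ?thesis
    using assms unfolding jet_array_def by (simp add: D ennreal_leI flip: ennreal_plus)
qed

lemma wick_h_diff_le:
  assumes "smooth f" "smooth g" "smooth k" "hbar > 0" "0 < t" "t < 1"
  shows "wick_h p hbar m l R S (\<lambda>z. k z - f z)
    \<le> ennreal ((1 - t) * (1 / (1 - t)) ^ (2 ^ Suc m)) * wick_h p hbar m l R S (\<lambda>z. g z - f z)
      + ennreal (t * (1 / t) ^ (2 ^ Suc m)) * wick_h p hbar m l R S (\<lambda>z. k z - g z)"
  unfolding wick_h_array[OF assms(4)]
  by (intro wick_array_add assms jet_array_diff_le)

text \<open>Since \<open>a t\<close> tends to 1, some \<open>t\<close> leaves \<open>a t * x\<close>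
  below \<open>E\<close>; the remaining gap divided by the other factor is the radius.\<close>

lemma wick_h_ball_open:
  assumes sm: "smooth f" "smooth g" "hbar > 0" and less: "wick_h p hbar m l R S (\<lambda>z. g z - f z) < ennreal E"
  obtains \<eta> where "\<eta> > 0" "\<And>k. smooth k \<Longrightarrow> wick_h p hbar m l R S (\<lambda>z. k z - g z) < ennreal \<eta> \<Longrightarrow>
    wick_h p hbar m l R S (\<lambda>z. k z - f z) < ennreal E"
proof -
  let ?q = "2 ^ Suc m :: nat"
  obtain x where x: "wick_h p hbar m l R S (\<lambda>z. g z - f z) = ennreal x" "x \<ge> 0" "x < E"
    using less by (cases "wick_h p hbar m l R S (\<lambda>z. g z - f z)") (auto simp: ennreal_less_iff)
  define a where "a t = (1 - t) * (1 / (1 - t)) ^ ?q" for t :: real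
  have "((\<lambda>t. a t * x) \<longlongrightarrow> (1 - 0) * (1 / (1 - 0)) ^ ?q * x) (at_right 0)"
    unfolding a_def by (intro tendsto_intros) auto
  then have "\<forall>\<^sub>F t in at_right 0. a t * x < E"
    using x by (intro order_tendstoD(2)) auto
  then obtain b where b: "b > 0" "\<And>t. 0 < t \<Longrightarrow> t < b \<Longrightarrow> a t * x < E"
    unfolding eventually_at_right_field by blast
  define t where "t = min b 1 / 2"
  have t: "0 < t" "t < 1" "t < b" using b by (auto simp: t_def)
  then have at: "a t \<ge> 0" "a t * x < E" using b by (auto simp: a_def)
  define c where "c = t * (1 / t) ^ ?q"
  have c: "c > 0" using t by (simp add: c_def)
  show ?thesis
  proof (rule that)
    show "(E - a t * x) / c > 0" using at c by simp
    fix k assume k: "smooth k" "wick_h p hbar m l R S (\<lambda>z. k z - g z) < ennreal ((E - a t * x) / c)"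
    obtain y where y: "wick_h p hbar m l R S (\<lambda>z. k z - g z) = ennreal y" "y \<ge> 0" "y < (E - a t * x) / c"
      using k(2) by (cases "wick_h p hbar m l R S (\<lambda>z. k z - g z)") (auto simp: ennreal_less_iff)
    have "wick_h p hbar m l R S (\<lambda>z. k z - f z) \<le> ennreal (a t) * ennreal x + ennreal c * ennreal y"
      using wick_h_diff_le[OF sm(1,2) k(1) sm(3) t(1,2), of p m l R S] unfolding x y a_def c_def .
    also have "\<dots> = ennreal (a t * x + c * y)"
      using at x c y by (simp add: ennreal_mult)
    also have "\<dots> < ennreal E"
      using y c at x by (intro ennreal_lessI) (auto simp: field_simps intro: le_less_trans)
    finally show "wick_h p hbar m l R S (\<lambda>z. k z - f z) < ennreal E" .
  qed
qed

lemma A_tilde_diff: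
  assumes "f \<in> A_tilde p hbar" "g \<in> A_tilde p hbar" "hbar > 0"
  shows "(\<lambda>z. f z - g z) \<in> A_tilde p hbar"
  unfolding A_tilde_iff
proof (intro conjI allI impI)
  have sm: "smooth f" "smooth g" using assms by (auto simp: A_tilde_iff)
  then show "smooth (\<lambda>z. f z - g z)" by (rule smooth_diff)
  fix m l :: nat and R S :: "nat ^ 'a" assume "l < 2 ^ m"
  then have fin: "wick_h p hbar m l R S f < \<infinity>" "wick_h p hbar m l R S g < \<infinity>" using assms by (auto simp: A_tilde_iff)
  \<comment> \<open>The estimate for differences will be used with 0 as the middle function, so the
    sign of \<open>g\<close> has to be removed.\<close>
  have "jet_array p hbar (\<lambda>z. 0 - g z) = jet_array p hbar g"
    using D_lincomb[OF sm(2) sm(2), of _ _ "-1" 0] by (simp add: fun_eq_iff jet_array_def)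
  then have "wick_h p hbar m l R S (\<lambda>z. 0 - g z) = wick_h p hbar m l R S g"
    by (simp add: wick_h_array assms(3))
  then show "wick_h p hbar m l R S (\<lambda>z. f z - g z) < \<infinity>"
    using wick_h_diff_le[OF sm(2) smooth_const[of 0] sm(1) assms(3), of "1/2" p m l R S] fin
    by (auto simp: ennreal_mult_less_top elim!: le_less_trans)
qed

section \<open>Independence of the base point\<close>

definition derivs_at :: "complex ^ 'n \<Rightarrow> 'n::finite cfun \<Rightarrow> nat ^ 'n \<Rightarrow> nat ^ 'n \<Rightarrow> complex" where
  "derivs_at p f R S = D_z R (D_zbar S f) p"

text \<open>The jet in all real directions and the array of mixed Wirtinger derivatives determine
  each other; the seminorms are built from the latter.\<close>

lemma jet_rel_iff: "(f, g) \<in> jet_rel p \<longleftrightarrow> smooth f \<and> smooth g \<and> derivs_at p f = derivs_at p g"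
proof -
  have "jet_vanishes p (\<lambda>z. g z - f z) \<longleftrightarrow> derivs_at p f = derivs_at p g" if "smooth f" "smooth g"
  proof -
    have D: "D_z R (D_zbar S (\<lambda>z. g z - f z)) p = derivs_at p g R S - derivs_at p f R S" for R S
      using D_lincomb[OF that(2,1), of R S 1 "-1"] by (simp add: derivs_at_def)
    show ?thesis
    proof
      assume "jet_vanishes p (\<lambda>z. g z - f z)"
      then have "flat p (\<lambda>z. g z - f z)" using that by (simp add: flat_def smooth_diff)
      from flat_wirtinger[OF this] show "derivs_at p f = derivs_at p g" by (simp add: D fun_eq_iff)
    next
      assume "derivs_at p f = derivs_at p g"
      then have "flat p (\<lambda>z. g z - f z)" using that by (intro flatI_wirtinger smooth_diff) (simp_all add: D)
      then show "jet_vanishes p (\<lambda>z. g z - f z)" by (simp add: flat_def)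
    qed
  qed
  then show ?thesis by (auto simp: jet_rel_def)
qed

lemma derivs_at_eq_flat:
  "smooth f \<Longrightarrow> smooth g \<Longrightarrow> derivs_at p f = derivs_at p g \<longleftrightarrow> flat p (\<lambda>z. g z - f z)"
  using jet_rel_iff[of f g p] by (simp add: jet_rel_def flat_def smooth_diff)

lemma jet_class_eq: "jet_class p f = {g. smooth f \<and> smooth g \<and> derivs_at p f = derivs_at p g}"
  by (auto simp: jet_class_def jet_rel_iff)

lemma jet_class_eq_iff:
  "smooth f \<Longrightarrow> jet_class p f = jet_class p g \<longleftrightarrow> smooth g \<and> derivs_at p f = derivs_at p g"
  by (auto simp: jet_class_eq set_eq_iff)

lemma real_analytic_eqI:
  assumes "real_analytic f" "real_analytic g" "smooth f" "smooth g" "derivs_at p f = derivs_at p g"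
  shows "f = g"
proof -
  have "(\<lambda>z. g z - f z) = (\<lambda>z. 0)"
    using assms derivs_at_eq_flat by (intro real_analytic_flat_zero real_analytic_diff) blast+
  then show ?thesis by (simp add: fun_eq_iff)
qed

lemma analytic_rep_jet_class:
  assumes "real_analytic f" "smooth f"
  shows "analytic_rep (jet_class p f) = f"
  unfolding analytic_rep_def
  by (rule the_equality) (use assms real_analytic_eqI in \<open>auto simp: jet_class_eq\<close>)

lemma jet_array_derivs_at:
  "jet_array p hbar f R S = ennreal (sqrt (2 * hbar) ^ (mi_abs R + mi_abs S) * cmod (derivs_at p f R S))"
  by (simp add: jet_array_def derivs_at_def)

text \<open>The factor \<open>v\<close> per extra derivative is rewritten as
  \<open>w * sqrt (2 * hbar)\<close>: the square roots complete the scaling of the entry at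
  \<open>R + K\<close> and \<open>S + L\<close>, and \<open>w\<close> becomes the base of the
  weights.\<close>

lemma taylor_term_bound:
  assumes "hbar > 0" "\<And>k. norm (z $ k - p $ k) \<le> v" and w: "w = v / sqrt (2 * hbar)"
  shows "ennreal (sqrt (2 * hbar) ^ (mi_abs R + mi_abs S) * norm (taylor_term p (\<lambda>K L. derivs_at p f (K + R) (L + S)) (K, L) z))
    \<le> ennreal (mwt w K) * (ennreal (mwt w L) * jet_array p hbar f (R + K) (S + L))"
proof -
  let ?h = "sqrt (2 * hbar)" and ?d = "norm (derivs_at p f (R + K) (S + L))"
  have h: "?h > 0" using assms by simp
  have v: "v \<ge> 0" using assms(2) norm_ge_zero order_trans by blast
  then have "w \<ge> 0" using w h by simp
  have vw: "v ^ k = w ^ k * ?h ^ k" for k using w h by (simp add: power_divide)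
  have "?h ^ (mi_abs R + mi_abs S) * norm (taylor_term p (\<lambda>K L. derivs_at p f (K + R) (L + S)) (K, L) z)
      = ?h ^ (mi_abs R + mi_abs S) * (?d * (mwt 1 K * mwt 1 L)) * (norm (mono_at p K z) * norm (mono_at p L z))"
    by (simp add: taylor_term_def norm_mult add.commute)
  also have "\<dots> \<le> ?h ^ (mi_abs R + mi_abs S) * (?d * (mwt 1 K * mwt 1 L)) * (v ^ mi_abs K * v ^ mi_abs L)"
    using h v by (intro mult_left_mono mult_mono norm_mono_at_le assms(2)) auto
  also have "\<dots> = mwt w K * (mwt w L * (?h ^ (mi_abs (R + K) + mi_abs (S + L)) * ?d))"
    using mwt_mult[of w 1 K] mwt_mult[of w 1 L] by (simp add: vw power_add)
  finally show ?thesis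
    using \<open>w \<ge> 0\<close> h by (simp add: jet_array_derivs_at ennreal_leI flip: ennreal_mult)
qed

text \<open>Taylor's formula for each derivative of \<open>f\<close>, centred at \<open>p\<close>
  and evaluated at \<open>p'\<close>, with absolute values taken termwise.\<close>

lemma jet_array_shift:
  assumes "hbar > 0" "expands p (derivs_at p f) f"
  shows "jet_array p' hbar f R S \<le> dshift (norm (p' - p) / sqrt (2 * hbar)) (jet_array p hbar f) R S"
proof -
  define w where "w = norm (p' - p) / sqrt (2 * hbar)"
  let ?T = "\<lambda>i. taylor_term p (\<lambda>K L. derivs_at p f (K + R) (L + S)) i p'"
  have "(?T has_sum derivs_at p' f R S) UNIV"
    using expands_D[OF assms(2), of R S] by (simp add: expands_def derivs_at_def)
  then have "((\<lambda>i. of_real (sqrt (2 * hbar) ^ (mi_abs R + mi_abs S)) * ?T i) has_sum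
      of_real (sqrt (2 * hbar) ^ (mi_abs R + mi_abs S)) * derivs_at p' f R S) UNIV"
    by (rule has_sum_cmult_right)
  from ennreal_norm_le_infsum[OF this] assms(1)
  have "jet_array p' hbar f R S \<le> (\<Sum>\<^sub>\<infinity>i. ennreal (sqrt (2 * hbar) ^ (mi_abs R + mi_abs S) * norm (?T i)))"
    by (simp add: jet_array_derivs_at norm_mult norm_power)
  also have "\<dots> \<le> (\<Sum>\<^sub>\<infinity>(K, L). ennreal (mwt w K) * (ennreal (mwt w L) * jet_array p hbar f (R + K) (S + L)))"
  proof (rule infsum_mono_ennreal)
    fix i :: "(nat ^ 'a) \<times> (nat ^ 'a)"
    have "norm (p' $ k - p $ k) \<le> norm (p' - p)" for k
      using Finite_Cartesian_Product.norm_nth_le[of "p' - p" k] by simp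
    from taylor_term_bound[OF assms(1) this w_def]
    show "ennreal (sqrt (2 * hbar) ^ (mi_abs R + mi_abs S) * norm (?T i))
      \<le> (case i of (K, L) \<Rightarrow> ennreal (mwt w K) * (ennreal (mwt w L) * jet_array p hbar f (R + K) (S + L)))"
      by (cases i) simp
  qed
  also have "\<dots> = dshift w (jet_array p hbar f) R S"
    unfolding dshift_def shift_op_def infsum_cmult_ennreal[symmetric] infsum_Sigma_ennreal UNIV_Times_UNIV ..
  finally show ?thesis unfolding w_def .
qed

section \<open>The common set of analytic representatives\<close>

definition An :: "complex ^ 'n \<Rightarrow> real \<Rightarrow> 'n::finite cfun set" where
  "An p hbar = {f \<in> A_tilde p hbar. real_analytic f}"

lemma wick_h_derivs_cong:
  assumes "hbar > 0" "derivs_at p f = derivs_at p g"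
  shows "wick_h p hbar m l R S f = wick_h p hbar m l R S g"
proof -
  have "jet_array p hbar f = jet_array p hbar g"
    using assms(2) by (simp add: jet_array_derivs_at fun_eq_iff)
  then show ?thesis by (simp add: wick_h_array[OF assms(1)])
qed

lemma wick_seminorm_derivs_cong:
  "hbar > 0 \<Longrightarrow> derivs_at p f = derivs_at p g \<Longrightarrow> wick_seminorm p hbar m l R S f = wick_seminorm p hbar m l R S g"
  unfolding wick_seminorm_def using wick_h_derivs_cong by metis

text \<open>The seminorm with \<open>m = 2\<close> and \<open>l = 1\<close> bounds the weighted sum
  of the derivatives for every base, and the base needed at \<open>z\<close> is proportional to the
  distance from \<open>p\<close>.\<close>

lemma A_tilde_expands:
  assumes "hbar > 0" "f \<in> A_tilde p hbar"
  shows "\<exists>g. expands p (derivs_at p f) g"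
proof -
  have "wick_h p hbar 2 1 0 0 f < \<infinity>"
    using assms(2)[unfolded A_tilde_iff, THEN conjunct2, rule_format, of 1 2 0 0] by simp
  then have fin: "wick_array 2 1 (jet_array p hbar f) 0 0 < top"
    by (simp add: wick_h_array[OF assms(1)])
  have "(\<lambda>i. taylor_term p (derivs_at p f) i z) summable_on UNIV" for z
  proof (rule summable_on_if_ennreal_finite)
    define w where "w = norm (z - p) / sqrt (2 * hbar)"
    have w: "w \<ge> 0" using assms(1) by (simp add: w_def)
    have "(\<Sum>\<^sub>\<infinity>i. ennreal (norm (taylor_term p (derivs_at p f) i z)))
        \<le> (\<Sum>\<^sub>\<infinity>(K, L). ennreal (mwt w K) * (ennreal (mwt w L) * jet_array p hbar f K L))"
    proof (rule infsum_mono_ennreal)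
      fix i :: "(nat ^ 'a) \<times> (nat ^ 'a)"
      have "norm (z $ k - p $ k) \<le> norm (z - p)" for k
        using Finite_Cartesian_Product.norm_nth_le[of "z - p" k] by simp
      from taylor_term_bound[OF assms(1) this w_def, of 0 0 f]
      show "ennreal (norm (taylor_term p (derivs_at p f) i z))
        \<le> (case i of (K, L) \<Rightarrow> ennreal (mwt w K) * (ennreal (mwt w L) * jet_array p hbar f K L))"
        by (cases i) simp
    qed
    also have "\<dots> = psum2 0 w (jet_array p hbar f)"
      unfolding psum2_def psum_def infsum_cmult_ennreal[symmetric] infsum_Sigma_ennreal UNIV_Times_UNIV by simp
    also have "\<dots> < top" by (rule psum2_finite_if_wick_array[OF fin w])
    finally show "(\<Sum>\<^sub>\<infinity>i. ennreal (norm (taylor_term p (derivs_at p f) i z))) < top" .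
  qed
  then show ?thesis unfolding expands_def by (meson has_sum_infsum)
qed

lemma derivs_at_expands: "expands p a g \<Longrightarrow> derivs_at p g = a"
  by (simp add: fun_eq_iff derivs_at_def expands_coeff)

text \<open>The sum of the Taylor series is smooth and has the same derivatives at \<open>p\<close>;
  finiteness of the seminorms depends on these alone.\<close>

lemma analytic_representative:
  assumes "hbar > 0" "f \<in> A_tilde p hbar"
  shows "\<exists>g\<in>An p hbar. derivs_at p g = derivs_at p f"
proof -
  obtain g where g: "expands p (derivs_at p f) g" using A_tilde_expands[OF assms] by blast
  have d: "derivs_at p g = derivs_at p f" by (rule derivs_at_expands[OF g])
  have "g \<in> A_tilde p hbar"
    using assms(2) smooth_expands[OF g] wick_h_derivs_cong[OF assms(1) d] by (simp add: A_tilde_iff)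
  then show ?thesis using real_analytic_expands[OF g] d by (auto simp: An_def)
qed

lemma An_expands:
  assumes "hbar > 0" "f \<in> An p hbar"
  shows "expands p (derivs_at p f) f"
proof -
  obtain g where g: "expands p (derivs_at p f) g"
    using A_tilde_expands[OF assms(1)] assms(2) by (auto simp: An_def)
  have "g = f"
    using assms(2) smooth_expands[OF g] real_analytic_expands[OF g] derivs_at_expands[OF g]
    by (intro real_analytic_eqI[where p = p]) (auto simp: An_def A_tilde_iff)
  then show ?thesis using g by simp
qed

lemma An_real_analytic: "f \<in> An p hbar \<Longrightarrow> real_analytic f"
  and An_smooth: "f \<in> An p hbar \<Longrightarrow> smooth f"
  and An_A_tilde: "f \<in> An p hbar \<Longrightarrow> f \<in> A_tilde p hbar"
  by (simp_all add: An_def A_tilde_def)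

lemma An_diff: "hbar > 0 \<Longrightarrow> f \<in> An p hbar \<Longrightarrow> g \<in> An p hbar \<Longrightarrow> (\<lambda>z. f z - g z) \<in> An p hbar"
  by (simp add: An_def A_tilde_diff real_analytic_diff)

text \<open>The constant is uniform in \<open>f\<close>, which serves both the inclusion of the
  carriers and the comparison of the topologies.\<close>

lemma wick_h_translate:
  fixes p p' :: "complex ^ 'n"
  assumes "hbar > 0"
  obtains C where "C < top" "\<And>f. f \<in> An p hbar \<Longrightarrow>
    (wick_h p' hbar m l R S f) ^ 4 \<le> C * wick_h p hbar (m + 2) 1 0 0 f"
proof -
  have "norm (p' - p) / sqrt (2 * hbar) \<ge> 0" using assms by simp
  then obtain C where C: "C < top" "\<And>X X' :: nat ^ 'n \<Rightarrow> nat ^ 'n \<Rightarrow> ennreal.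
    (\<And>R S. X' R S \<le> dshift (norm (p' - p) / sqrt (2 * hbar)) X R S) \<Longrightarrow>
      (wick_array m l X' R S) ^ 4 \<le> C * wick_array (m + 2) 1 X 0 0"
    by (rule wick_array_dshift_le[where m = m and l = l and R = R and S = S]) blast
  show ?thesis
    by (rule that[OF C(1)], unfold wick_h_array[OF assms])
       (rule C(2), rule jet_array_shift[OF assms An_expands[OF assms]])
qed

lemma An_subset: "hbar > 0 \<Longrightarrow> An p hbar \<subseteq> An p' hbar"
proof
  fix f assume h: "hbar > 0" and f: "f \<in> An p hbar"
  have "wick_h p' hbar m l R S f < \<infinity>" if "l < 2 ^ m" for m l R S
  proof -
    obtain C where C: "C < top" "(wick_h p' hbar m l R S f) ^ 4 \<le> C * wick_h p hbar (m + 2) 1 0 0 f"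
      using wick_h_translate[OF h] f by metis
    have "(1::nat) < 2 ^ (m + 2)" by (rule one_less_power) auto
    then have "wick_h p hbar (m + 2) 1 0 0 f < \<infinity>"
      using An_A_tilde[OF f] unfolding A_tilde_iff by blast
    then have "C * wick_h p hbar (m + 2) 1 0 0 f < top" using C(1) by (simp add: ennreal_mult_less_top)
    then have "(wick_h p' hbar m l R S f) ^ 4 < top" using C(2) by (rule le_less_trans[rotated])
    then show ?thesis by (simp add: power_less_top_ennreal)
  qed
  then show "f \<in> An p' hbar" using f by (auto simp: An_def A_tilde_iff)
qed

lemma An_eq: "hbar > 0 \<Longrightarrow> An p hbar = An p' hbar"
  using An_subset by blast

lemma carrier_wick_quotient: "hbar > 0 \<Longrightarrow> A_tilde p hbar // jet_rel p = jet_class p ` An p hbar"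
proof
  assume h: "hbar > 0"
  show "A_tilde p hbar // jet_rel p \<subseteq> jet_class p ` An p hbar"
  proof
    fix X assume "X \<in> A_tilde p hbar // jet_rel p"
    then obtain f where f: "f \<in> A_tilde p hbar" "X = jet_class p f" by (auto simp: quotient_def jet_class_def)
    obtain g where "g \<in> An p hbar" "derivs_at p g = derivs_at p f" using analytic_representative[OF h f(1)] by blast
    moreover have "smooth f" using f(1) by (simp add: A_tilde_def)
    ultimately have "X = jet_class p g" using f(2) jet_class_eq_iff An_smooth by metis
    then show "X \<in> jet_class p ` An p hbar" using \<open>g \<in> An p hbar\<close> by blast
  qed
  show "jet_class p ` An p hbar \<subseteq> A_tilde p hbar // jet_rel p"
    by (auto simp: quotient_def jet_class_def An_def)
qed

lemma analytic_rep_An: "f \<in> An p hbar \<Longrightarrow> analytic_rep (jet_class q f) = f"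
  by (intro analytic_rep_jet_class An_real_analytic An_smooth)

lemma analytic_rep_carrier: "hbar > 0 \<Longrightarrow> analytic_rep ` (A_tilde p hbar // jet_rel p) = An p hbar"
  unfolding carrier_wick_quotient image_image by (simp add: analytic_rep_An)

section \<open>The common topology\<close>

definition An_topology :: "complex ^ 'n \<Rightarrow> real \<Rightarrow> 'n::finite cfun topology" where
  "An_topology p hbar = pullback_topology (An p hbar) (jet_class p) (quot_topology p hbar)"

definition An_ball where
  "An_ball p hbar m l R S f \<epsilon> = {g \<in> An p hbar. wick_seminorm p hbar m l R S (\<lambda>z. g z - f z) < ennreal \<epsilon>}"

text \<open>The seminorm sees only the derivatives at \<open>p\<close>, so passing to another
  representative of the same class does not leave the ball. The centre may be any element of
  \<open>A_tilde\<close>.\<close>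

lemma vimage_jet_class_ball:
  assumes h: "hbar > 0" and f: "f \<in> A_tilde p hbar"
  shows "jet_class p -` (jet_class p ` A_ball p hbar m l R S f \<epsilon>) \<inter> An p hbar = An_ball p hbar m l R S f \<epsilon>"
proof (intro equalityI subsetI)
  fix g assume "g \<in> jet_class p -` (jet_class p ` A_ball p hbar m l R S f \<epsilon>) \<inter> An p hbar"
  then obtain g' where g: "g \<in> An p hbar" "jet_class p g = jet_class p g'" "g' \<in> A_ball p hbar m l R S f \<epsilon>" by blast
  then have d: "derivs_at p g = derivs_at p g'" and sm: "smooth g" "smooth g'" "smooth f"
    using jet_class_eq_iff An_smooth f by (metis, metis An_smooth, auto simp: A_ball_def A_tilde_def)
  have D: "derivs_at p (\<lambda>z. u z - f z) R S = derivs_at p u R S - derivs_at p f R S" if "smooth u" for u R S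
    using D_lincomb[OF that sm(3), of R S 1 "-1"] by (simp add: derivs_at_def)
  have "derivs_at p (\<lambda>z. g z - f z) = derivs_at p (\<lambda>z. g' z - f z)"
    using d sm by (simp add: D fun_eq_iff)
  then show "g \<in> An_ball p hbar m l R S f \<epsilon>"
    using g wick_seminorm_derivs_cong[OF h, of p "\<lambda>z. g z - f z" "\<lambda>z. g' z - f z" m l R S]
    unfolding An_ball_def A_ball_def by simp
next
  fix g assume "g \<in> An_ball p hbar m l R S f \<epsilon>"
  then show "g \<in> jet_class p -` (jet_class p ` A_ball p hbar m l R S f \<epsilon>) \<inter> An p hbar"
    by (auto simp: An_ball_def A_ball_def An_def)
qed

lemma openin_An_ball:
  assumes "hbar > 0" "f \<in> A_tilde p hbar" "l < 2 ^ m" "\<epsilon> > 0"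
  shows "openin (An_topology p hbar) (An_ball p hbar m l R S f \<epsilon>)"
proof -
  have "openin (quot_topology p hbar) (jet_class p ` A_ball p hbar m l R S f \<epsilon>)"
    unfolding quot_topology_def using assms(2-4) by (intro topology_generated_by_Basis) blast
  then show ?thesis
    unfolding An_topology_def openin_pullback_topology
    using vimage_jet_class_ball[OF assms(1,2)] by metis
qed

lemma wick_seminorm_zero:
  fixes p :: "complex ^ 'n"
  assumes h: "hbar > 0"
  shows "wick_seminorm p hbar m l R S (\<lambda>z. 0) = 0"
proof -
  have sm: "smooth (\<lambda>z :: complex ^ 'n. 0)" by (rule smooth_const)
  have "jet_array p hbar (\<lambda>z. 0) = (\<lambda>R S. 0 * 0)"
    using D_lincomb[OF sm sm, of _ _ 0 0] by (simp add: jet_array_def fun_eq_iff)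
  then have "wick_array m l (jet_array p hbar (\<lambda>z. 0)) R S = 0 ^ (2 ^ Suc m) * wick_array m l (\<lambda>_ _. 0) R S"
    by (simp only: wick_array_cmult)
  also have "\<dots> = 0" by (subst zero_power) simp_all
  finally show ?thesis by (simp add: wick_seminorm_def wick_h_array[OF h])
qed

text \<open>By convexity a smaller ball at \<open>p'\<close> around a point \<open>g\<close> fits
  into the given one, and by the fourth-power estimate a ball at \<open>p\<close> around
  \<open>g\<close> fits into that. The estimate applies to \<open>k - g\<close> because both
  functions lie in the common set \<open>An\<close>.\<close>

lemma openin_An_ball_translate:
  fixes p p' :: "complex ^ 'n"
  assumes h: "hbar > 0" and f: "f \<in> A_tilde p' hbar" and l: "l < 2 ^ m" and \<epsilon>: "\<epsilon> > 0"
  shows "openin (An_topology p hbar) (An_ball p' hbar m l R S f \<epsilon>)"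
proof (subst openin_subopen, intro ballI)
  fix g assume "g \<in> An_ball p' hbar m l R S f \<epsilon>"
  then have g: "g \<in> An p' hbar" "wick_h p' hbar m l R S (\<lambda>z. g z - f z) < ennreal (\<epsilon> ^ (2 ^ Suc m))"
    by (auto simp: An_ball_def wick_seminorm_less_iff[OF \<epsilon>])
  have gp: "g \<in> An p hbar" using g(1) An_eq[OF h] by blast
  have "smooth f" using f by (simp add: A_tilde_def)
  from wick_h_ball_open[OF this An_smooth[OF gp] h g(2)]
  obtain \<eta> where \<eta>: "\<eta> > 0" "\<And>k. smooth k \<Longrightarrow> wick_h p' hbar m l R S (\<lambda>z. k z - g z) < ennreal \<eta> \<Longrightarrow>
    wick_h p' hbar m l R S (\<lambda>z. k z - f z) < ennreal (\<epsilon> ^ (2 ^ Suc m))" by blast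
  obtain C where C: "C < top" "\<And>f. f \<in> An p hbar \<Longrightarrow>
    (wick_h p' hbar m l R S f) ^ 4 \<le> C * wick_h p hbar (m + 2) 1 0 0 f"
    using wick_h_translate[OF h] by metis
  obtain c where c: "C = ennreal c" "c \<ge> 0" using C(1) by (cases C) auto
  define q where "q = (2 ^ Suc (m + 2) :: nat)"
  \<comment> \<open>The bound 1 gives \<open>\<delta> ^ q \<le> \<delta>\<close>; dividing by
    \<open>c + 1\<close> makes \<open>c * \<delta>\<close> strictly smaller than
    \<open>\<eta> ^ 4\<close> and covers \<open>c = 0\<close>.\<close>
  define \<delta> where "\<delta> = min 1 (\<eta> ^ 4 / (c + 1))"
  have \<delta>: "\<delta> > 0" "\<delta> \<le> 1" using \<eta>(1) c(2) by (auto simp: \<delta>_def)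
  have "c * \<delta> ^ q < \<eta> ^ 4"
  proof -
    have "\<delta> ^ q \<le> \<delta>" using \<delta> power_le_one_iff power_decreasing[of 1 q \<delta>] by (simp add: q_def)
    also have "\<dots> \<le> \<eta> ^ 4 / (c + 1)" by (simp add: \<delta>_def)
    finally have "c * \<delta> ^ q \<le> c * (\<eta> ^ 4 / (c + 1))" using c(2) by (rule mult_left_mono)
    also have "\<dots> < \<eta> ^ 4" using \<eta>(1) c(2) by (simp add: field_simps)
    finally show ?thesis .
  qed
  have l': "(1::nat) < 2 ^ (m + 2)" by (rule one_less_power) auto
  show "\<exists>W. openin (An_topology p hbar) W \<and> g \<in> W \<and> W \<subseteq> An_ball p' hbar m l R S f \<epsilon>"
  proof (intro exI conjI subsetI)
    show "openin (An_topology p hbar) (An_ball p hbar (m + 2) 1 0 0 g \<delta>)"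
      using An_A_tilde[OF gp] l' \<delta>(1) by (rule openin_An_ball[OF h])
    show "g \<in> An_ball p hbar (m + 2) 1 0 0 g \<delta>"
      using gp \<delta>(1) by (simp add: An_ball_def wick_seminorm_zero[OF h])
    fix k assume "k \<in> An_ball p hbar (m + 2) 1 0 0 g \<delta>"
    then have k: "k \<in> An p hbar" "wick_h p hbar (m + 2) 1 0 0 (\<lambda>z. k z - g z) < ennreal (\<delta> ^ q)"
      by (auto simp: An_ball_def wick_seminorm_less_iff[OF \<delta>(1)] q_def)
    have "(wick_h p' hbar m l R S (\<lambda>z. k z - g z)) ^ 4 \<le> C * wick_h p hbar (m + 2) 1 0 0 (\<lambda>z. k z - g z)"
      by (rule C(2)[OF An_diff[OF h k(1) gp]])
    also have "\<dots> \<le> ennreal c * ennreal (\<delta> ^ q)"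
      unfolding c(1) using k(2) by (intro mult_left_mono) auto
    also have "\<dots> = ennreal (c * \<delta> ^ q)" using c \<delta> by (simp add: ennreal_mult)
    also have "\<dots> < ennreal (\<eta> ^ 4)"
      using \<open>c * \<delta> ^ q < \<eta> ^ 4\<close> zero_less_power[OF \<eta>(1), of 4] by (intro ennreal_lessI)
    finally have "(wick_h p' hbar m l R S (\<lambda>z. k z - g z)) ^ 4 < (ennreal \<eta>) ^ 4"
      using \<eta>(1) by (simp add: ennreal_power)
    then have "wick_h p' hbar m l R S (\<lambda>z. k z - g z) < ennreal \<eta>"
      by (metis not_less power_mono zero_le)
    then have "wick_h p' hbar m l R S (\<lambda>z. k z - f z) < ennreal (\<epsilon> ^ (2 ^ Suc m))"
      using \<eta>(2) An_smooth[OF k(1)] by blast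
    then show "k \<in> An_ball p' hbar m l R S f \<epsilon>"
      using k(1) An_eq[OF h] by (auto simp: An_ball_def wick_seminorm_less_iff[OF \<epsilon>])
  qed
qed

text \<open>Every class lies in a ball around its own representative, so the generating sets cover
  the carrier.\<close>

lemma topspace_quot_topology:
  "hbar > 0 \<Longrightarrow> topspace (quot_topology p hbar) = jet_class p ` An p hbar"
proof (intro equalityI subsetI)
  assume h: "hbar > 0"
  fix X assume "X \<in> topspace (quot_topology p hbar)"
  then obtain f where "X = jet_class p f" "f \<in> A_tilde p hbar"
    unfolding quot_topology_def topology_generated_by_topspace by (auto simp: A_ball_def)
  then show "X \<in> jet_class p ` An p hbar"
    unfolding carrier_wick_quotient[OF h, symmetric] by (auto simp: quotient_def jet_class_def)
next
  assume h: "hbar > 0"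
  fix X assume "X \<in> jet_class p ` An p hbar"
  then obtain f where f: "X = jet_class p f" "f \<in> A_tilde p hbar" by (auto simp: An_def)
  have "wick_seminorm p hbar 0 0 0 0 (\<lambda>z. f z - f z) = 0"
    by (simp add: wick_seminorm_zero[OF h])
  then have "X \<in> jet_class p ` A_ball p hbar 0 0 0 0 f 1"
    using f by (auto simp: A_ball_def)
  moreover have "jet_class p ` A_ball p hbar 0 0 0 0 f 1 \<in> {jet_class p ` A_ball p hbar m l R S f \<epsilon> | m l R S f \<epsilon>.
        l < 2 ^ m \<and> f \<in> A_tilde p hbar \<and> \<epsilon> > 0}"
    using f(2) by (intro CollectI exI[of _ 0] exI[of _ f] exI[of _ "1::real"]) auto
  ultimately show "X \<in> topspace (quot_topology p hbar)"
    unfolding quot_topology_def topology_generated_by_topspace by (rule UnionI[rotated])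
qed

text \<open>Preimages commute with the operations that generate the topology, so only the balls have
  to be checked.\<close>

lemma An_topology_le:
  assumes h: "hbar > 0" and U: "openin (An_topology p' hbar) U"
  shows "openin (An_topology p hbar) U"
proof -
  obtain V where V: "openin (quot_topology p' hbar) V" "U = jet_class p' -` V \<inter> An p' hbar"
    using U unfolding An_topology_def openin_pullback_topology by blast
  have "openin (An_topology p hbar) (jet_class p' -` V \<inter> An p' hbar)"
    using V(1)[unfolded quot_topology_def openin_topology_generated_by_iff]
  proof induction
    case (Int a b)
    have "jet_class p' -` (a \<inter> b) \<inter> An p' hbar = (jet_class p' -` a \<inter> An p' hbar) \<inter> (jet_class p' -` b \<inter> An p' hbar)"
      by blast
    then show ?case using Int.IH by auto
  next
    case (UN K)
    have *: "jet_class p' -` (\<Union>K) \<inter> An p' hbar = (\<Union>k\<in>K. jet_class p' -` k \<inter> An p' hbar)" by blast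
    show ?case unfolding * by (rule openin_Union) (use UN.IH in auto)
  next
    case (Basis s)
    then obtain m l R S f \<epsilon> where "s = jet_class p' ` A_ball p' hbar m l R S f \<epsilon>" "l < 2 ^ m" "f \<in> A_tilde p' hbar" "\<epsilon> > 0"
      by blast
    then show ?case using vimage_jet_class_ball[OF h] openin_An_ball_translate[OF h] by metis
  qed simp
  then show ?thesis using V(2) by simp
qed

lemma An_topology_eq: "hbar > 0 \<Longrightarrow> An_topology p hbar = An_topology p' hbar"
  unfolding topology_eq using An_topology_le by blast

lemma topspace_An_topology: "hbar > 0 \<Longrightarrow> topspace (An_topology p hbar) = An p hbar"
  unfolding An_topology_def topspace_pullback_topology topspace_quot_topology by blast

section \<open>Separation, limits and the transported operations\<close>

lemma Hausdorff_An_topology: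
  assumes h: "hbar > 0"
  shows "Hausdorff_space (An_topology p hbar)"
  unfolding Hausdorff_space_def topspace_An_topology[OF h]
proof (intro allI impI)
  fix f g assume fg: "f \<in> An p hbar \<and> g \<in> An p hbar \<and> f \<noteq> g"
  then have sm: "smooth f" "smooth g" using An_smooth by blast+
  have "derivs_at p f \<noteq> derivs_at p g"
    using fg sm real_analytic_eqI An_real_analytic by metis
  then obtain R S where RS: "derivs_at p f R S \<noteq> derivs_at p g R S" by (auto simp: fun_eq_iff)
  \<comment> \<open>The level \<open>m = 0\<close> already separates points: it dominates the square
    of each scaled derivative.\<close>
  define x where "x = wick_h p hbar 0 0 R S (\<lambda>z. g z - f z)"
  have "derivs_at p (\<lambda>z. g z - f z) R S \<noteq> 0"
    using D_lincomb[OF sm(2,1), of R S 1 "-1"] RS by (simp add: derivs_at_def)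
  then have "0 < jet_array p hbar (\<lambda>z. g z - f z) R S"
    using h by (simp add: jet_array_derivs_at)
  then have "0 < (jet_array p hbar (\<lambda>z. g z - f z) R S) ^ (2 ^ Suc 0)"
    by (simp add: zero_less_iff_neq_zero)
  also have "\<dots> \<le> x" unfolding x_def wick_h_array[OF h] by (rule power_le_wick_array)
  finally have "x > 0" .
  moreover have "x < \<infinity>"
    unfolding x_def using An_A_tilde[OF An_diff[OF h]] fg unfolding A_tilde_iff by (metis less_numeral_extra(1) power_0)
  ultimately obtain r where r: "x = ennreal r" "r > 0" by (cases x) auto
  \<comment> \<open>At level 0 the seminorm is a square root, and convexity with
    \<open>t = 1/2\<close> has both constants equal to 2; a common point of the two balls would give
    \<open>x < 2 * (r / 4) + 2 * (r / 4) = r\<close>.\<close>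
  define e where "e = sqrt (r / 4)"
  have e: "e > 0" "e ^ (2 ^ Suc 0) = r / 4" using r by (auto simp: e_def)
  have disj: "An_ball p hbar 0 0 R S f e \<inter> An_ball p hbar 0 0 R S g e = {}"
  proof (rule ccontr)
    assume "An_ball p hbar 0 0 R S f e \<inter> An_ball p hbar 0 0 R S g e \<noteq> {}"
    then obtain k where "k \<in> An_ball p hbar 0 0 R S f e" "k \<in> An_ball p hbar 0 0 R S g e" by blast
    then have k: "k \<in> An p hbar"
      "wick_h p hbar 0 0 R S (\<lambda>z. k z - f z) < ennreal (r / 4)"
      "wick_h p hbar 0 0 R S (\<lambda>z. k z - g z) < ennreal (r / 4)"
      unfolding An_ball_def mem_Collect_eq wick_seminorm_less_iff[OF e(1)] e(2) by blast+
    have "jet_array p hbar (\<lambda>z. g z - k z) R' S' = jet_array p hbar (\<lambda>z. k z - g z) R' S'" for R' S'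
      using D_lincomb[OF sm(2) An_smooth[OF k(1)], of R' S' 1 "-1"] D_lincomb[OF An_smooth[OF k(1)] sm(2), of R' S' 1 "-1"]
      by (simp add: jet_array_def norm_minus_commute)
    then have "wick_h p hbar 0 0 R S (\<lambda>z. g z - k z) = wick_h p hbar 0 0 R S (\<lambda>z. k z - g z)"
      unfolding wick_h_array[OF h] by presburger
    then have "x \<le> ennreal 2 * wick_h p hbar 0 0 R S (\<lambda>z. k z - f z) + ennreal 2 * wick_h p hbar 0 0 R S (\<lambda>z. k z - g z)"
      using wick_h_diff_le[OF sm(1) An_smooth[OF k(1)] sm(2) h, of "1/2" p 0 0 R S] unfolding x_def
      by (simp add: power2_eq_square del: wick_h.simps)
    also have "\<dots> < ennreal 2 * ennreal (r / 4) + ennreal 2 * ennreal (r / 4)"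
      using k(2,3) by (intro add_strict_mono ennreal_mult_strict_left_mono) auto
    also have "\<dots> = ennreal (2 * (r / 4) + 2 * (r / 4))"
      using r(2) by (simp only: ennreal_mult ennreal_plus)
    also have "2 * (r / 4) + 2 * (r / 4) = r" by simp
    finally show False using r(1) by simp
  qed
  show "\<exists>U V. openin (An_topology p hbar) U \<and> openin (An_topology p hbar) V \<and> f \<in> U \<and> g \<in> V \<and> disjnt U V"
  proof (intro exI conjI)
    show "openin (An_topology p hbar) (An_ball p hbar 0 0 R S f e)" "openin (An_topology p hbar) (An_ball p hbar 0 0 R S g e)"
      using fg An_A_tilde e(1) by (auto intro!: openin_An_ball[OF h])
    show "f \<in> An_ball p hbar 0 0 R S f e" "g \<in> An_ball p hbar 0 0 R S g e"
      using fg e(1) by (auto simp: An_ball_def wick_seminorm_zero[OF h])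
  qed (simp add: disjnt_def disj)
qed

text \<open>The partial sums of a star product are not known in advance to lie in \<open>An\<close>,
  so the sequence is any family of smooth real-analytic functions; convergence in the quotient
  forces eventual membership.\<close>

lemma limitin_quot_iff:
  assumes h: "hbar > 0" and s: "\<And>i. real_analytic (s i)" "\<And>i. smooth (s i)"
  shows "limitin (quot_topology p hbar) (\<lambda>i. jet_class p (s i)) L F \<longleftrightarrow>
    (\<exists>f. L = jet_class p f \<and> limitin (An_topology p hbar) s f F)"
proof
  assume lim: "limitin (quot_topology p hbar) (\<lambda>i. jet_class p (s i)) L F"
  then obtain f where f: "L = jet_class p f" "f \<in> An p hbar"
    unfolding limitin_def topspace_quot_topology[OF h] by blast
  have "\<forall>\<^sub>F i in F. s i \<in> U" if U: "openin (An_topology p hbar) U" "f \<in> U" for U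
  proof -
    obtain V where V: "openin (quot_topology p hbar) V" "U = jet_class p -` V \<inter> An p hbar"
      using U(1) unfolding An_topology_def openin_pullback_topology by blast
    have "L \<in> V" using V(2) U(2) f(1) by simp
    then have "\<forall>\<^sub>F i in F. jet_class p (s i) \<in> V"
      using lim V(1) unfolding limitin_def by simp
    then show ?thesis
    proof (rule eventually_mono)
      fix i assume i: "jet_class p (s i) \<in> V"
      \<comment> \<open>An open set is contained in the underlying space, so the class of
        \<open>s i\<close> has a representative in \<open>An\<close>; uniqueness of analytic
        representatives identifies it with \<open>s i\<close>.\<close>
      then obtain g where g: "g \<in> An p hbar" "jet_class p (s i) = jet_class p g"
        using openin_subset[OF V(1)] topspace_quot_topology[OF h] by blast
      have "s i = analytic_rep (jet_class p (s i))"
        by (rule analytic_rep_jet_class[OF s(1)[of i] s(2)[of i], symmetric])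
      also have "\<dots> = g" unfolding g(2) by (rule analytic_rep_An[OF g(1)])
      finally show "s i \<in> U" using V(2) i g(1) by simp
    qed
  qed
  then have "limitin (An_topology p hbar) s f F"
    using f(2) by (simp add: limitin_def topspace_An_topology[OF h])
  then show "\<exists>f. L = jet_class p f \<and> limitin (An_topology p hbar) s f F" using f(1) by blast
next
  assume "\<exists>f. L = jet_class p f \<and> limitin (An_topology p hbar) s f F"
  then obtain f where f: "L = jet_class p f" "limitin (An_topology p hbar) s f F" by blast
  then have fA: "f \<in> An p hbar" by (simp add: limitin_def topspace_An_topology[OF h])
  show "limitin (quot_topology p hbar) (\<lambda>i. jet_class p (s i)) L F"
    unfolding limitin_def
  proof (intro conjI allI impI)
    show "L \<in> topspace (quot_topology p hbar)" using f(1) fA topspace_quot_topology[OF h] by blast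
    fix V assume V: "openin (quot_topology p hbar) V \<and> L \<in> V"
    then have "openin (An_topology p hbar) (jet_class p -` V \<inter> An p hbar)"
      unfolding An_topology_def openin_pullback_topology by blast
    moreover have "f \<in> jet_class p -` V \<inter> An p hbar" using V f(1) fA by simp
    ultimately have "\<forall>\<^sub>F i in F. s i \<in> jet_class p -` V \<inter> An p hbar"
      using f(2) unfolding limitin_def by blast
    then show "\<forall>\<^sub>F i in F. jet_class p (s i) \<in> V" by (rule eventually_mono) simp
  qed
qed

text \<open>If the limit does not exist, both sides are the same junk value.\<close>

lemma analytic_rep_limit_eq:
  assumes h: "hbar > 0" and s: "\<And>i. real_analytic (s i)" "\<And>i. smooth (s i)" and F: "F \<noteq> bot"
  shows "analytic_rep (THE L. limitin (quot_topology p hbar) (\<lambda>i. jet_class p (s i)) L F)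
    = analytic_rep (THE L. limitin (quot_topology p' hbar) (\<lambda>i. jet_class p' (s i)) L F)"
proof (cases "\<exists>f. limitin (An_topology p hbar) s f F")
  case True
  then obtain f where f: "limitin (An_topology p hbar) s f F" by blast
  have fA: "f \<in> An p hbar" using f by (simp add: limitin_def topspace_An_topology[OF h])
  have "(THE L. limitin (quot_topology q hbar) (\<lambda>i. jet_class q (s i)) L F) = jet_class q f" for q
    unfolding limitin_quot_iff[OF h s] An_topology_eq[OF h, of q p]
    using f limitin_Hausdorff_unique[OF _ _ F Hausdorff_An_topology[OF h]]
    by (intro the_equality) blast+
  then show ?thesis using analytic_rep_An[OF fA] by simp
next
  case False
  then show ?thesis
    unfolding limitin_quot_iff[OF h s] An_topology_eq[OF h, of p' p] by simp
qed

text \<open>All representatives give the same class, so the union over them is that class. Unary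
  operations are covered by taking \<open>T\<close> constant in its second argument.\<close>

lemma UN_jet_class2:
  assumes "smooth f" "smooth g"
    "\<And>f' g'. smooth f' \<Longrightarrow> smooth g' \<Longrightarrow> flat p (\<lambda>z. f' z - f z) \<Longrightarrow> flat p (\<lambda>z. g' z - g z) \<Longrightarrow>
      smooth (T f' g') \<and> flat p (\<lambda>z. T f' g' z - T f g z)"
  shows "(\<Union>f'\<in>jet_class p f. \<Union>g'\<in>jet_class p g. jet_class p (T f' g')) = jet_class p (T f g)"
proof -
  have fl: "flat p (\<lambda>z. u z - u z)" for u :: "'a cfun" using flat_zero by simp
  have sm: "smooth (T f g)" using assms(3)[OF assms(1,2)] fl by blast
  have "jet_class p (T f' g') = jet_class p (T f g)" if "f' \<in> jet_class p f" "g' \<in> jet_class p g" for f' g'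
  proof -
    have f': "smooth f'" "smooth g'" "flat p (\<lambda>z. f' z - f z)" "flat p (\<lambda>z. g' z - g z)"
      using that derivs_at_eq_flat assms(1,2) by (auto simp: jet_class_eq)
    show ?thesis
      using assms(3)[OF f'] jet_class_eq_iff[OF sm] derivs_at_eq_flat[OF sm] by metis
  qed
  moreover have "f \<in> jet_class p f" "g \<in> jet_class p g" using assms(1,2) by (simp_all add: jet_class_eq)
  ultimately show ?thesis by blast
qed

lemma wick_term_eq:
  "wick_term hbar f g N = (\<lambda>z. (of_real ((2 * hbar) ^ mi_abs N / real (mi_fact N)) * D_gen (- \<i>) N f z) * D_gen \<i> N g z)"
  by (simp add: wick_term_def D_z_eq D_zbar_eq)

lemma smooth_wick_sum: "smooth f \<Longrightarrow> smooth g \<Longrightarrow> smooth (\<lambda>z. \<Sum>N\<in>F. wick_term hbar f g N z)"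
  unfolding wick_term_eq by (intro smooth_sum smooth_mult smooth_cmult smooth_D_gen)

text \<open>Derivatives of entire expansions are entire expansions, and real-analytic functions are
  closed under finite sums and products; the seminorms of the product do not enter.\<close>

lemma real_analytic_wick_sum:
  assumes "expands p a f" "expands p b g"
  shows "real_analytic (\<lambda>z. \<Sum>N\<in>F. wick_term hbar f g N z)"
  unfolding wick_term_eq
  by (intro real_analytic_sum real_analytic_mult real_analytic_cmult
      real_analytic_expands[OF expands_D_gen[OF assms(1)]] real_analytic_expands[OF expands_D_gen_bar[OF assms(2)]])

lemma flat_wick_sum:
  assumes "smooth f" "smooth g" "smooth f'" "smooth g'" "flat p (\<lambda>z. f' z - f z)" "flat p (\<lambda>z. g' z - g z)"
  shows "flat p (\<lambda>z. (\<Sum>N\<in>F. wick_term hbar f' g' N z) - (\<Sum>N\<in>F. wick_term hbar f g N z))"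
proof -
  have D: "D_gen c N (\<lambda>z. u z - v z) = (\<lambda>z. D_gen c N u z - D_gen c N v z)" if "smooth u" "smooth v" for u v c N
    using D_gen_lincomb[OF that, of c N 1 "-1"] by simp
  have d: "flat p (\<lambda>z. D_gen (- \<i>) N f' z - D_gen (- \<i>) N f z)" "flat p (\<lambda>z. D_gen \<i> N g' z - D_gen \<i> N g z)" for N
    using flat_D_gen[OF assms(5)] flat_D_gen[OF assms(6)] by (simp_all add: D assms)
  \<comment> \<open>Telescoping of a product: each summand has a flat factor, and the flat functions
    form an ideal among the smooth ones.\<close>
  have *: "(c * x') * y' - (c * x) * y = c * ((x' - x) * y' + (y' - y) * x)" for c x x' y y' :: complex
    by (simp add: algebra_simps)
  show ?thesis
    unfolding wick_term_eq sum_subtractf[symmetric] *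
    by (intro flat_sum flat_cmult flat_add flat_mult d smooth_D_gen assms)
qed

text \<open>Addition, scaling and involution become pointwise, so apart from their domain no trace
  of \<open>p\<close> is left in them; only the product keeps its defining limit in the
  quotient.\<close>

lemma wick_algebra_eq:
  assumes h: "hbar > 0"
  shows "wick_algebra p hbar = \<lparr> tsa_carrier = An p hbar, tsa_topology = An_topology p hbar,
    tsa_add = (\<lambda>f\<in>An p hbar. \<lambda>g\<in>An p hbar. \<lambda>z. f z + g z),
    tsa_scale = (\<lambda>c. \<lambda>f\<in>An p hbar. \<lambda>z. c * f z),
    tsa_mult = (\<lambda>f\<in>An p hbar. \<lambda>g\<in>An p hbar. analytic_rep (THE L. limitin (quot_topology p hbar)
      (\<lambda>F. jet_class p (\<lambda>z. \<Sum>N\<in>F. wick_term hbar f g N z)) L (finite_subsets_at_top UNIV))),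
    tsa_star = (\<lambda>f\<in>An p hbar. \<lambda>z. cnj (f z)) \<rparr>"
proof -
  have add: "analytic_rep (\<Union>f'\<in>jet_class p f. \<Union>g'\<in>jet_class p g. jet_class p (\<lambda>z. f' z + g' z)) = (\<lambda>z. f z + g z)"
    if "f \<in> An p hbar" "g \<in> An p hbar" for f g
  proof -
    note sm = An_smooth[OF that(1)] An_smooth[OF that(2)]
    have "(\<Union>f'\<in>jet_class p f. \<Union>g'\<in>jet_class p g. jet_class p (\<lambda>z. f' z + g' z)) = jet_class p (\<lambda>z. f z + g z)"
    proof (rule UN_jet_class2[where T = "\<lambda>f g z. f z + g z", OF sm], intro conjI smooth_add)
      fix f' g' assume "flat p (\<lambda>z. f' z - f z)" "flat p (\<lambda>z. g' z - g z)"
      from flat_add[OF this] show "flat p (\<lambda>z. f' z + g' z - (f z + g z))" by (simp add: algebra_simps)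
    qed
    then show ?thesis
      using that by (simp add: analytic_rep_jet_class An_real_analytic real_analytic_add smooth_add sm)
  qed
  have scale: "analytic_rep (\<Union>f'\<in>jet_class p f. jet_class p (\<lambda>z. c * f' z)) = (\<lambda>z. c * f z)"
    if "f \<in> An p hbar" for f c
  proof -
    note sm = An_smooth[OF that]
    \<comment> \<open>The second union is a dummy, removed below because the class is
      nonempty.\<close>
    have "(\<Union>f'\<in>jet_class p f. \<Union>g'\<in>jet_class p f. jet_class p (\<lambda>z. c * f' z)) = jet_class p (\<lambda>z. c * f z)"
    proof (rule UN_jet_class2[where T = "\<lambda>f g z. c * f z", OF sm sm], intro conjI smooth_cmult)
      fix f' assume "flat p (\<lambda>z. f' z - f z)"
      from flat_cmult[OF this] show "flat p (\<lambda>z. c * f' z - c * f z)" by (simp only: algebra_simps)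
    qed
    moreover have "jet_class p f \<noteq> {}" using sm by (auto simp: jet_class_eq)
    ultimately show ?thesis
      using that by (simp add: analytic_rep_jet_class An_real_analytic real_analytic_cmult smooth_cmult sm)
  qed
  have star: "analytic_rep (\<Union>f'\<in>jet_class p f. jet_class p (\<lambda>z. cnj (f' z))) = (\<lambda>z. cnj (f z))"
    if "f \<in> An p hbar" for f
  proof -
    note sm = An_smooth[OF that]
    have "(\<Union>f'\<in>jet_class p f. \<Union>g'\<in>jet_class p f. jet_class p (\<lambda>z. cnj (f' z))) = jet_class p (\<lambda>z. cnj (f z))"
    proof (rule UN_jet_class2[where T = "\<lambda>f g z. cnj (f z)", OF sm sm], intro conjI smooth_cnj)
      fix f' assume "flat p (\<lambda>z. f' z - f z)"
      from flat_cnj[OF this] show "flat p (\<lambda>z. cnj (f' z) - cnj (f z))" by simp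
    qed
    moreover have "jet_class p f \<noteq> {}" using sm by (auto simp: jet_class_eq)
    ultimately show ?thesis
      using that by (simp add: analytic_rep_jet_class An_real_analytic real_analytic_cnj smooth_cnj sm)
  qed
  have mult: "(\<Union>f'\<in>jet_class p f. \<Union>g'\<in>jet_class p g. jet_class p (\<lambda>z. \<Sum>N\<in>F. wick_term hbar f' g' N z))
      = jet_class p (\<lambda>z. \<Sum>N\<in>F. wick_term hbar f g N z)" if "f \<in> An p hbar" "g \<in> An p hbar" for f g F
    using An_smooth[OF that(1)] An_smooth[OF that(2)]
    by (intro UN_jet_class2[where T = "\<lambda>f g z. \<Sum>N\<in>F. wick_term hbar f g N z"] conjI smooth_wick_sum flat_wick_sum)
  show ?thesis
    unfolding wick_algebra_def wick_quotient_def Let_def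
    by (simp add: analytic_rep_carrier[OF h] An_topology_def add scale star mult cong: restrict_cong)
qed

theorem theorem5p5:
  fixes hbar :: real and p p' :: "complex ^ 'n"
  assumes "hbar > 0"
  shows "tsa_carrier (wick_algebra p hbar) \<subseteq> {f. real_analytic f} \<and>
         wick_algebra p hbar = wick_algebra p' hbar"
proof
  show "tsa_carrier (wick_algebra p hbar) \<subseteq> {f. real_analytic f}"
    using An_real_analytic by (auto simp: wick_algebra_eq[OF assms])
  \<comment> \<open>The partial sums are the same functions for both base points; only the quotients
    in which the limits are taken differ, and these match through the representatives.\<close>
  have "analytic_rep (THE L. limitin (quot_topology p hbar)
      (\<lambda>F. jet_class p (\<lambda>z. \<Sum>N\<in>F. wick_term hbar f g N z)) L (finite_subsets_at_top UNIV))
    = analytic_rep (THE L. limitin (quot_topology p' hbar)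
      (\<lambda>F. jet_class p' (\<lambda>z. \<Sum>N\<in>F. wick_term hbar f g N z)) L (finite_subsets_at_top UNIV))"
    if "f \<in> An p hbar" "g \<in> An p hbar" for f g
    using that
    by (intro analytic_rep_limit_eq[OF assms] real_analytic_wick_sum[OF An_expands[OF assms] An_expands[OF assms]]
        smooth_wick_sum) (auto intro: An_smooth)
  then show "wick_algebra p hbar = wick_algebra p' hbar"
    unfolding wick_algebra_eq[OF assms] An_eq[OF assms, of p' p] An_topology_eq[OF assms, of p' p]
    by (simp cong: restrict_cong)
qed

end
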